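(* Let $n\geq 2$. For any positive integer $m$, we have $$\mathfrak{d}_m^{\mathrm{sd}}(\mathfrak{sl}_n)\leq\omega(m)\exp\left(-\frac{n}{36m}\right)$$ and $$\mathfrak{d}_m^{\mathrm{orth}}(\mathfrak{sl}_n)\leq 2\,\omega(m)\exp\left(-\frac{n}{36m}\right).$$
   Context: $\omega(m)$ is the number of distinct prime factors of $m$. For a complex semisimple Lie algebra $\mathfrak{g}$ with weight lattice $\Lambda$ (for a fixed Cartan subalgebra and positive system), let $\rho$ be the half-sum of positive roots, $\rho^\vee$ the half-sum of positive coroots, and $w_0$ the longest Weyl group element. Let $\mathscr{D}:\Lambda\to\mathbb{Z}$ be the Weyl dimension polynomial $$\mathscr{D}(\lambda)=\prod_{\alpha>0}\frac{\langle\lambda+\rho,\alpha^\vee\rangle}{\langle\rho,\alpha^\vee\rangle},$$ which is integer-valued on $\Lambda$ and, for dominant $\lambda$, equals the degree of the irreducible representation of highest weight $\lambda$. Put $$\Lambda_m=\{\lambda\in\Lambda : m\nmid\mathscr{D}(\lambda)\},\quad \Lambda_{\mathrm{sd}}=\{\lambda\in\Lambda : w_0\lambda=-\lambda\},\quad \Lambda_{\mathrm{orth}}=\{\lambda\in\Lambda_{\mathrm{sd}} : \langle\lambda,2\rho^\vee\rangle\text{ is even}\}.$$ (The dominant members of $\Lambda_{\mathrm{sd}}$, resp. $\Lambda_{\mathrm{orth}}$, are the highest weights of the irreducible self-dual, resp. orthogonal, representations.) For a finite-rank free $\mathbb{Z}$-module $L$ and a subset $A\subseteq L$ with $A+\varpi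 L=A$ for some positive integer $\varpi$, put $$\mathfrak{d}(A\mid L)=\lim_{r\to\infty}\frac{\#\{a\in A : N(a)<r\}}{\#\{v\in L : N(v)<r\}},$$ where $N$ is any norm on $L\otimes_{\mathbb{Z}}\mathbb{R}$; the limit exists and is independent of $N$. Define $$\mathfrak{d}_m^{\mathrm{sd}}(\mathfrak{g})=\mathfrak{d}(\Lambda_m\cap\Lambda_{\mathrm{sd}}\mid\Lambda_{\mathrm{sd}}),\qquad \mathfrak{d}_m^{\mathrm{orth}}(\mathfrak{g})=\mathfrak{d}(\Lambda_m\cap\Lambda_{\mathrm{orth}}\mid\Lambda_{\mathrm{orth}}).$$ *)

theory Defs
  imports
    "HOL-Computational_Algebra.Primes"
    "HOL-Library.Function_Algebras"
    "Jordan_Normal_Form.Matrix"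
begin

section \<open>Roots and weights of a complex matrix Lie algebra\<close>

text \<open>
  Throughout, \<open>g\<close> is a semisimple Lie algebra of complex square matrices, \<open>h\<close> a Cartan
  subalgebra of it and \<open>P\<close> a positive system of roots. A linear functional on \<open>h\<close> is
  represented by a function on all matrices that vanishes outside \<open>h\<close>, so that equality of
  functionals is equality of functions; addition and negation of functionals are the
  pointwise ones from \<open>Function_Algebras\<close>.
\<close>

type_synonym functional = "complex mat \<Rightarrow> complex"

definition lie_bracket :: "complex mat \<Rightarrow> complex mat \<Rightarrow> complex mat" where
  "lie_bracket X Y = X * Y - Y * X"

definition dual_space :: "complex mat set \<Rightarrow> functional set" where
  "dual_space h = {f. (\<forall>A\<in>h. \<forall>B\<in>h. f (A + B) = f A + f B) \<and>
                      (\<forall>c. \<forall>A\<in>h. f (c \<cdot>\<^sub>m A) = c * f A) \<and>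
                      (\<forall>A. A \<notin> h \<longrightarrow> f A = 0)}"

definition root_space :: "complex mat set \<Rightarrow> complex mat set \<Rightarrow> functional \<Rightarrow> complex mat set" where
  "root_space g h \<alpha> = {X \<in> g. \<forall>H\<in>h. lie_bracket H X = \<alpha> H \<cdot>\<^sub>m X}"

definition roots :: "complex mat set \<Rightarrow> complex mat set \<Rightarrow> functional set" where
  "roots g h = {\<alpha> \<in> dual_space h. \<alpha> \<noteq> 0 \<and>
                  (\<exists>X\<in>root_space g h \<alpha>. X \<noteq> 0\<^sub>m (dim_row X) (dim_col X))}"

text \<open>
  The coroot of \<open>\<alpha>\<close> is the element of the line \<open>[g\<^sub>\<alpha>, g\<^sub>-\<^sub>\<alpha>]\<close> on which \<open>\<alpha>\<close> takes the value 2.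
  As the root spaces are lines, every element of that line is a single bracket. The pairing
  of a functional with an element of \<open>h\<close> is evaluation.
\<close>

definition coroot :: "complex mat set \<Rightarrow> complex mat set \<Rightarrow> functional \<Rightarrow> complex mat" where
  "coroot g h \<alpha> = (THE H. H \<in> h \<and> \<alpha> H = 2 \<and>
     (\<exists>X\<in>root_space g h \<alpha>. \<exists>Y\<in>root_space g h (- \<alpha>). H = lie_bracket X Y))"

definition weight_lattice :: "complex mat set \<Rightarrow> complex mat set \<Rightarrow> functional set" where
  "weight_lattice g h = {\<mu> \<in> dual_space h. \<forall>\<alpha>\<in>roots g h. \<mu> (coroot g h \<alpha>) \<in> \<int>}"

definition half_sum_roots :: "functional set \<Rightarrow> functional" where
  "half_sum_roots P = (\<lambda>H. (\<Sum>\<alpha>\<in>P. \<alpha> H) / 2)"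

definition half_sum_coroots ::
    "nat \<Rightarrow> complex mat set \<Rightarrow> complex mat set \<Rightarrow> functional set \<Rightarrow> complex mat" where
  "half_sum_coroots n g h P = mat n n (\<lambda>ij. (\<Sum>\<alpha>\<in>P. coroot g h \<alpha> $$ ij) / 2)"

text \<open>
  The Weyl dimension polynomial takes integer values on weights; it is written here as a
  complex number because the pairing of weights and coroots is complex-valued.
\<close>

definition weyl_dim ::
    "complex mat set \<Rightarrow> complex mat set \<Rightarrow> functional set \<Rightarrow> functional \<Rightarrow> complex" where
  "weyl_dim g h P \<mu> =
     (\<Prod>\<alpha>\<in>P. (\<mu> + half_sum_roots P) (coroot g h \<alpha>) / half_sum_roots P (coroot g h \<alpha>))"

subsection \<open>The longest element of the Weyl group\<close>

text \<open>
  Elements of the Weyl group are maps on all functions, equal to the identity outside the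
  dual space of \<open>h\<close>.
\<close>

definition reflection ::
    "complex mat set \<Rightarrow> complex mat set \<Rightarrow> functional \<Rightarrow> functional \<Rightarrow> functional" where
  "reflection g h \<alpha> \<mu> =
     (if \<mu> \<in> dual_space h then (\<lambda>H. \<mu> H - \<mu> (coroot g h \<alpha>) * \<alpha> H) else \<mu>)"

definition reflection_word ::
    "complex mat set \<Rightarrow> complex mat set \<Rightarrow> functional list \<Rightarrow> functional \<Rightarrow> functional" where
  "reflection_word g h \<alpha>s = foldr (\<circ>) (map (reflection g h) \<alpha>s) id"

definition weyl_group ::
    "complex mat set \<Rightarrow> complex mat set \<Rightarrow> (functional \<Rightarrow> functional) set" where
  "weyl_group g h = {reflection_word g h \<alpha>s | \<alpha>s. set \<alpha>s \<subseteq> roots g h}"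

definition simple_roots :: "functional set \<Rightarrow> functional set" where
  "simple_roots P = {\<alpha> \<in> P. \<not> (\<exists>\<beta>\<in>P. \<exists>\<gamma>\<in>P. \<alpha> = \<beta> + \<gamma>)}"

definition weyl_length ::
    "complex mat set \<Rightarrow> complex mat set \<Rightarrow> functional set \<Rightarrow> (functional \<Rightarrow> functional) \<Rightarrow> nat" where
  "weyl_length g h P w =
     (LEAST k. \<exists>\<alpha>s. length \<alpha>s = k \<and> set \<alpha>s \<subseteq> simple_roots P \<and> w = reflection_word g h \<alpha>s)"

definition longest_element ::
    "complex mat set \<Rightarrow> complex mat set \<Rightarrow> functional set \<Rightarrow> functional \<Rightarrow> functional" where
  "longest_element g h P =
     (THE w. w \<in> weyl_group g h \<and>
        (\<forall>v\<in>weyl_group g h. weyl_length g h P v \<le> weyl_length g h P w))"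

subsection \<open>The sets of weights\<close>

definition weights_not_div ::
    "nat \<Rightarrow> complex mat set \<Rightarrow> complex mat set \<Rightarrow> functional set \<Rightarrow> functional set" where
  "weights_not_div m g h P =
     {\<mu> \<in> weight_lattice g h. \<not> (\<exists>k::int. weyl_dim g h P \<mu> = of_nat m * of_int k)}"

definition weights_sd ::
    "complex mat set \<Rightarrow> complex mat set \<Rightarrow> functional set \<Rightarrow> functional set" where
  "weights_sd g h P = {\<mu> \<in> weight_lattice g h. longest_element g h P \<mu> = - \<mu>}"

definition weights_orth ::
    "nat \<Rightarrow> complex mat set \<Rightarrow> complex mat set \<Rightarrow> functional set \<Rightarrow> functional set" where
  "weights_orth n g h P =
     {\<mu> \<in> weights_sd g h P. \<exists>k::int. \<mu> (2 \<cdot>\<^sub>m half_sum_coroots n g h P) = 2 * of_int k}"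

section \<open>Density in a lattice\<close>

text \<open>
  For a lattice \<open>L\<close> (a subgroup generated by finitely many functions that are linearly
  independent over the reals), the real span of \<open>L\<close> is \<open>L \<otimes> \<real>\<close>.
\<close>

definition real_span :: "('a \<Rightarrow> complex) set \<Rightarrow> ('a \<Rightarrow> complex) set" where
  "real_span L = {v. \<exists>S c. finite S \<and> S \<subseteq> L \<and>
                       v = (\<lambda>x. \<Sum>u\<in>S. complex_of_real (c u) * u x)}"

definition is_norm_on :: "('a \<Rightarrow> complex) set \<Rightarrow> (('a \<Rightarrow> complex) \<Rightarrow> real) \<Rightarrow> bool" where
  "is_norm_on V N \<longleftrightarrow>
     (\<forall>v\<in>V. 0 \<le> N v \<and> (N v = 0 \<longleftrightarrow> v = 0)) \<and>
     (\<forall>c::real. \<forall>v\<in>V. N (\<lambda>x. complex_of_real c * v x) = \<bar>c\<bar> * N v) \<and>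
     (\<forall>v\<in>V. \<forall>w\<in>V. N (v + w) \<le> N v + N w)"

text \<open>The density is the common value of the limits for all norms.\<close>

definition density :: "('a \<Rightarrow> complex) set \<Rightarrow> ('a \<Rightarrow> complex) set \<Rightarrow> real" where
  "density A L = (THE d. \<forall>N. is_norm_on (real_span L) N \<longrightarrow>
     ((\<lambda>r. real (card {a\<in>A. N a < r}) / real (card {v\<in>L. N v < r})) \<longlongrightarrow> d) at_top)"

definition density_sd ::
    "nat \<Rightarrow> complex mat set \<Rightarrow> complex mat set \<Rightarrow> functional set \<Rightarrow> real" where
  "density_sd m g h P = density (weights_not_div m g h P \<inter> weights_sd g h P) (weights_sd g h P)"

definition density_orth ::
    "nat \<Rightarrow> nat \<Rightarrow> complex mat set \<Rightarrow> complex mat set \<Rightarrow> functional set \<Rightarrow> real" where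
  "density_orth m n g h P =
     density (weights_not_div m g h P \<inter> weights_orth n g h P) (weights_orth n g h P)"

section \<open>The special linear Lie algebra\<close>

definition sl :: "nat \<Rightarrow> complex mat set" where
  "sl n = {A \<in> carrier_mat n n. (\<Sum>i<n. A $$ (i, i)) = 0}"

definition sl_cartan :: "nat \<Rightarrow> complex mat set" where
  "sl_cartan n = {A \<in> sl n. diagonal_mat A}"

text \<open>The standard positive system: the roots whose root spaces are upper triangular.\<close>

definition sl_positive :: "nat \<Rightarrow> functional set" where
  "sl_positive n =
     {\<alpha> \<in> roots (sl n) (sl_cartan n). \<forall>X\<in>root_space (sl n) (sl_cartan n) \<alpha>. upper_triangular X}"

definition sl_density_sd :: "nat \<Rightarrow> nat \<Rightarrow> real" where
  "sl_density_sd m n = density_sd m (sl n) (sl_cartan n) (sl_positive n)"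

definition sl_density_orth :: "nat \<Rightarrow> nat \<Rightarrow> real" where
  "sl_density_orth m n = density_orth m n (sl n) (sl_cartan n) (sl_positive n)"

definition omega :: "nat \<Rightarrow> nat" where
  "omega m = card (prime_factors m)"

end

theory Submission
  imports
    Defs
    "HOL-Number_Theory.Cong"
    "HOL-Combinatorics.Permutations"
    "HOL-Analysis.Function_Topology"
    "HOL-Analysis.Elementary_Normed_Spaces"
begin

text \<open>
  Put \<open>g i = \<Sum>s<i. (x s + 1)\<close>, where \<open>x s\<close> are the Dynkin labels of a weight. The pairings of
  the \<open>\<rho>\<close>-shifted weight with the positive coroots are the differences \<open>g j - g i\<close> for \<open>i < j < n\<close>,
  so the Weyl dimension polynomial is the Vandermonde product of \<open>g\<close> divided by that of the
  identity. Self-dual weights are those with mirror symmetric labels; they form a lattice of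
  rank \<open>k = n div 2\<close>, coordinatised by the labels from the middle outwards.

  The \<open>p\<close>-adic valuation of a Vandermonde product is the sum over \<open>s \<ge> 1\<close> of the number of pairs
  \<open>i < j\<close> that are congruent modulo \<open>p ^ s\<close>. Consecutive integers are equidistributed modulo every
  \<open>p ^ s\<close> and therefore minimise each summand, by convexity of the number of pairs
  (\<open>card_cong_pairs_ge_consecutive\<close>). Once \<open>p ^ s \<ge> n\<close>, they have no congruent pair at all. Let \<open>s0\<close> be
  the least exponent with \<open>p ^ s0 \<ge> n\<close> and \<open>T = p ^ (s0 + e - 1)\<close>. A collision of \<open>g\<close> modulo \<open>T\<close> is a
  collision at each of the \<open>e\<close> levels from \<open>s0\<close> to \<open>s0 + e - 1\<close>, so it forces \<open>p ^ e\<close> to divide the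
  dimension. Hence if \<open>m\<close> does not divide the dimension, then \<open>g\<close> is injective modulo \<open>T\<close> for one of
  the \<open>omega m\<close> prime factors \<open>p\<close> of \<open>m\<close>, with \<open>e\<close> the multiplicity of \<open>p\<close> in \<open>m\<close>, and \<open>T \<le> n * m\<close>
  (\<open>vandermonde_dvd\<close>).

  Injectivity is rare. Choose the labels from the middle outwards: with \<open>t\<close> labels chosen, the next
  one must keep the next value of \<open>g\<close> away from \<open>2 * t\<close> distinct residues modulo \<open>T\<close> (one
  residue if \<open>t = 0\<close>). This gives the proportion at most
  \<open>\<Prod>t<k. exp (- max 1 (2 * t) / T) = exp (- (1 + k * (k - 1)) / T)\<close>, and
  \<open>1 + k * (k - 1) \<ge> n\<^sup>2 / 36\<close> (\<open>card_injective_staircases\<close>, \<open>exponent_bound\<close>).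

  Proportions of residue classes are densities: for every norm, all residue classes
  modulo \<open>M\<close> have asymptotically equally many points in large balls (\<open>density_periodic\<close>).
  The orthogonal weights are those on which an integral linear form is even, so they fill at least
  half of the residue classes, which costs the factor 2.

  The remaining work identifies the Lie theoretic data of \<open>sl n\<close>: the roots are the differences of
  diagonal entries, the coroots are \<open>E\<^sub>i\<^sub>i - E\<^sub>j\<^sub>j\<close>, and the Weyl group is the symmetric group, with
  the number of inversions as length and the order reversal as longest element.
\<close>

section \<open>Divisibility of Vandermonde products\<close>

lemma multiplicity_eq_card_powers:
  fixes p x :: int
  assumes "prime p" "x \<noteq> 0" "multiplicity p x \<le> S"
  shows "multiplicity p x = card {s\<in>{1..S}. p ^ s dvd x}"
proof -
  have "\<not> is_unit p" using assms(1) by (meson not_prime_unit)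
  hence "p ^ s dvd x \<longleftrightarrow> s \<le> multiplicity p x" for s
    using power_dvd_iff_le_multiplicity[of x p s] assms(2) by blast
  hence "{s\<in>{1..S}. p ^ s dvd x} = {s\<in>{1..S}. s \<le> multiplicity p x}" by blast
  also have "\<dots> = {1..multiplicity p x}" using assms(3) by auto
  finally have "{s\<in>{1..S}. p ^ s dvd x} = {1..multiplicity p x}" .
  thus ?thesis by simp
qed

definition index_pairs :: "nat \<Rightarrow> (nat \<times> nat) set" where
  "index_pairs n = {(i, j). i < j \<and> j < n}"

lemma finite_index_pairs [simp]: "finite (index_pairs n)"
  by (rule finite_subset[of _ "{..<n} \<times> {..<n}"]) (auto simp: index_pairs_def)

definition vandermonde :: "(nat \<Rightarrow> int) \<Rightarrow> nat \<Rightarrow> int" where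
  "vandermonde g n = (\<Prod>(i, j)\<in>index_pairs n. g j - g i)"

definition cong_pairs :: "(nat \<Rightarrow> int) \<Rightarrow> nat \<Rightarrow> int \<Rightarrow> (nat \<times> nat) set" where
  "cong_pairs g n Q = {(i, j)\<in>index_pairs n. Q dvd g j - g i}"

definition residue_class :: "(nat \<Rightarrow> int) \<Rightarrow> nat \<Rightarrow> nat \<Rightarrow> nat \<Rightarrow> nat set" where
  "residue_class g n Q c = {i. i < n \<and> g i mod int Q = int c}"

lemma finite_residue_class [simp]: "finite (residue_class g n Q c)"
  by (simp add: residue_class_def)

lemma sum_card_residue_class:
  assumes "Q > 0"
  shows "(\<Sum>c<Q. card (residue_class g n Q c)) = n"
proof -
  have "(\<Union>c<Q. residue_class g n Q c) = {..<n}"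
  proof (intro equalityI subsetI)
    fix i assume "i \<in> {..<n}"
    moreover have "nat (g i mod int Q) < Q" "int (nat (g i mod int Q)) = g i mod int Q"
      using assms by (simp_all add: nat_less_iff)
    ultimately show "i \<in> (\<Union>c<Q. residue_class g n Q c)"
      unfolding residue_class_def by fastforce
  qed (auto simp: residue_class_def)
  moreover have "card (\<Union>c<Q. residue_class g n Q c) = (\<Sum>c<Q. card (residue_class g n Q c))"
    by (rule card_UN_disjoint) (auto simp: residue_class_def)
  ultimately show ?thesis by simp
qed

text \<open>
  The pairs in a common class form the union of the squares \<open>C \<times> C\<close> over the classes \<open>C\<close>: they
  consist of the congruent pairs \<open>i < j\<close>, their mirror images, and the diagonal.
\<close>

lemma sum_card_residue_class_squares:
  assumes "Q > 0"
  shows "(\<Sum>c<Q. card (residue_class g n Q c) ^ 2) = 2 * card (cong_pairs g n (int Q)) + n"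
proof -
  define C where "C = cong_pairs g n (int Q)"
  define D where "D = (\<lambda>i::nat. (i, i)) ` {..<n}"
  define U where "U = (\<Union>c<Q. residue_class g n Q c \<times> residue_class g n Q c)"
  have fC: "finite C" unfolding C_def cong_pairs_def by (rule finite_subset[OF _ finite_index_pairs[of n]]) auto
  have U: "U = C \<union> prod.swap ` C \<union> D"
  proof (intro equalityI subsetI)
    fix x assume "x \<in> U"
    then obtain i j c where x: "x = (i, j)" "i < n" "j < n" "g i mod int Q = int c" "g j mod int Q = int c"
      unfolding U_def residue_class_def by auto
    hence "int Q dvd g j - g i" "int Q dvd g i - g j" by (metis mod_eq_dvd_iff)+
    moreover have "i < j \<or> j < i \<or> i = j" by auto
    ultimately show "x \<in> C \<union> prod.swap ` C \<union> D"
      using x unfolding C_def cong_pairs_def index_pairs_def D_def by (force simp: image_iff)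
  next
    fix x assume a: "x \<in> C \<union> prod.swap ` C \<union> D"
    obtain i j where x: "x = (i, j)" by fastforce
    have ij: "i < n" "j < n" "g i mod int Q = g j mod int Q"
      using a x unfolding C_def cong_pairs_def index_pairs_def D_def by (auto simp: mod_eq_dvd_iff dvd_diff_commute)
    have "nat (g i mod int Q) < Q" "int (nat (g i mod int Q)) = g i mod int Q"
      using assms by (simp_all add: nat_less_iff)
    thus "x \<in> U" using ij x unfolding U_def residue_class_def by force
  qed
  have "card U = (\<Sum>c<Q. card (residue_class g n Q c \<times> residue_class g n Q c))"
    unfolding U_def by (rule card_UN_disjoint) (auto simp: residue_class_def)
  also have "\<dots> = (\<Sum>c<Q. card (residue_class g n Q c) ^ 2)"
    by (simp add: card_cartesian_product power2_eq_square)
  finally have 1: "card U = (\<Sum>c<Q. card (residue_class g n Q c) ^ 2)" .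
  have "card U = card (C \<union> prod.swap ` C) + card D"
    unfolding U by (rule card_Un_disjoint) (use fC in \<open>auto simp: D_def C_def cong_pairs_def index_pairs_def\<close>)
  also have "card (C \<union> prod.swap ` C) = card C + card (prod.swap ` C)"
    by (rule card_Un_disjoint) (use fC in \<open>auto simp: C_def cong_pairs_def index_pairs_def\<close>)
  also have "card (prod.swap ` C) = card C" by (rule card_image) (auto simp: inj_on_def)
  also have "card D = n" unfolding D_def by (subst card_image) (auto simp: inj_on_def)
  finally show ?thesis using 1 unfolding C_def by simp
qed

lemma card_residue_class_consecutive:
  assumes "Q > 0" "c < Q"
  shows "card (residue_class int n Q c) \<in> {n div Q, n div Q + 1}"
proof -
  define t where "t = {t. c + Q * t < n}"
  have "residue_class int n Q c = (\<lambda>t. c + Q * t) ` t"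
  proof (intro equalityI subsetI)
    fix i assume "i \<in> residue_class int n Q c"
    hence i: "i < n" "i mod Q = c" unfolding residue_class_def by (auto simp flip: of_nat_mod)
    have "i = c + Q * (i div Q)" using i(2) by (metis mod_mult_div_eq)
    thus "i \<in> (\<lambda>t. c + Q * t) ` t" unfolding t_def using i(1) by auto
  next
    fix i assume "i \<in> (\<lambda>t. c + Q * t) ` t"
    thus "i \<in> residue_class int n Q c" 
      unfolding residue_class_def t_def using assms(2) by (auto simp flip: of_nat_mod)
  qed
  moreover have "inj_on (\<lambda>t. c + Q * t) t" using assms(1) by (auto simp: inj_on_def)
  ultimately have card: "card (residue_class int n Q c) = card t" by (simp add: card_image)
  have up: "t \<subseteq> {..n div Q}"
    unfolding t_def using assms by (auto simp: less_eq_div_iff_mult_less_eq mult.commute)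
  have lo: "{..<n div Q} \<subseteq> t"
  proof
    fix s assume "s \<in> {..<n div Q}"
    hence "Suc s \<le> n div Q" by simp
    hence "Suc s * Q \<le> n" using assms(1) by (simp add: less_eq_div_iff_mult_less_eq)
    thus "s \<in> t" using assms unfolding t_def by (simp add: algebra_simps)
  qed
  have "card t \<le> n div Q + 1" using card_mono[OF _ up] by simp
  moreover have "n div Q \<le> card t" using card_mono[OF finite_subset[OF up] lo] by simp
  ultimately show ?thesis unfolding card by auto
qed

text \<open>
  Convexity: if the class sizes \<open>N\<close> add up to \<open>n\<close>, then \<open>\<Sum> N\<^sup>2\<close> is least when all sizes are
  \<open>n div Q\<close> or \<open>n div Q + 1\<close>, as they are for consecutive integers.
\<close>

lemma card_cong_pairs_ge_consecutive:
  assumes "Q > 0"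
  shows "card (cong_pairs int n (int Q)) \<le> card (cong_pairs g n (int Q))"
proof -
  define f where "f = int (n div Q)"
  \<comment> \<open>Summing \<open>N\<^sup>2 = (N - f) * (N - f - 1) + (2 * f + 1) * N - f * (f + 1)\<close>: the first product is
    never negative on integers, and it vanishes exactly for \<open>N = f\<close> and \<open>N = f + 1\<close>.\<close>
  have sq: "(\<Sum>c<Q. int (card (residue_class h n Q c)) ^ 2)
      = (\<Sum>c<Q. (int (card (residue_class h n Q c)) - f) * (int (card (residue_class h n Q c)) - f - 1))
        + (2 * f + 1) * int n - int Q * (f * (f + 1))" for h
  proof -
    have "int n = (\<Sum>c<Q. int (card (residue_class h n Q c)))"
      using sum_card_residue_class[OF assms, of h n] by (metis of_nat_sum)
    hence "(2 * f + 1) * int n - int Q * (f * (f + 1))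
        = (\<Sum>c<Q. (2 * f + 1) * int (card (residue_class h n Q c)) - f * (f + 1))"
      by (simp add: sum_subtractf sum_distrib_left)
    moreover have "(\<Sum>c<Q. int (card (residue_class h n Q c)) ^ 2)
        = (\<Sum>c<Q. (int (card (residue_class h n Q c)) - f) * (int (card (residue_class h n Q c)) - f - 1)
            + ((2 * f + 1) * int (card (residue_class h n Q c)) - f * (f + 1)))"
      by (intro sum.cong refl) (simp add: algebra_simps power2_eq_square)
    ultimately show ?thesis by (simp only: sum.distrib)
  qed
  have "(\<Sum>c<Q. (int (card (residue_class int n Q c)) - f) * (int (card (residue_class int n Q c)) - f - 1)) = 0"
  proof (rule sum.neutral, intro ballI)
    fix c assume "c \<in> {..<Q}"
    thus "(int (card (residue_class int n Q c)) - f) * (int (card (residue_class int n Q c)) - f - 1) = 0"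
      using card_residue_class_consecutive[OF assms, of c n] unfolding f_def by auto
  qed
  moreover have "(\<Sum>c<Q. (int (card (residue_class g n Q c)) - f) * (int (card (residue_class g n Q c)) - f - 1)) \<ge> 0"
  proof (rule sum_nonneg)
    fix c
    show "(int (card (residue_class g n Q c)) - f) * (int (card (residue_class g n Q c)) - f - 1) \<ge> 0"
      by (cases "int (card (residue_class g n Q c)) \<ge> f + 1") (auto intro: mult_nonneg_nonneg mult_nonpos_nonpos)
  qed
  ultimately have "(\<Sum>c<Q. int (card (residue_class int n Q c)) ^ 2) \<le> (\<Sum>c<Q. int (card (residue_class g n Q c)) ^ 2)"
    unfolding sq by linarith
  hence "(\<Sum>c<Q. card (residue_class int n Q c) ^ 2) \<le> (\<Sum>c<Q. card (residue_class g n Q c) ^ 2)"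
    by (simp flip: of_nat_power of_nat_sum)
  thus ?thesis unfolding sum_card_residue_class_squares[OF assms] by simp
qed

text \<open>
  Legendre's argument: the valuation of a difference is the number of powers of \<open>p\<close> dividing it;
  summing over all pairs and exchanging the sums counts, for each power, the congruent pairs.
\<close>

lemma multiplicity_vandermonde:
  fixes p :: nat
  assumes "prime p" and inj: "inj_on g {..<n}"
    and S: "\<And>i j. i < j \<Longrightarrow> j < n \<Longrightarrow> multiplicity (int p) (g j - g i) \<le> S"
  shows "multiplicity (int p) (vandermonde g n) = (\<Sum>s\<in>{1..S}. card (cong_pairs g n (int (p ^ s))))"
proof -
  have p: "prime (int p)" using assms(1) by simp
  have nz: "g j - g i \<noteq> 0" if "(i, j) \<in> index_pairs n" for i j
    using that inj unfolding index_pairs_def inj_on_def by force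
  have "multiplicity (int p) (vandermonde g n) = (\<Sum>x\<in>index_pairs n. multiplicity (int p) (case x of (i, j) \<Rightarrow> g j - g i))"
    unfolding vandermonde_def
    by (rule prime_elem_multiplicity_prod_distrib) (use p nz in \<open>auto simp: image_iff prime_imp_prime_elem\<close>)
  also have "\<dots> = (\<Sum>x\<in>index_pairs n. card {s\<in>{1..S}. int (p ^ s) dvd (case x of (i, j) \<Rightarrow> g j - g i)})"
  proof (rule sum.cong)
    fix x assume x: "x \<in> index_pairs n"
    obtain i j where ij: "x = (i, j)" by fastforce
    show "multiplicity (int p) (case x of (i, j) \<Rightarrow> g j - g i) = card {s\<in>{1..S}. int (p ^ s) dvd (case x of (i, j) \<Rightarrow> g j - g i)}"
      using multiplicity_eq_card_powers[OF p nz[of i j] S] x ij unfolding index_pairs_def by simp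
  qed simp
  also have "\<dots> = (\<Sum>x\<in>index_pairs n. \<Sum>s\<in>{1..S}. if int (p ^ s) dvd (case x of (i, j) \<Rightarrow> g j - g i) then 1 else 0)"
    by (intro sum.cong refl) (simp add: sum.If_cases Int_def)
  also have "\<dots> = (\<Sum>s\<in>{1..S}. \<Sum>x\<in>index_pairs n. if int (p ^ s) dvd (case x of (i, j) \<Rightarrow> g j - g i) then 1 else 0)"
    by (rule sum.swap)
  also have "\<dots> = (\<Sum>s\<in>{1..S}. card (cong_pairs g n (int (p ^ s))))"
    unfolding cong_pairs_def
    by (intro sum.cong refl) (simp add: sum.If_cases Int_def case_prod_unfold)
  finally show ?thesis .
qed

text \<open>
  Level by level, \<open>g\<close> has at least as many congruent pairs as the identity. At the \<open>e\<close> levels from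
  \<open>s0\<close> to \<open>s0 + e - 1\<close> the identity has none, while the collision of \<open>g\<close> modulo the highest of these
  powers is a collision modulo each of them.
\<close>

lemma multiplicity_vandermonde_gain:
  fixes p e s0 :: nat
  assumes "prime p" and inj: "inj_on g {..<n}" and "n \<ge> 2" and s0: "n \<le> p ^ s0"
    and coll: "e > 0 \<Longrightarrow> \<not> inj_on (\<lambda>i. g i mod int (p ^ (s0 + e - 1))) {..<n}"
  shows "multiplicity (int p) (vandermonde int n) + e \<le> multiplicity (int p) (vandermonde g n)"
proof -
  \<comment> \<open>Any cut-off beyond all valuations and beyond the level \<open>s0 + e\<close>.\<close>
  define S where "S = s0 + e + (\<Sum>(i, j)\<in>index_pairs n. multiplicity (int p) (g j - g i)
      + multiplicity (int p) (int j - int i))"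
  have le: "multiplicity (int p) (g j - g i) + multiplicity (int p) (int j - int i) \<le> S" if "i < j" "j < n" for i j
  proof -
    have "(case (i, j) of (i, j) \<Rightarrow> multiplicity (int p) (g j - g i) + multiplicity (int p) (int j - int i))
       \<le> (\<Sum>(i, j)\<in>index_pairs n. multiplicity (int p) (g j - g i) + multiplicity (int p) (int j - int i))"
      by (rule member_le_sum) (use that in \<open>auto simp: index_pairs_def finite_index_pairs[unfolded index_pairs_def]\<close>)
    thus ?thesis unfolding S_def by simp
  qed
  have p0: "p > 0" using assms(1) prime_gt_0_nat by blast
  have "s0 \<noteq> 0" using s0 assms(3) by (cases s0) auto
  have "(\<Sum>s\<in>{1..S}. card (cong_pairs int n (int (p ^ s)))) + e
      = (\<Sum>s\<in>{1..S}. card (cong_pairs int n (int (p ^ s))) + (if s \<in> {s0..<s0 + e} then 1 else 0))"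
  proof -
    have "{1..S} \<inter> {s. s \<in> {s0..<s0 + e}} = {s0..<s0 + e}" using \<open>s0 \<noteq> 0\<close> unfolding S_def by auto
    hence "(\<Sum>s\<in>{1..S}. if s \<in> {s0..<s0 + e} then 1 else 0) = e" by (subst sum.If_cases) simp_all
    thus ?thesis by (simp only: sum.distrib)
  qed
  also have "\<dots> \<le> (\<Sum>s\<in>{1..S}. card (cong_pairs g n (int (p ^ s))))"
  proof (rule sum_mono)
    fix s assume "s \<in> {1..S}"
    show "card (cong_pairs int n (int (p ^ s))) + (if s \<in> {s0..<s0 + e} then 1 else 0) \<le> card (cong_pairs g n (int (p ^ s)))"
    proof (cases "s \<in> {s0..<s0 + e}")
      case False
      thus ?thesis using card_cong_pairs_ge_consecutive[of "p ^ s" n g] p0 by (simp only: if_False) simp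
    next
      case True
      have "n \<le> p ^ s" using s0 True p0 power_increasing[of s0 s p] by simp
      hence empty: "cong_pairs int n (int (p ^ s)) = {}"
        unfolding cong_pairs_def index_pairs_def using zdvd_imp_le by fastforce
      moreover obtain i j where ij: "i < j" "j < n" "g i mod int (p ^ (s0 + e - 1)) = g j mod int (p ^ (s0 + e - 1))"
      proof -
        have "\<not> inj_on (\<lambda>i. g i mod int (p ^ (s0 + e - 1))) {..<n}" using coll True by auto
        then obtain a b where ab: "a < n" "b < n" "a \<noteq> b" "g a mod int (p ^ (s0 + e - 1)) = g b mod int (p ^ (s0 + e - 1))"
          unfolding inj_on_def by auto
        show thesis using that[of a b] that[of b a] ab by (cases "a < b") auto
      qed
      have "int (p ^ (s0 + e - 1)) dvd g j - g i" using ij(3) by (metis mod_eq_dvd_iff)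
      moreover have "int (p ^ s) dvd int (p ^ (s0 + e - 1))" using True by (auto intro!: le_imp_power_dvd)
      ultimately have "(i, j) \<in> cong_pairs g n (int (p ^ s))"
        using ij unfolding cong_pairs_def index_pairs_def by (auto intro: dvd_trans)
      moreover have "finite (cong_pairs g n (int (p ^ s)))"
        unfolding cong_pairs_def by (rule finite_subset[OF _ finite_index_pairs[of n]]) auto
      ultimately have "card (cong_pairs g n (int (p ^ s))) \<ge> 1" by (auto simp: card_gt_0_iff Suc_le_eq simp del: of_nat_power)
      thus ?thesis unfolding empty by simp
    qed
  qed
  finally show ?thesis
    using multiplicity_vandermonde[OF assms(1) inj, of S] multiplicity_vandermonde[OF assms(1), of int n S]
      add_leD1[OF le] add_leD2[OF le] by simp
qed

text \<open>
  The divisibility may be checked one prime at a time. Primes not dividing \<open>m\<close> are covered by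
  \<open>multiplicity_vandermonde_gain\<close> with \<open>e = 0\<close>, which is the classical fact that the Vandermonde product of
  consecutive integers divides all others.
\<close>

lemma vandermonde_dvd:
  assumes "n \<ge> 2" "m > 0"
    and coll: "\<And>p. p \<in> prime_factors m \<Longrightarrow> n \<le> p ^ s p
      \<and> \<not> inj_on (\<lambda>i. g i mod int (p ^ (s p + multiplicity p m - 1))) {..<n}"
  shows "int m * vandermonde int n dvd vandermonde g n"
proof (cases "inj_on g {..<n}")
  case False
  then obtain a b where ab: "a < n" "b < n" "a \<noteq> b" "g a = g b" unfolding inj_on_def by auto
  then obtain i j where "i < j" "j < n" "g i = g j" by (metis linorder_neqE_nat)
  hence "vandermonde g n = 0" unfolding vandermonde_def by (intro prod_zero bexI[of _ "(i, j)"] finite_index_pairs) (auto simp: index_pairs_def)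
  thus ?thesis by simp
next
  case True
  have nz: "vandermonde h n \<noteq> 0" if "inj_on h {..<n}" for h
    using that unfolding vandermonde_def by (force simp: index_pairs_def inj_on_def finite_index_pairs[unfolded index_pairs_def])
  have nzi: "vandermonde int n \<noteq> 0" by (rule nz) (simp add: inj_on_def)
  show ?thesis
  proof (rule multiplicity_le_imp_dvd)
    show "int m * vandermonde int n \<noteq> 0" using nzi assms(2) by simp
    fix q :: int assume q: "prime q"
    define p where "p = nat q"
    have qp: "q = int p" using q prime_ge_0_int unfolding p_def by simp
    have pp: "prime p" using q unfolding qp by simp
    have mm: "multiplicity q (int m) = multiplicity p m" unfolding qp by (simp add: multiplicity_def flip: of_nat_power)
    have "multiplicity q (vandermonde int n) + multiplicity p m \<le> multiplicity q (vandermonde g n)"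
    proof (cases "p \<in> prime_factors m")
      case True
      show ?thesis unfolding qp using multiplicity_vandermonde_gain[OF pp \<open>inj_on g {..<n}\<close> assms(1), of "s p" "multiplicity p m"]
          coll[OF True] by simp
    next
      case False
      hence "multiplicity p m = 0" using pp assms(2) by (simp add: in_prime_factors_iff not_dvd_imp_multiplicity_0)
      moreover have "n \<le> p ^ n" 
        using less_exp[of n] power_mono[of 2 p n] prime_ge_2_nat[OF pp] by linarith
      ultimately show ?thesis unfolding qp
        using multiplicity_vandermonde_gain[OF pp \<open>inj_on g {..<n}\<close> assms(1), of n 0] by simp
    qed
    moreover have "multiplicity q (int m * vandermonde int n) = multiplicity q (int m) + multiplicity q (vandermonde int n)"
      using q nzi assms(2) by (intro prime_elem_multiplicity_mult_distrib) auto
    ultimately show "multiplicity q (int m * vandermonde int n) \<le> multiplicity q (vandermonde g n)"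
      unfolding mm by simp
  qed
qed

section \<open>Counting staircases that are injective modulo an integer\<close>

text \<open>
  The \<open>n - 1\<close> nodes of the Dynkin diagram are folded along its mirror symmetry: node \<open>s\<close> gets its
  distance from the middle, so that the \<open>n div 2\<close> orbits are numbered from the middle outwards.
\<close>

definition mirror_label :: "nat \<Rightarrow> nat \<Rightarrow> nat" where
  "mirror_label n s = (if n - n div 2 - 1 \<le> s then s - (n - n div 2 - 1) else n div 2 - 1 - s)"

text \<open>
  The coordinates of the \<open>\<rho>\<close>-shifted weight with mirror symmetric Dynkin labels \<open>x\<close>, up to sign
  and a common constant.
\<close>

definition staircase :: "nat \<Rightarrow> (nat \<Rightarrow> int) \<Rightarrow> nat \<Rightarrow> int" where
  "staircase n x i = (\<Sum>s<i. x (mirror_label n s) + 1)"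

lemma card_residues_in_interval:
  fixes M T :: int
  assumes "T > 0" "M \<ge> 0" "T dvd M" "A \<subseteq> {0..<T}"
  shows "real (card {v\<in>{0..<M}. v mod T \<in> A}) = real_of_int M / real_of_int T * real (card A)"
proof -
  obtain q where q: "M = T * q" using assms(3) by auto
  have q0: "q \<ge> 0" using q assms(1,2) by (simp add: zero_le_mult_iff)
  define f where "f = (\<lambda>(a, r). T * a + r)"
  have "bij_betw f ({0..<q} \<times> A) {v\<in>{0..<M}. v mod T \<in> A}"
  proof (rule bij_betwI[where g = "\<lambda>v. (v div T, v mod T)"])
    show "f \<in> {0..<q} \<times> A \<rightarrow> {v\<in>{0..<M}. v mod T \<in> A}"
    proof
      fix z assume "z \<in> {0..<q} \<times> A"
      then obtain a r where z: "z = (a, r)" "0 \<le> a" "a \<le> q - 1" "r \<in> A" "0 \<le> r" "r < T" using assms(4) by auto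
      have "T * a \<le> T * (q - 1)" using z assms(1) by simp
      hence "T * a + r < M" using z unfolding q by (simp add: algebra_simps)
      thus "f z \<in> {v\<in>{0..<M}. v mod T \<in> A}" using z assms(1) by (simp add: f_def)
    qed
    show "(\<lambda>v. (v div T, v mod T)) \<in> {v\<in>{0..<M}. v mod T \<in> A} \<rightarrow> {0..<q} \<times> A"
    proof
      fix v assume v: "v \<in> {v\<in>{0..<M}. v mod T \<in> A}"
      have "T * (v div T) \<le> v" using mult_div_mod_eq[of T v] pos_mod_sign[OF assms(1), of v] by linarith
      hence "T * (v div T) < T * q" using v unfolding q by simp
      hence "v div T < q" using assms(1) by simp
      thus "(v div T, v mod T) \<in> {0..<q} \<times> A" using v assms(1) by (simp add: pos_imp_zdiv_nonneg_iff)
    qed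
    fix z assume "z \<in> {0..<q} \<times> A"
    thus "((f z) div T, (f z) mod T) = z" using assms(1,4) by (auto simp: f_def subset_iff)
  next
    fix v show "f (v div T, v mod T) = v" by (simp add: f_def)
  qed
  hence "card {v\<in>{0..<M}. v mod T \<in> A} = nat q * card A"
    using bij_betw_same_card by (fastforce simp: card_cartesian_product)
  thus ?thesis using q q0 assms(1) by simp
qed

text \<open>
  Choosing the coordinates one after the other, with at most \<open>c t\<close> admissible choices for
  coordinate \<open>t\<close> whatever the previous ones were. The predicate \<open>G t\<close> describes the admissible
  initial segments of length \<open>t\<close>; being a predicate on total functions, it is required to look only at
  the first \<open>t\<close> values.
\<close>

lemma card_PiE_stepwise:
  fixes c :: "nat \<Rightarrow> real" and M :: int
  assumes local: "\<And>t x y. (\<And>s. s < t \<Longrightarrow> x s = y s) \<Longrightarrow> G t x = G t y"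
    and mono: "\<And>t x. t < k \<Longrightarrow> G (Suc t) x \<Longrightarrow> G t x"
    and step: "\<And>t x. t < k \<Longrightarrow> G t x \<Longrightarrow> real (card {v\<in>{0..<M}. G (Suc t) (x(t := v))}) \<le> c t"
    and c: "\<And>t. c t \<ge> 0"
  shows "real (card {x \<in> PiE {..<k} (\<lambda>_. {0..<M}). G k x}) \<le> (\<Prod>t<k. c t)"
proof -
  define S where "S = (\<lambda>t. {x \<in> PiE {..<t} (\<lambda>_. {0..<M}). G t x})"
  have fin: "finite (S t)" for t unfolding S_def by (intro finite_subset[OF _ finite_PiE[of "{..<t}" "\<lambda>_. {0..<M}"]]) auto
  have "real (card (S t)) \<le> (\<Prod>s<t. c s)" if "t \<le> k" for t
    using that
  proof (induction t)
    case 0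
    have "S 0 \<subseteq> {\<lambda>_. undefined}" unfolding S_def by auto
    hence "card (S 0) \<le> 1" using card_mono[of "{\<lambda>_. undefined}" "S 0"] by simp
    thus ?case by simp
  next
    case (Suc t)
    define V where "V = (\<lambda>y. {v\<in>{0..<M}. G (Suc t) (y(t := v))})"
    have finV: "finite (V y)" for y unfolding V_def by (rule finite_subset[of _ "{0..<M}"]) auto
    define \<phi> where "\<phi> = (\<lambda>x::nat \<Rightarrow> int. (restrict x {..<t}, x t))"
    have "\<phi> ` S (Suc t) \<subseteq> Sigma (S t) V"
    proof
      fix z assume "z \<in> \<phi> ` S (Suc t)"
      then obtain x where x: "z = \<phi> x" "x \<in> PiE {..<Suc t} (\<lambda>_. {0..<M})" "G (Suc t) x" unfolding S_def by auto
      have xs: "x s \<in> {0..<M}" if "s < Suc t" for s using PiE_mem[OF x(2), of s] that by simp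
      have "G t (restrict x {..<t})" using local[of t x "restrict x {..<t}"] mono[of t x] x(3) Suc.prems by auto
      moreover have "G (Suc t) ((restrict x {..<t})(t := x t))"
      proof -
        have "G (Suc t) x = G (Suc t) ((restrict x {..<t})(t := x t))" by (rule local) (auto simp: less_Suc_eq)
        thus ?thesis using x(3) by (simp only:)
      qed
      ultimately show "z \<in> Sigma (S t) V" using xs unfolding x(1) \<phi>_def S_def V_def by auto
    qed
    moreover have "inj_on \<phi> (S (Suc t))"
    proof (rule inj_onI)
      fix x y assume xy: "x \<in> S (Suc t)" "y \<in> S (Suc t)" "\<phi> x = \<phi> y"
      show "x = y"
      proof (rule PiE_ext)
        show "x \<in> PiE {..<Suc t} (\<lambda>_. {0..<M})" "y \<in> PiE {..<Suc t} (\<lambda>_. {0..<M})" using xy unfolding S_def by auto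
        fix s assume "s \<in> {..<Suc t}"
        moreover have "restrict x {..<t} s = restrict y {..<t} s" "x t = y t" using xy(3) unfolding \<phi>_def by simp_all
        ultimately show "x s = y s" by (cases "s = t") auto
      qed
    qed
    moreover have "finite (Sigma (S t) V)" by (intro finite_SigmaI fin finV)
    ultimately have "card (S (Suc t)) \<le> card (Sigma (S t) V)" using card_inj_on_le by blast
    also have "card (Sigma (S t) V) = (\<Sum>y\<in>S t. card (V y))" by (rule card_SigmaI) (use fin finV in auto)
    finally have "real (card (S (Suc t))) \<le> (\<Sum>y\<in>S t. real (card (V y)))" by (simp flip: of_nat_sum)
    also have "\<dots> \<le> (\<Sum>y\<in>S t. c t)"
      using step[of t] Suc.prems unfolding S_def V_def by (intro sum_mono) auto
    also have "\<dots> = real (card (S t)) * c t" by simp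
    also have "\<dots> \<le> (\<Prod>s<t. c s) * c t" using Suc c[of t] by (intro mult_right_mono) auto
    finally show ?case by simp
  qed
  from this[of k] show ?thesis unfolding S_def by simp
qed

text \<open>
  The positions of the staircase whose mutual differences involve only the \<open>t\<close> innermost labels,
  up to the one leftmost position that the symmetric shape leaves out when \<open>n\<close> is odd.
\<close>

definition window :: "nat \<Rightarrow> nat \<Rightarrow> nat set" where
  "window n t = {n - n div 2 - t..<n - n div 2 + t}"

definition distinct_mod :: "nat \<Rightarrow> int \<Rightarrow> nat \<Rightarrow> (nat \<Rightarrow> int) \<Rightarrow> bool" where
  "distinct_mod n T t x \<longleftrightarrow> inj_on (\<lambda>i. staircase n x i mod T) (window n t)"

lemma staircase_diff:
  assumes "j \<le> i"
  shows "staircase n x i - staircase n x j = (\<Sum>s\<in>{j..<i}. x (mirror_label n s) + 1)"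
proof -
  have "{..<i} = {..<j} \<union> {j..<i}" using assms by auto
  thus ?thesis unfolding staircase_def by (simp add: sum.union_disjoint[of "{..<j}" "{j..<i}"] ivl_disj_int)
qed

lemma mirror_label_less:
  assumes "n - n div 2 - t \<le> s" "s + 1 < n - n div 2 + t" "t \<le> n div 2"
  shows "mirror_label n s < t"
  using assms unfolding mirror_label_def by (auto split: if_splits)

lemma staircase_diff_local:
  assumes "\<And>s. s < t \<Longrightarrow> x s = y s" "t \<le> n div 2"
    and "n - n div 2 - t \<le> j" "j \<le> i" "i < n - n div 2 + t"
  shows "staircase n x i - staircase n x j = staircase n y i - staircase n y j"
  unfolding staircase_diff[OF assms(4)]
proof (rule sum.cong)
  fix s assume "s \<in> {j..<i}"
  hence "mirror_label n s < t" using assms by (intro mirror_label_less) auto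
  thus "x (mirror_label n s) + 1 = y (mirror_label n s) + 1" using assms(1) by simp
qed simp

lemma distinct_mod_local:
  assumes "\<And>s. s < t \<Longrightarrow> x s = y s" "t \<le> n div 2"
  shows "distinct_mod n T t x = distinct_mod n T t y"
proof -
  have *: "(staircase n x i mod T = staircase n x j mod T) = (staircase n y i mod T = staircase n y j mod T)"
    if "j \<le> i" "i \<in> window n t" "j \<in> window n t" for i j
    using staircase_diff_local[of t x y n j i, OF assms] that unfolding window_def mod_eq_dvd_iff by simp
  have "(staircase n x i mod T = staircase n x j mod T) = (staircase n y i mod T = staircase n y j mod T)"
    if "i \<in> window n t" "j \<in> window n t" for i j
    using *[of i j] *[of j i] that by (metis nat_le_linear)
  thus ?thesis unfolding distinct_mod_def inj_on_def by blast
qed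

text \<open>
  Relative to the values in the window, the value at the next position to the right is \<open>v\<close> plus a
  known number. Its residue must differ from those of the \<open>2 * t\<close> positions in the window, which are
  distinct by assumption. Then \<open>1 - \<beta> / T \<le> exp (- \<beta> / T)\<close>.
\<close>

lemma card_extensions_distinct_mod:
  fixes M T :: int
  assumes n: "n \<ge> 2" and t: "t < n div 2" and T: "T > 0" "M > 0" "T dvd M" and G: "distinct_mod n T t x"
  shows "real (card {v\<in>{0..<M}. distinct_mod n T (Suc t) (x(t := v))})
     \<le> real_of_int M * exp (- (real (max 1 (2 * t)) / real_of_int T))"
proof -
  define hi where "hi = n - n div 2 + t - 1"
  \<comment> \<open>The window is empty for \<open>t = 0\<close>; but the two positions joined by the first label must already
    differ, which excludes one residue. This makes the bound nontrivial for \<open>n = 2\<close>.\<close>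
  define J where "J = (if t = 0 then {hi} else window n t)"
  define h where "h = (\<lambda>j. (staircase n x j - staircase n x hi - 1) mod T)"
  have hi: "Suc hi = n - n div 2 + t" "n - n div 2 \<ge> 1" using n t unfolding hi_def by auto
  have card_J: "card J = max 1 (2 * t)" using t unfolding J_def window_def by auto
  have Jb: "n - n div 2 - Suc t \<le> j" "j \<le> hi" "t > 0 \<Longrightarrow> n - n div 2 - t \<le> j" "t = 0 \<Longrightarrow> j = hi" if "j \<in> J" for j
  proof -
    define N where "N = n - n div 2"
    have N: "N \<ge> 1" using hi(2) unfolding N_def .
    have j: "if t = 0 then j = N - 1 else N - t \<le> j \<and> j < N + t"
      using that unfolding J_def window_def hi_def N_def by (auto split: if_splits)
    show "n - n div 2 - Suc t \<le> j" "j \<le> hi" "t > 0 \<Longrightarrow> n - n div 2 - t \<le> j" "t = 0 \<Longrightarrow> j = hi"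
      using j N unfolding hi_def N_def[symmetric] by (auto split: if_splits)
  qed
  have inj: "inj_on h J"
  proof (cases "t = 0")
    case False
    show ?thesis
    proof (rule inj_onI)
      fix i j assume ij: "i \<in> J" "j \<in> J" "h i = h j"
      hence "staircase n x i mod T = staircase n x j mod T" unfolding h_def mod_eq_dvd_iff by simp
      thus "i = j" using G ij False unfolding distinct_mod_def J_def inj_on_def by auto
    qed
  qed (simp add: J_def)
  define A where "A = {0..<T} - h ` J"
  have hJ: "h ` J \<subseteq> {0..<T}" unfolding h_def using T by auto
  have card_hJ: "card (h ` J) = max 1 (2 * t)" using card_image[OF inj] card_J by simp
  have cA: "real (card A) = real_of_int T - real (max 1 (2 * t))"
  proof -
    have "card (h ` J) \<le> card {0..<T}" by (rule card_mono[OF _ hJ]) simp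
    thus ?thesis unfolding A_def using card_Diff_subset[OF finite_subset[OF hJ] hJ] card_hJ T by (simp add: of_nat_diff)
  qed
  have sub: "{v\<in>{0..<M}. distinct_mod n T (Suc t) (x(t := v))} \<subseteq> {v\<in>{0..<M}. v mod T \<in> A}"
  proof
    fix v assume v: "v \<in> {v\<in>{0..<M}. distinct_mod n T (Suc t) (x(t := v))}"
    define y where "y = x(t := v)"
    have D: "inj_on (\<lambda>i. staircase n y i mod T) (window n (Suc t))" using v unfolding distinct_mod_def y_def by simp
    have "v mod T \<noteq> h j" if j: "j \<in> J" for j
    proof
      assume eq: "v mod T = h j"
      have diff: "staircase n x hi - staircase n x j = staircase n y hi - staircase n y j"
      proof (cases "t = 0")
        case True
        thus ?thesis using Jb[OF j] by simp
      next
        case False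
        show ?thesis by (rule staircase_diff_local[of t]) (use False Jb[OF j] t hi in \<open>auto simp: y_def\<close>)
      qed
      have "mirror_label n hi = t" unfolding mirror_label_def hi_def using hi by auto
      hence "staircase n y (Suc hi) = staircase n y hi + (v + 1)" unfolding staircase_def y_def by simp
      hence "staircase n y (Suc hi) - staircase n y j = v - (staircase n x j - staircase n x hi - 1)"
        using diff by simp
      moreover have "T dvd v - (staircase n x j - staircase n x hi - 1)"
        using eq unfolding h_def mod_eq_dvd_iff .
      ultimately have "staircase n y (Suc hi) mod T = staircase n y j mod T" unfolding mod_eq_dvd_iff by simp
      moreover have "Suc hi \<in> window n (Suc t)" "j \<in> window n (Suc t)"
        using hi Jb[OF j] t unfolding window_def by auto
      ultimately have "Suc hi = j" using D unfolding inj_on_def by blast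
      thus False using Jb(2)[OF j] by simp
    qed
    thus "v \<in> {v\<in>{0..<M}. v mod T \<in> A}" using v T unfolding A_def by auto
  qed
  have "card {v\<in>{0..<M}. distinct_mod n T (Suc t) (x(t := v))} \<le> card {v\<in>{0..<M}. v mod T \<in> A}"
    by (rule card_mono[OF _ sub]) (rule finite_subset[of _ "{0..<M}"], auto)
  hence "real (card {v\<in>{0..<M}. distinct_mod n T (Suc t) (x(t := v))}) \<le> real (card {v\<in>{0..<M}. v mod T \<in> A})" by simp
  also have "\<dots> = real_of_int M / real_of_int T * real (card A)"
    by (rule card_residues_in_interval) (use T in \<open>auto simp: A_def\<close>)
  also have "\<dots> = real_of_int M * (1 + - (real (max 1 (2 * t)) / real_of_int T))"
    unfolding cA using T by (simp add: field_simps)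
  also have "\<dots> \<le> real_of_int M * exp (- (real (max 1 (2 * t)) / real_of_int T))"
    using T by (intro mult_left_mono exp_ge_add_one_self) auto
  finally show ?thesis .
qed

lemma sum_max_one_double: "k \<ge> 1 \<Longrightarrow> (\<Sum>t<k. max 1 (2 * t)) = 1 + k * (k - 1)" for k :: nat
proof (induction k)
  case (Suc k)
  thus ?case by (cases "k = 0") (auto simp: algebra_simps max_def)
qed simp

lemma card_injective_staircases:
  fixes M T :: int
  assumes n: "n \<ge> 2" and T: "T > 0" "M > 0" "T dvd M"
  shows "real (card {x \<in> PiE {..<n div 2} (\<lambda>_. {0..<M}). inj_on (\<lambda>i. staircase n x i mod T) {..<n}})
     \<le> real_of_int M ^ (n div 2) * exp (- (real (1 + n div 2 * (n div 2 - 1)) / real_of_int T))"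
proof -
  define k where "k = n div 2"
  have k: "k \<ge> 1" unfolding k_def using n by simp
  define G where "G = (\<lambda>t x. distinct_mod n T (min t k) x)"
  have "{x \<in> PiE {..<k} (\<lambda>_. {0..<M}). inj_on (\<lambda>i. staircase n x i mod T) {..<n}}
      \<subseteq> {x \<in> PiE {..<k} (\<lambda>_. {0..<M}). G k x}"
  proof -
    have "window n k \<subseteq> {..<n}" unfolding window_def k_def by auto
    thus ?thesis unfolding G_def distinct_mod_def by (auto intro: inj_on_subset)
  qed
  hence "card {x \<in> PiE {..<k} (\<lambda>_. {0..<M}). inj_on (\<lambda>i. staircase n x i mod T) {..<n}}
      \<le> card {x \<in> PiE {..<k} (\<lambda>_. {0..<M}). G k x}"
    by (intro card_mono finite_subset[OF _ finite_PiE[of "{..<k}" "\<lambda>_. {0..<M}"]]) auto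
  hence "real (card {x \<in> PiE {..<k} (\<lambda>_. {0..<M}). inj_on (\<lambda>i. staircase n x i mod T) {..<n}})
      \<le> real (card {x \<in> PiE {..<k} (\<lambda>_. {0..<M}). G k x})" by simp
  also have "\<dots> \<le> (\<Prod>t<k. real_of_int M * exp (- (real (max 1 (2 * t)) / real_of_int T)))"
  proof (rule card_PiE_stepwise)
    show "G t x = G t y" if "\<And>s. s < t \<Longrightarrow> x s = y s" for t and x y :: "nat \<Rightarrow> int"
      unfolding G_def by (rule distinct_mod_local) (use that in \<open>auto simp: k_def\<close>)
    show "G t x" if "t < k" "G (Suc t) x" for t and x :: "nat \<Rightarrow> int"
    proof -
      have "window n t \<subseteq> window n (Suc t)" unfolding window_def by auto
      thus ?thesis using that unfolding G_def distinct_mod_def by (auto simp: min_def intro: inj_on_subset split: if_splits)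
    qed
    show "real (card {v\<in>{0..<M}. G (Suc t) (x(t := v))}) \<le> real_of_int M * exp (- (real (max 1 (2 * t)) / real_of_int T))"
      if "t < k" "G t x" for t x
      using card_extensions_distinct_mod[OF n _ T, of t x] that unfolding G_def k_def by (simp add: min_def)
  qed (use T in auto)
  also have "\<dots> = real_of_int M ^ k * (\<Prod>t<k. exp (- (real (max 1 (2 * t)) / real_of_int T)))"
    by (simp add: prod.distrib)
  also have "(\<Prod>t<k. exp (- (real (max 1 (2 * t)) / real_of_int T))) = exp (\<Sum>t<k. - (real (max 1 (2 * t)) / real_of_int T))"
    by (simp add: exp_sum)
  also have "(\<Sum>t<k. - (real (max 1 (2 * t)) / real_of_int T)) = - (real (\<Sum>t<k. max 1 (2 * t)) / real_of_int T)"
    unfolding of_nat_sum sum_divide_distrib sum_negf ..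
  also have "(\<Sum>t<k. max 1 (2 * t)) = 1 + k * (k - 1)" by (rule sum_max_one_double[OF k])
  finally show ?thesis unfolding k_def .
qed

lemma quadratic_comparison: "(2 * K + 1)\<^sup>2 \<le> 36 * (1 + K * (K - 1))" for K :: real
proof -
  have "0 \<le> 32 * (K - 5 / 8)\<^sup>2 + 45 / 2" by simp
  also have "\<dots> = 36 * (1 + K * (K - 1)) - (2 * K + 1)\<^sup>2" by (simp add: power2_eq_square algebra_simps)
  finally show ?thesis by simp
qed

text \<open>
  With \<open>k = n div 2\<close>, so \<open>n \<le> 2 * k + 1\<close>, and \<open>T \<le> n * m\<close>, the claim follows from
  \<open>n\<^sup>2 \<le> 36 * (1 + k * (k - 1))\<close>.
\<close>

lemma exponent_bound:
  assumes "n \<ge> 2" "m > 0" "T > 0" "T \<le> n * m"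
  shows "real n / (36 * real m) \<le> real (1 + n div 2 * (n div 2 - 1)) / real T"
proof -
  define k where "k = n div 2"
  have "n \<le> 2 * k + 1" "k \<ge> 1" using assms(1) unfolding k_def by auto
  hence kn: "real n \<le> 2 * real k + 1" by linarith
  have kk: "real (1 + k * (k - 1)) = 1 + real k * (real k - 1)" using \<open>k \<ge> 1\<close> by (simp add: of_nat_diff)
  have "real n ^ 2 \<le> (2 * real k + 1) ^ 2" using kn by (intro power_mono) auto
  also have "\<dots> \<le> 36 * (1 + real k * (real k - 1))" by (rule quadratic_comparison)
  finally have 1: "real n ^ 2 \<le> 36 * real (1 + k * (k - 1))" unfolding kk .
  have "real T \<le> real n * real m" using assms(4) by (metis of_nat_le_iff of_nat_mult)
  hence "real n * real T \<le> real n * (real n * real m)" by (intro mult_left_mono) auto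
  also have "\<dots> = real n ^ 2 * real m" by (simp add: power2_eq_square)
  also have "\<dots> \<le> 36 * real (1 + k * (k - 1)) * real m" using 1 by (intro mult_right_mono) auto
  finally have "real n * real T \<le> real (1 + k * (k - 1)) * (36 * real m)" by (simp only: ac_simps)
  thus ?thesis unfolding k_def[symmetric] using assms(2,3) by (simp add: divide_le_eq le_divide_eq mult.commute)
qed

text \<open>
  In terms of labels: \<open>m\<close> does not divide the Weyl dimension.
\<close>

definition non_multiple :: "nat \<Rightarrow> nat \<Rightarrow> (nat \<Rightarrow> int) \<Rightarrow> bool" where
  "non_multiple n m x \<longleftrightarrow> \<not> int m * vandermonde int n dvd vandermonde (staircase n x) n"

lemma vandermonde_cong:
  assumes "\<And>i. i < n \<Longrightarrow> [f i = g i] (mod Q)"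
  shows "[vandermonde f n = vandermonde g n] (mod Q)"
  unfolding vandermonde_def
  by (rule cong_prod) (use assms in \<open>auto simp: index_pairs_def intro!: cong_diff\<close>)

lemma vandermonde_int_pos: "vandermonde int n > 0"
  unfolding vandermonde_def by (rule prod_pos) (auto simp: index_pairs_def)

lemma mirror_label_bound:
  assumes "n \<ge> 2" "s + 1 < n"
  shows "mirror_label n s < n div 2"
  using assms unfolding mirror_label_def by auto

lemma non_multiple_periodic:
  assumes "n \<ge> 2" "int m * vandermonde int n dvd M" "\<And>t. t < n div 2 \<Longrightarrow> [x t = y t] (mod M)"
  shows "non_multiple n m x = non_multiple n m y"
proof -
  have "[staircase n x i = staircase n y i] (mod (int m * vandermonde int n))" if "i < n" for i
    unfolding staircase_def
  proof (intro cong_sum cong_add cong_refl)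
    fix s assume "s \<in> {..<i}"
    hence "mirror_label n s < n div 2" using that assms(1) by (intro mirror_label_bound) auto
    thus "[x (mirror_label n s) = y (mirror_label n s)] (mod (int m * vandermonde int n))"
      using assms(2,3) cong_dvd_modulus by blast
  qed
  hence "[vandermonde (staircase n x) n = vandermonde (staircase n y) n] (mod (int m * vandermonde int n))"
    by (rule vandermonde_cong)
  from cong_dvd_iff[OF this] show ?thesis unfolding non_multiple_def by simp
qed

text \<open>
  Union bound over the prime factors of \<open>m\<close>, with the modulus \<open>T\<close> of each prime as small as
  \<open>vandermonde_dvd\<close> permits.
\<close>

lemma card_non_multiple:
  assumes n: "n \<ge> 2" and m: "m > 0"
  obtains M :: int where "M > 0" "even M" "int m * vandermonde int n dvd M"
    "real (card {x \<in> PiE {..<n div 2} (\<lambda>_. {0..<M}). non_multiple n m x})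
       \<le> real (card (prime_factors m)) * exp (- (real n / (36 * real m))) * real_of_int M ^ (n div 2)"
proof -
  \<comment> \<open>Minimality gives \<open>p ^ (s p - 1) < n\<close>, hence \<open>T p \<le> n * m\<close>.\<close>
  define s where "s = (\<lambda>p. LEAST s. n \<le> p ^ s)"
  define T where "T = (\<lambda>p. p ^ (s p + multiplicity p m - 1))"
  have s: "n \<le> p ^ s p" "T p > 0" "T p \<le> n * m" if p: "p \<in> prime_factors m" for p
  proof -
    have p2: "p \<ge> 2" using p by (intro prime_ge_2_nat) auto
    have "n \<le> p ^ n" using less_exp[of n] power_mono[of 2 p n] p2 by linarith
    thus 1: "n \<le> p ^ s p" unfolding s_def by (rule LeastI)
    have "s p \<noteq> 0" using 1 n by (cases "s p") auto
    hence "\<not> n \<le> p ^ (s p - 1)" unfolding s_def by (intro not_less_Least) simp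
    moreover have "p ^ multiplicity p m \<le> m" using m by (intro dvd_imp_le multiplicity_dvd) auto
    ultimately have "p ^ (s p - 1) * p ^ multiplicity p m \<le> n * m" by (intro mult_mono) auto
    thus "T p \<le> n * m" using \<open>s p \<noteq> 0\<close> unfolding T_def by (simp flip: power_add)
    show "T p > 0" unfolding T_def using p2 by simp
  qed
  \<comment> \<open>A common period of all conditions; the factor 2 is there for the parity condition that singles
    out the orthogonal weights.\<close>
  define M where "M = 2 * (int m * vandermonde int n * int (\<Prod>p\<in>prime_factors m. T p))"
  have M: "M > 0" "even M" "int m * vandermonde int n dvd M"
    unfolding M_def using m vandermonde_int_pos[of n] s(2) by (auto intro!: mult_pos_pos prod_pos)
  have TM: "int (T p) dvd M" if "p \<in> prime_factors m" for p
  proof -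
    have "int (T p) dvd int (\<Prod>p\<in>prime_factors m. T p)" using that by (simp only: int_dvd_int_iff) (rule dvd_prodI, auto)
    thus ?thesis unfolding M_def by (intro dvd_mult)
  qed
  define I where "I = (\<lambda>p. {x \<in> PiE {..<n div 2} (\<lambda>_. {0..<M}). inj_on (\<lambda>i. staircase n x i mod int (T p)) {..<n}})"
  have fin: "finite (PiE {..<n div 2} (\<lambda>_. {0..<M}))" by (intro finite_PiE) auto
  have "{x \<in> PiE {..<n div 2} (\<lambda>_. {0..<M}). non_multiple n m x} \<subseteq> (\<Union>p\<in>prime_factors m. I p)"
  proof
    fix x assume x: "x \<in> {x \<in> PiE {..<n div 2} (\<lambda>_. {0..<M}). non_multiple n m x}"
    have "\<exists>p\<in>prime_factors m. inj_on (\<lambda>i. staircase n x i mod int (T p)) {..<n}"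
    proof (rule ccontr)
      assume "\<not> ?thesis"
      hence "int m * vandermonde int n dvd vandermonde (staircase n x) n"
        using s(1) unfolding T_def by (intro vandermonde_dvd[OF n m, of s]) blast
      thus False using x unfolding non_multiple_def by simp
    qed
    thus "x \<in> (\<Union>p\<in>prime_factors m. I p)" using x unfolding I_def by auto
  qed
  hence "card {x \<in> PiE {..<n div 2} (\<lambda>_. {0..<M}). non_multiple n m x} \<le> card (\<Union>p\<in>prime_factors m. I p)"
    by (intro card_mono) (auto simp: I_def intro: finite_subset[OF _ fin])
  also have "\<dots> \<le> (\<Sum>p\<in>prime_factors m. card (I p))" by (intro card_UN_le) simp
  finally have "real (card {x \<in> PiE {..<n div 2} (\<lambda>_. {0..<M}). non_multiple n m x}) \<le> (\<Sum>p\<in>prime_factors m. real (card (I p)))"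
    by (simp flip: of_nat_sum)
  also have "\<dots> \<le> (\<Sum>p\<in>prime_factors m. real_of_int M ^ (n div 2) * exp (- (real n / (36 * real m))))"
  proof (rule sum_mono)
    fix p assume p: "p \<in> prime_factors m"
    have "real (card (I p)) \<le> real_of_int M ^ (n div 2) * exp (- (real (1 + n div 2 * (n div 2 - 1)) / real_of_int (int (T p))))"
      unfolding I_def by (rule card_injective_staircases[OF n _ M(1) TM[OF p]]) (use s(2)[OF p] in simp)
    also have "\<dots> \<le> real_of_int M ^ (n div 2) * exp (- (real n / (36 * real m)))"
      using exponent_bound[OF n m s(2)[OF p] s(3)[OF p]] M(1) by (intro mult_left_mono) auto
    finally show "real (card (I p)) \<le> real_of_int M ^ (n div 2) * exp (- (real n / (36 * real m)))" .
  qed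
  finally show thesis by (intro that[OF M]) (simp add: ac_simps)
qed

text \<open>
  If some coefficient \<open>c i\<close> is odd, then flipping the lowest bit of coordinate \<open>i\<close> injects the odd
  points into the even ones; the box is preserved because \<open>M\<close> is even.
\<close>

lemma card_even_combinations:
  fixes c :: "nat \<Rightarrow> int" and M :: int
  assumes "even M" "M > 0"
  shows "real_of_int M ^ k \<le> 2 * real (card {x \<in> PiE {..<k} (\<lambda>_. {0..<M}). even (\<Sum>t<k. c t * x t)})"
proof -
  define B where "B = PiE {..<k} (\<lambda>_. {0..<M})"
  define E where "E = {x \<in> B. even (\<Sum>t<k. c t * x t)}"
  have fin: "finite B" unfolding B_def by (intro finite_PiE) auto
  have "card (B - E) \<le> card E"
  proof (cases "\<forall>t<k. even (c t)")
    case True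
    hence "even (\<Sum>t<k. c t * x t)" for x by (intro dvd_sum) auto
    hence "B - E = {}" unfolding E_def by auto
    thus ?thesis by (simp only: card.empty)
  next
    case False
    then obtain i where i: "i < k" "odd (c i)" by auto
    define f where "f = (\<lambda>x::nat \<Rightarrow> int. x(i := if even (x i) then x i + 1 else x i - 1))"
    have "f ` (B - E) \<subseteq> E"
    proof
      fix z assume "z \<in> f ` (B - E)"
      then obtain x where x: "z = f x" "x \<in> B" "odd (\<Sum>t<k. c t * x t)" unfolding E_def by auto
      have xi: "0 \<le> x i" "x i < M" using PiE_mem[OF x(2)[unfolded B_def], of i] i by auto
      have "x i + 1 \<noteq> M" if "even (x i)" using that assms(1) by auto
      moreover have "x i \<noteq> 0" if "odd (x i)" using that by auto
      ultimately have fi: "f x i \<in> {0..<M}" using xi unfolding f_def by force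
      have "f x \<in> B"
        unfolding B_def
      proof (rule PiE_I)
        fix s assume "s \<in> {..<k}"
        thus "f x s \<in> {0..<M}" using fi PiE_mem[OF x(2)[unfolded B_def], of s] unfolding f_def by (cases "s = i") auto
      next
        fix s assume "s \<notin> {..<k}"
        thus "f x s = undefined" using PiE_arb[OF x(2)[unfolded B_def], of s] i(1) unfolding f_def by auto
      qed
      moreover have "even (\<Sum>t<k. c t * f x t)"
      proof -
        have "(\<Sum>t<k. c t * y t) = c i * y i + (\<Sum>t\<in>{..<k} - {i}. c t * y t)" for y
          using i(1) by (intro sum.remove) auto
        moreover have "(\<Sum>t\<in>{..<k} - {i}. c t * f x t) = (\<Sum>t\<in>{..<k} - {i}. c t * x t)"
          unfolding f_def by (intro sum.cong) auto
        moreover have "even (f x i) \<longleftrightarrow> odd (x i)" unfolding f_def by auto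
        ultimately show ?thesis using x(3) i(2) by auto
      qed
      ultimately show "z \<in> E" unfolding E_def x(1) by simp
    qed
    moreover have "inj_on f (B - E)"
    proof (rule inj_onI)
      fix x y assume eq: "f x = f y"
      have "x i = y i" using fun_cong[OF eq, of i] unfolding f_def by (auto split: if_splits) presburger+
      moreover have "x s = y s" if "s \<noteq> i" for s using fun_cong[OF eq, of s] that unfolding f_def by simp
      ultimately show "x = y" by (metis ext)
    qed
    moreover have "finite E" using fin unfolding E_def by simp
    ultimately show ?thesis using card_inj_on_le by blast
  qed
  moreover have "card B = card (B - E) + card E"
  proof -
    have "E \<subseteq> B" "finite E" using fin unfolding E_def by auto
    thus ?thesis using card_Diff_subset[of E B] card_mono[of B E] fin by simp
  qed
  ultimately have "card B \<le> 2 * card E" by linarith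
  hence "real (card B) \<le> 2 * real (card E)" by linarith
  moreover have "real (card B) = real_of_int M ^ k" unfolding B_def using assms(2) by (simp add: card_PiE)
  ultimately show ?thesis unfolding E_def B_def by simp
qed

section \<open>Densities of periodic subsets of a lattice\<close>

text \<open>
  A norm on \<open>\<real>\<^sup>k\<close>, with vectors as functions on all natural numbers of which only the first \<open>k\<close>
  values count. The number \<open>k\<close> varies with \<open>n\<close>, so it cannot be a type.
\<close>

locale coordinate_norm =
  fixes k :: nat and \<nu> :: "(nat \<Rightarrow> real) \<Rightarrow> real"
  assumes dim_pos: "k > 0"
    and norm_nonneg: "\<nu> x \<ge> 0"
    and norm_triangle: "\<nu> (\<lambda>t. x t + y t) \<le> \<nu> x + \<nu> y"
    and norm_scale: "\<nu> (\<lambda>t. c * x t) = \<bar>c\<bar> * \<nu> x"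
    and norm_local: "(\<And>t. t < k \<Longrightarrow> x t = y t) \<Longrightarrow> \<nu> x = \<nu> y"
    and norm_definite: "\<nu> x = 0 \<Longrightarrow> t < k \<Longrightarrow> x t = 0"
begin

definition unit_norm :: "nat \<Rightarrow> real" where
  "unit_norm t = \<nu> (\<lambda>s. if s = t then 1 else 0)"

lemma unit_norm_nonneg: "unit_norm t \<ge> 0"
  unfolding unit_norm_def by (rule norm_nonneg)

lemma norm_zero: "\<nu> (\<lambda>t. 0) = 0"
  using norm_scale[of 0 "\<lambda>t. 0"] by simp

lemma norm_le_sum: "\<nu> x \<le> (\<Sum>t<k. \<bar>x t\<bar> * unit_norm t)"
proof -
  have "\<nu> (\<lambda>s. if s < j then x s else 0) \<le> (\<Sum>t<j. \<bar>x t\<bar> * unit_norm t)" for j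
  proof (induction j)
    case 0
    show ?case using norm_zero by simp
  next
    case (Suc j)
    have "(\<lambda>s. if s < Suc j then x s else 0) = (\<lambda>s. (if s < j then x s else 0) + x j * (if s = j then 1 else 0))"
      by (auto simp: fun_eq_iff less_Suc_eq)
    hence "\<nu> (\<lambda>s. if s < Suc j then x s else 0)
        \<le> \<nu> (\<lambda>s. if s < j then x s else 0) + \<nu> (\<lambda>s. x j * (if s = j then 1 else 0))"
      using norm_triangle by metis
    also have "\<nu> (\<lambda>s. x j * (if s = j then 1 else 0)) = \<bar>x j\<bar> * unit_norm j"
      unfolding unit_norm_def by (rule norm_scale)
    finally show ?case using Suc by simp
  qed
  from this[of k] show ?thesis using norm_local[of x "\<lambda>s. if s < k then x s else 0"] by simp
qed

lemma norm_diff_le: "\<bar>\<nu> x - \<nu> y\<bar> \<le> (\<Sum>t<k. \<bar>x t - y t\<bar> * unit_norm t)"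
proof -
  have *: "\<nu> u - \<nu> v \<le> (\<Sum>t<k. \<bar>u t - v t\<bar> * unit_norm t)" for u v
    using norm_triangle[of "\<lambda>t. u t - v t" v] norm_le_sum[of "\<lambda>t. u t - v t"] by simp
  show ?thesis using *[of x y] *[of y x] by (simp add: abs_minus_commute)
qed

lemma continuous_norm: "continuous_on UNIV \<nu>"
proof -
  have "(\<nu> \<longlongrightarrow> \<nu> a) (at a)" for a
  proof -
    define h where "h = (\<lambda>x::nat \<Rightarrow> real. \<Sum>t<k. \<bar>x t - a t\<bar> * unit_norm t)"
    have "continuous_on UNIV h"
      unfolding h_def by (intro continuous_intros continuous_on_product_coordinates)
    hence "(h \<longlongrightarrow> h a) (at a)" unfolding continuous_on_def by blast
    hence "(h \<longlongrightarrow> 0) (at a)" by (simp add: h_def)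
    hence "((\<lambda>x. \<nu> x - \<nu> a) \<longlongrightarrow> 0) (at a)"
      by (rule Lim_null_comparison[rotated]) (simp add: h_def norm_diff_le)
    thus ?thesis by (simp add: LIM_zero_iff)
  qed
  thus ?thesis unfolding continuous_on_def by blast
qed

text \<open>
  Every norm dominates the maximum norm up to a constant: it is continuous and positive on the
  compact boundary of the unit cube.
\<close>

lemma coordinate_bound: "\<exists>K>0. \<forall>x. \<forall>t<k. \<bar>x t\<bar> \<le> K * \<nu> x"
proof -
  \<comment> \<open>The faces of the cube, one for each coordinate; by homogeneity the faces with
    coordinate 1 suffice. Coordinates from \<open>k\<close> on are frozen to 0 to get compactness.\<close>
  define B where "B = (\<lambda>t. PiE UNIV (\<lambda>s::nat. if s = t then {1::real} else if s < k then {-1..1} else {0}))"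
  define S where "S = (\<Union>t<k. B t)"
  have "compact (B t)" for t
  proof -
    have "compactin (product_topology (\<lambda>i. euclidean) UNIV) (B t)"
      unfolding B_def compactin_PiE by simp
    thus ?thesis by (simp add: euclidean_product_topology)
  qed
  hence "compact S" unfolding S_def by (intro compact_UN) auto
  moreover have "S \<noteq> {}"
  proof -
    have "(\<lambda>s. if s = 0 then 1 else 0) \<in> B 0" unfolding B_def by auto
    thus ?thesis unfolding S_def using dim_pos by auto
  qed
  ultimately obtain y where y: "y \<in> S" "\<forall>z\<in>S. \<nu> y \<le> \<nu> z"
    using continuous_attains_inf[of S \<nu>] continuous_on_subset[OF continuous_norm] by blast
  obtain t0 where t0: "t0 < k" "y \<in> B t0" using y(1) unfolding S_def by auto
  have "y t0 = 1" using PiE_mem[OF t0(2)[unfolded B_def], of t0] by simp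
  hence pos: "\<nu> y > 0" using norm_definite[of y t0] norm_nonneg[of y] t0(1) by fastforce
  have "\<bar>x t\<bar> \<le> (1 / \<nu> y) * \<nu> x" if "t < k" for x t
  proof (cases "\<forall>t<k. x t = 0")
    case True
    thus ?thesis using that norm_nonneg[of x] pos by simp
  next
    case False
    have "Max ((\<lambda>t. \<bar>x t\<bar>) ` {..<k}) \<in> (\<lambda>t. \<bar>x t\<bar>) ` {..<k}" using dim_pos by (intro Max_in) auto
    then obtain s where s': "s < k" "\<bar>x s\<bar> = Max ((\<lambda>t. \<bar>x t\<bar>) ` {..<k})" by force
    have s: "s < k" "\<And>t. t < k \<Longrightarrow> \<bar>x t\<bar> \<le> \<bar>x s\<bar>" unfolding s'(2) using s'(1) by auto
    have xs: "x s \<noteq> 0" using False s(2) by force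
    define z where "z = (\<lambda>t. if t < k then x t / x s else 0)"
    have "\<bar>x t / x s\<bar> \<le> 1" if "t < k" for t
      using s(2)[OF that] xs by (simp add: abs_divide)
    hence "x t / x s \<in> {-1..1}" if "t < k" for t
      using that unfolding abs_le_iff atLeastAtMost_iff minus_le_iff[of _ 1] by blast
    hence "z \<in> B s" unfolding B_def z_def using s(1) xs by auto
    hence "\<nu> y \<le> \<nu> z" using y(2) s(1) unfolding S_def by auto
    also have "\<nu> z = \<nu> (\<lambda>t. (1 / x s) * x t)" unfolding z_def by (rule norm_local) simp
    also have "\<dots> = \<nu> x / \<bar>x s\<bar>" using norm_scale[of "1 / x s" x] by simp
    finally have "\<bar>x s\<bar> \<le> (1 / \<nu> y) * \<nu> x" using xs pos by (simp add: field_simps)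
    thus ?thesis using s(2)[OF that] by linarith
  qed
  thus ?thesis using pos by (intro exI[of _ "1 / \<nu> y"]) simp
qed

abbreviation lattice_points :: "(nat \<Rightarrow> int) set" where
  "lattice_points \<equiv> PiE {..<k} (\<lambda>_. UNIV)"

abbreviation int_norm :: "(nat \<Rightarrow> int) \<Rightarrow> real" where
  "int_norm x \<equiv> \<nu> (\<lambda>t. of_int (x t))"

definition residue_ball :: "int \<Rightarrow> (nat \<Rightarrow> int) \<Rightarrow> real \<Rightarrow> (nat \<Rightarrow> int) set" where
  "residue_ball M c r = {x \<in> lattice_points. (\<forall>t<k. [x t = c t] (mod M)) \<and> int_norm x < r}"

definition bound_const :: real where
  "bound_const = (SOME K. K > 0 \<and> (\<forall>x. \<forall>t<k. \<bar>x t\<bar> \<le> K * \<nu> x))"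

lemma bound_const: "bound_const > 0" "t < k \<Longrightarrow> \<bar>x t\<bar> \<le> bound_const * \<nu> x"
proof -
  have "bound_const > 0 \<and> (\<forall>x. \<forall>t<k. \<bar>x t\<bar> \<le> bound_const * \<nu> x)"
    unfolding bound_const_def by (rule someI_ex) (use coordinate_bound in blast)
  thus "bound_const > 0" "t < k \<Longrightarrow> \<bar>x t\<bar> \<le> bound_const * \<nu> x" by auto
qed

definition radius :: "real \<Rightarrow> int" where
  "radius r = \<lceil>bound_const * r\<rceil>"

lemma coordinate_in_radius:
  assumes "int_norm x < r" "t < k"
  shows "x t \<in> {- radius r..radius r}"
proof -
  have "\<bar>real_of_int (x t)\<bar> \<le> bound_const * int_norm x" using bound_const(2)[OF assms(2), of "\<lambda>t. of_int (x t)"] .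
  also have "\<dots> \<le> bound_const * r" using bound_const(1) assms(1) by simp
  also have "\<dots> \<le> of_int (radius r)" unfolding radius_def by simp
  finally have "\<bar>x t\<bar> \<le> radius r" by linarith
  thus ?thesis by auto
qed

lemma finite_norm_ball: "finite {x \<in> lattice_points. int_norm x < r}"
proof (rule finite_subset)
  show "{x \<in> lattice_points. int_norm x < r} \<subseteq> PiE {..<k} (\<lambda>_. {- radius r..radius r})"
    using coordinate_in_radius by (auto simp: PiE_iff extensional_def)
  show "finite (PiE {..<k} (\<lambda>_. {- radius r..radius r}))" by (intro finite_PiE) auto
qed

lemma finite_residue_ball [simp]: "finite (residue_ball M c r)"
  by (rule finite_subset[OF _ finite_norm_ball[of r]]) (auto simp: residue_ball_def)

text \<open>
  A bound for the number of lines in a fixed coordinate direction through integer points of the ball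
  of radius \<open>r\<close>. It grows like \<open>r ^ (k - 1)\<close>.
\<close>

definition boundary_bound :: "real \<Rightarrow> nat" where
  "boundary_bound r = nat (2 * radius r + 1) ^ (k - 1)"

text \<open>
  Translation by a unit vector maps the points of one residue class into the neighbouring class. A
  point leaves the ball under this translation only if it is the last one on its line, because
  balls are convex; so at most one point per line is lost.
\<close>

lemma card_residue_ball_step:
  assumes t: "t < k"
  shows "card (residue_ball M c r) \<le> card (residue_ball M (c(t := c t + 1)) r) + boundary_bound r"
proof -
  define X where "X = {x \<in> residue_ball M c r. int_norm (x(t := x t + 1)) \<ge> r}"
  have "(\<lambda>x. x(t := x t + 1)) ` (residue_ball M c r - X) \<subseteq> residue_ball M (c(t := c t + 1)) r"
    unfolding X_def residue_ball_def using t by (auto simp: PiE_iff extensional_def cong_add)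
  moreover have "inj_on (\<lambda>x. x(t := x t + 1)) (residue_ball M c r - X)"
  proof (rule inj_onI)
    fix x y :: "nat \<Rightarrow> int" assume "x(t := x t + 1) = y(t := y t + 1)"
    hence "(x(t := x t + 1)) s = (y(t := y t + 1)) s" for s by simp
    hence "x s = y s" for s by (cases "s = t") (force split: if_splits simp: fun_upd_def)+
    thus "x = y" by auto
  qed
  ultimately have 1: "card (residue_ball M c r - X) \<le> card (residue_ball M (c(t := c t + 1)) r)"
    using card_inj_on_le[OF _ _ finite_residue_ball] by blast
  have "(\<lambda>x. restrict x ({..<k} - {t})) ` X \<subseteq> PiE ({..<k} - {t}) (\<lambda>_. {- radius r..radius r})"
  proof
    fix z assume "z \<in> (\<lambda>x. restrict x ({..<k} - {t})) ` X"
    then obtain x where x: "z = restrict x ({..<k} - {t})" "int_norm x < r" 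
      unfolding X_def residue_ball_def by auto
    thus "z \<in> PiE ({..<k} - {t}) (\<lambda>_. {- radius r..radius r})" using coordinate_in_radius[OF x(2)] by auto
  qed
  moreover have "inj_on (\<lambda>x. restrict x ({..<k} - {t})) X"
  proof -
    have no: False if x: "x \<in> X" and y: "y \<in> X" and eq: "\<And>s. s < k \<Longrightarrow> s \<noteq> t \<Longrightarrow> x s = y s" and lt: "x t < y t" for x y
    proof -
      \<comment> \<open>\<open>x + e\<^sub>t\<close> lies on the segment from \<open>x\<close> to \<open>y\<close>, at parameter \<open>l\<close>.\<close>
      define l where "l = 1 / (real_of_int (y t) - real_of_int (x t))"
      have d: "real_of_int (y t) - real_of_int (x t) \<ge> 1" using lt by linarith
      have l: "0 < l" "l \<le> 1" using d unfolding l_def by auto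
      have "int_norm (x(t := x t + 1)) = \<nu> (\<lambda>s. (1 - l) * of_int (x s) + l * of_int (y s))"
      proof (rule norm_local)
        fix s assume "s < k"
        have "l * (real_of_int (y t) - real_of_int (x t)) = 1" using d unfolding l_def by simp
        thus "of_int ((x(t := x t + 1)) s) = (1 - l) * of_int (x s) + l * of_int (y s)"
          using eq[OF \<open>s < k\<close>] by (cases "s = t") (auto simp: algebra_simps)
      qed
      also have "\<dots> \<le> (1 - l) * int_norm x + l * int_norm y"
        using norm_triangle[of "\<lambda>s. (1 - l) * of_int (x s)" "\<lambda>s. l * of_int (y s)"] l by (simp add: norm_scale)
      also have "\<dots> < (1 - l) * r + l * r"
      proof (rule add_le_less_mono)
        show "(1 - l) * int_norm x \<le> (1 - l) * r" using l x unfolding X_def residue_ball_def by (intro mult_left_mono) auto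
        show "l * int_norm y < l * r" using l y unfolding X_def residue_ball_def by simp
      qed
      also have "\<dots> = r" by (simp add: algebra_simps)
      finally show False using x unfolding X_def by simp
    qed
    show ?thesis
    proof (rule inj_onI)
      fix x y assume xy: "x \<in> X" "y \<in> X" and "restrict x ({..<k} - {t}) = restrict y ({..<k} - {t})"
      hence eq: "x s = y s" if "s < k" "s \<noteq> t" for s using that by (metis DiffI lessThan_iff restrict_apply' singletonD)
      have "x t = y t" using no[OF xy eq] no[OF xy(2,1) eq[symmetric]] by (metis linorder_neqE)
      thus "x = y" using xy eq unfolding X_def residue_ball_def by (intro ext) (metis (mono_tags, lifting) PiE_arb lessThan_iff mem_Collect_eq)
    qed
  qed
  moreover have "finite (PiE ({..<k} - {t}) (\<lambda>_. {- radius r..radius r}))" by (intro finite_PiE) auto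
  ultimately have "card X \<le> card (PiE ({..<k} - {t}) (\<lambda>_. {- radius r..radius r}))"
    using card_inj_on_le by blast
  also have "\<dots> = boundary_bound r" unfolding boundary_bound_def using t by (simp add: card_PiE add.commute)
  finally have 2: "card X \<le> boundary_bound r" .
  have "card (residue_ball M c r) = card (residue_ball M c r - X) + card X"
    by (subst card_Diff_subset) (auto simp: X_def intro!: le_add_diff_inverse2[symmetric] card_mono)
  thus ?thesis using 1 2 by linarith
qed

lemma card_residue_ball_steps:
  assumes t: "t < k"
  shows "card (residue_ball M c r) \<le> card (residue_ball M (c(t := c t + int j)) r) + j * boundary_bound r"
proof (induction j)
  case (Suc j)
  have "(c(t := c t + int j))(t := (c(t := c t + int j)) t + 1) = c(t := c t + int (Suc j))" by auto
  hence "card (residue_ball M (c(t := c t + int j)) r) \<le> card (residue_ball M (c(t := c t + int (Suc j))) r) + boundary_bound r"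
    using card_residue_ball_step[OF t, of M "c(t := c t + int j)" r] by metis
  thus ?case using Suc.IH unfolding mult_Suc by linarith
qed simp

lemma residue_ball_cong:
  assumes "\<And>t. t < k \<Longrightarrow> [c t = c' t] (mod M)"
  shows "residue_ball M c r = residue_ball M c' r"
  unfolding residue_ball_def using assms by (meson cong_sym cong_trans)

text \<open>
  Any class is reached from any other by fewer than \<open>M\<close> unit steps in each coordinate.
\<close>

lemma card_residue_ball_le:
  assumes "M > 0"
  shows "card (residue_ball M c r) \<le> card (residue_ball M c' r) + k * (nat M * boundary_bound r)"
proof -
  \<comment> \<open>The classes between \<open>c\<close> and \<open>c'\<close> in which the first \<open>T\<close> coordinates have been adjusted.\<close>
  define d where "d = (\<lambda>T t. if t < T then c' t else c t)"
  have "card (residue_ball M c r) \<le> card (residue_ball M (d T) r) + T * (nat M * boundary_bound r)" if "T \<le> k" for T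
    using that
  proof (induction T)
    case (Suc T)
    define j where "j = nat ((c' T - c T) mod M)"
    have j: "int j = (c' T - c T) mod M" "j \<le> nat M" unfolding j_def using assms by (auto intro: nat_mono less_imp_le)
    have "residue_ball M ((d T)(T := d T T + int j)) r = residue_ball M (d (Suc T)) r"
    proof (rule residue_ball_cong)
      fix t assume "t < k"
      have "[c T + (c' T - c T) mod M = c' T] (mod M)" by (simp add: cong_def mod_add_right_eq)
      thus "[((d T)(T := d T T + int j)) t = d (Suc T) t] (mod M)" unfolding d_def j(1) by (auto simp: less_Suc_eq)
    qed
    hence "card (residue_ball M (d T) r) \<le> card (residue_ball M (d (Suc T)) r) + j * boundary_bound r"
      using card_residue_ball_steps[of T M "d T" r j] Suc.prems by simp
    also have "j * boundary_bound r \<le> nat M * boundary_bound r" using j(2) by simp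
    finally show ?case using Suc by simp
  qed (simp add: d_def)
  from this[of k] show ?thesis using residue_ball_cong[of "d k" c' M r] by (simp add: d_def)
qed

text \<open>
  A cube of this many multiples of \<open>M\<close> per side, starting at the origin, fits into the ball of radius
  \<open>r\<close>.
\<close>

definition inner_side :: "int \<Rightarrow> real \<Rightarrow> nat" where
  "inner_side M r = nat \<lfloor>r / (of_int M * (\<Sum>t<k. unit_norm t) + 1)\<rfloor>"

lemma card_residue_ball_zero_ge:
  assumes "M > 0"
  shows "inner_side M r ^ k \<le> card (residue_ball M (\<lambda>_. 0) r)"
proof -
  define h where "h = inner_side M r"
  define C where "C = of_int M * (\<Sum>t<k. unit_norm t) + 1"
  have C: "C > 0" unfolding C_def using assms unit_norm_nonneg by (intro add_nonneg_pos mult_nonneg_nonneg sum_nonneg) auto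
  define \<phi> where "\<phi> = (\<lambda>z::nat \<Rightarrow> int. restrict (\<lambda>t. M * z t) {..<k})"
  have "\<phi> ` PiE {..<k} (\<lambda>_. {0..<int h}) \<subseteq> residue_ball M (\<lambda>_. 0) r"
  proof
    fix x assume "x \<in> \<phi> ` PiE {..<k} (\<lambda>_. {0..<int h})"
    then obtain z where z: "x = \<phi> z" "z \<in> PiE {..<k} (\<lambda>_. {0..<int h})" by auto
    have zt: "0 \<le> z t" "z t < int h" if "t < k" for t using PiE_mem[OF z(2), of t] that by simp_all
    have "h > 0" using zt[OF dim_pos] by simp
    hence "real h \<le> r / C" unfolding h_def inner_side_def C_def[symmetric] by simp
    hence hr: "real h * C \<le> r" using C by (simp add: field_simps)
    have "int_norm x \<le> (\<Sum>t<k. \<bar>real_of_int (x t)\<bar> * unit_norm t)" by (rule norm_le_sum)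
    also have "\<dots> \<le> (\<Sum>t<k. (of_int M * real h) * unit_norm t)"
    proof (rule sum_mono)
      fix t assume "t \<in> {..<k}"
      hence "\<bar>x t\<bar> = M * z t" "M * z t \<le> M * int h" using zt[of t] assms unfolding z(1) \<phi>_def by auto
      hence "\<bar>x t\<bar> \<le> M * int h" by simp
      hence "\<bar>real_of_int (x t)\<bar> \<le> of_int M * real h" by (metis of_int_abs of_int_le_iff of_int_mult of_int_of_nat_eq)
      thus "\<bar>real_of_int (x t)\<bar> * unit_norm t \<le> (of_int M * real h) * unit_norm t"
        by (intro mult_right_mono unit_norm_nonneg)
    qed
    also have "\<dots> = real h * (C - 1)" unfolding C_def by (simp add: sum_distrib_left algebra_simps)
    also have "\<dots> < real h * C" using \<open>h > 0\<close> by simp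
    finally show "x \<in> residue_ball M (\<lambda>_. 0) r" using hr unfolding residue_ball_def z(1) \<phi>_def by (auto simp: cong_def)
  qed
  moreover have "inj_on \<phi> (PiE {..<k} (\<lambda>_. {0..<int h}))"
  proof (rule inj_onI)
    fix x y assume xy: "x \<in> PiE {..<k} (\<lambda>_. {0..<int h})" "y \<in> PiE {..<k} (\<lambda>_. {0..<int h})" "\<phi> x = \<phi> y"
    have "x t = y t" if "t < k" for t
      using fun_cong[OF xy(3), of t] that assms unfolding \<phi>_def by simp
    thus "x = y" using xy(1,2) by (intro PiE_ext) auto
  qed
  ultimately have "card (PiE {..<k} (\<lambda>_. {0..<int h})) \<le> card (residue_ball M (\<lambda>_. 0) r)"
    using card_inj_on_le[OF _ _ finite_residue_ball] by blast
  thus ?thesis unfolding h_def[symmetric] by (simp add: card_PiE)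
qed

lemma inner_side_at_top:
  assumes "M > 0"
  shows "filterlim (\<lambda>r. real (inner_side M r)) at_top at_top"
proof -
  define C where "C = of_int M * (\<Sum>t<k. unit_norm t) + 1"
  have C: "C > 0" unfolding C_def using assms unit_norm_nonneg by (intro add_nonneg_pos mult_nonneg_nonneg sum_nonneg) auto
  show ?thesis
    unfolding filterlim_at_top
  proof
    fix Z
    show "\<forall>\<^sub>F r in at_top. Z \<le> real (inner_side M r)"
      using eventually_ge_at_top[of "(Z + 1) * C"]
    proof eventually_elim
      case (elim r)
      hence "Z + 1 \<le> r / C" using C by (simp add: field_simps)
      thus ?case unfolding inner_side_def C_def[symmetric] by linarith
    qed
  qed
qed

text \<open>
  The boundary has order \<open>r ^ (k - 1)\<close>, while the ball contains a cube with \<open>inner_side M r ^ k\<close>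
  points of the class.
\<close>

lemma boundary_negligible:
  assumes "M > 0"
  shows "((\<lambda>r. real (boundary_bound r) / real (card (residue_ball M (\<lambda>_. 0) r))) \<longlongrightarrow> 0) at_top"
proof -
  define C where "C = of_int M * (\<Sum>t<k. unit_norm t) + 1"
  have C: "C \<ge> 1" unfolding C_def using assms unit_norm_nonneg by (simp add: mult_nonneg_nonneg sum_nonneg)
  \<comment> \<open>For large \<open>r\<close>, the factor \<open>2 * radius r + 1\<close> is at most \<open>(2 * bound_const + 3) * r\<close>, and
    \<open>inner_side M r\<close> is at least \<open>r / (2 * C)\<close>.\<close>
  define J where "J = (2 * bound_const + 3) * (2 * C)"
  have J: "J > 0" unfolding J_def using bound_const(1) C by simp
  have "((\<lambda>r. J ^ (k - 1) / real (inner_side M r)) \<longlongrightarrow> 0) at_top"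
    by (intro real_tendsto_divide_at_top[OF tendsto_const] inner_side_at_top assms)
  thus ?thesis
  proof (rule Lim_null_comparison[rotated])
    show "\<forall>\<^sub>F r in at_top. norm (real (boundary_bound r) / real (card (residue_ball M (\<lambda>_. 0) r))) \<le> J ^ (k - 1) / real (inner_side M r)"
      using eventually_ge_at_top[of "2 * C"]
    proof eventually_elim
      case (elim r)
      have r1: "r \<ge> 1" using elim C by linarith
      have "r / C \<ge> 2" using elim C by (simp add: field_simps)
      hence "real (inner_side M r) \<ge> r / C - 1" unfolding inner_side_def C_def[symmetric] by linarith
      hence h: "real (inner_side M r) \<ge> r / (2 * C)" using \<open>r / C \<ge> 2\<close> by simp
      hence h1: "real (inner_side M r) > 0" using \<open>r / C \<ge> 2\<close> by simp
      have rad: "of_int (radius r) \<le> bound_const * r + 1" "radius r \<ge> 0"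
        unfolding radius_def using mult_pos_pos[of bound_const r] bound_const(1) r1 by linarith+
      have "real (nat (2 * radius r + 1)) = 2 * of_int (radius r) + 1" using rad(2) by simp
      also have "\<dots> \<le> (2 * bound_const + 3) * r" using rad(1) r1 by (simp add: algebra_simps)
      also have "\<dots> = J * (r / (2 * C))" unfolding J_def using C by simp
      also have "\<dots> \<le> J * real (inner_side M r)" by (rule mult_left_mono[OF h]) (use J in simp)
      finally have "real (boundary_bound r) \<le> (J * real (inner_side M r)) ^ (k - 1)"
        unfolding boundary_bound_def of_nat_power by (rule power_mono) simp
      hence "real (boundary_bound r) / real (card (residue_ball M (\<lambda>_. 0) r))
          \<le> (J * real (inner_side M r)) ^ (k - 1) / real (inner_side M r) ^ k"
        using card_residue_ball_zero_ge[OF assms, of r] h1 by (intro frac_le) (auto simp flip: of_nat_power)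
      also have "\<dots> = J ^ (k - 1) / real (inner_side M r)"
        using h1 dim_pos by (cases k) (auto simp: power_mult_distrib)
      finally show ?case by simp
    qed
  qed
qed

lemma residue_balls_equidistributed:
  assumes "M > 0"
  shows "((\<lambda>r. real (card (residue_ball M c r)) / real (card (residue_ball M (\<lambda>_. 0) r))) \<longlongrightarrow> 1) at_top"
proof -
  have "((\<lambda>r. real (k * nat M) * (real (boundary_bound r) / real (card (residue_ball M (\<lambda>_. 0) r)))) \<longlongrightarrow> 0) at_top"
    using tendsto_mult_right_zero[OF boundary_negligible[OF assms]] .
  hence "((\<lambda>r. real (card (residue_ball M c r)) / real (card (residue_ball M (\<lambda>_. 0) r)) - 1) \<longlongrightarrow> 0) at_top"
  proof (rule Lim_null_comparison[rotated])
    have "\<forall>\<^sub>F r in at_top. real (inner_side M r) > 0"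
      using inner_side_at_top[OF assms] unfolding filterlim_at_top_dense by blast
    thus "\<forall>\<^sub>F r in at_top. norm (real (card (residue_ball M c r)) / real (card (residue_ball M (\<lambda>_. 0) r)) - 1)
       \<le> real (k * nat M) * (real (boundary_bound r) / real (card (residue_ball M (\<lambda>_. 0) r)))"
    proof eventually_elim
      case (elim r)
      define a where "a = card (residue_ball M c r)"
      define b where "b = card (residue_ball M (\<lambda>_. 0) r)"
      define E where "E = k * nat M * boundary_bound r"
      have "inner_side M r ^ k > 0" using elim by simp
      hence b: "b > 0" unfolding b_def using card_residue_ball_zero_ge[OF assms, of r] by linarith
      have "a \<le> b + E" "b \<le> a + E"
        unfolding a_def b_def E_def using card_residue_ball_le[OF assms] by (simp_all add: mult.assoc)
      hence "\<bar>real a - real b\<bar> \<le> real E" by linarith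
      hence "\<bar>real a - real b\<bar> / real b \<le> real E / real b" by (intro divide_right_mono) auto
      moreover have "real a / real b - 1 = (real a - real b) / real b" using b by (simp add: field_simps)
      ultimately have "\<bar>real a / real b - 1\<bar> \<le> real E / real b" by (simp add: abs_divide)
      thus ?case unfolding a_def b_def E_def by simp
    qed
  qed
  thus ?thesis by (simp add: LIM_zero_iff)
qed

abbreviation residue_box :: "int \<Rightarrow> (nat \<Rightarrow> int) set" where
  "residue_box M \<equiv> PiE {..<k} (\<lambda>_. {0..<M})"

lemma card_periodic_ball:
  assumes "M > 0" and P: "\<And>x y. (\<And>t. t < k \<Longrightarrow> [x t = y t] (mod M)) \<Longrightarrow> P x = P y"
  shows "card {x \<in> lattice_points. P x \<and> int_norm x < r} = (\<Sum>c\<in>{c \<in> residue_box M. P c}. card (residue_ball M c r))"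
proof -
  have "{x \<in> lattice_points. P x \<and> int_norm x < r} = (\<Union>c\<in>{c \<in> residue_box M. P c}. residue_ball M c r)"
  proof (intro equalityI subsetI)
    fix x assume x: "x \<in> {x \<in> lattice_points. P x \<and> int_norm x < r}"
    define c where "c = restrict (\<lambda>t. x t mod M) {..<k}"
    have xc: "[x t = c t] (mod M)" if "t < k" for t using that unfolding c_def by (simp add: cong_def)
    have "P c" using P[OF xc] x by simp
    moreover have "c \<in> residue_box M" unfolding c_def using assms(1) by auto
    ultimately show "x \<in> (\<Union>c\<in>{c \<in> residue_box M. P c}. residue_ball M c r)"
      using x xc unfolding residue_ball_def by (intro UN_I[of c]) auto
  next
    fix x assume "x \<in> (\<Union>c\<in>{c \<in> residue_box M. P c}. residue_ball M c r)"
    then obtain c where "P c" "x \<in> residue_ball M c r" by auto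
    thus "x \<in> {x \<in> lattice_points. P x \<and> int_norm x < r}" using P[of x c] unfolding residue_ball_def by auto
  qed
  moreover have "card (\<Union>c\<in>{c \<in> residue_box M. P c}. residue_ball M c r) = (\<Sum>c\<in>{c \<in> residue_box M. P c}. card (residue_ball M c r))"
  proof (rule card_UN_disjoint)
    show "finite {c \<in> residue_box M. P c}" by (intro finite_subset[OF _ finite_PiE[of "{..<k}" "\<lambda>_. {0..<M}"]]) auto
    show "\<forall>i\<in>{c \<in> residue_box M. P c}. \<forall>j\<in>{c \<in> residue_box M. P c}. i \<noteq> j \<longrightarrow> residue_ball M i r \<inter> residue_ball M j r = {}"
    proof (intro ballI impI)
      fix c d assume cd: "c \<in> {c \<in> residue_box M. P c}" "d \<in> {c \<in> residue_box M. P c}" "c \<noteq> d"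
      have "c = d" if "x \<in> residue_ball M c r \<inter> residue_ball M d r" for x
      proof (rule PiE_ext)
        show "c \<in> residue_box M" "d \<in> residue_box M" using cd by auto
        fix t assume "t \<in> {..<k}"
        hence "[c t = d t] (mod M)" "0 \<le> c t" "c t < M" "0 \<le> d t" "d t < M"
          using that cd unfolding residue_ball_def by (auto simp: cong_def dest: PiE_mem)
        thus "c t = d t" by (simp add: cong_def)
      qed
      thus "residue_ball M c r \<inter> residue_ball M d r = {}" using cd(3) by auto
    qed
  qed simp
  ultimately show ?thesis by simp
qed

text \<open>
  Both sets are unions of residue classes, and the counts of all classes are asymptotically equal.
\<close>

lemma periodic_ratio_tendsto:
  assumes "M > 0"
    and P: "\<And>x y. (\<And>t. t < k \<Longrightarrow> [x t = y t] (mod M)) \<Longrightarrow> P x = P y"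
    and R: "\<And>x y. (\<And>t. t < k \<Longrightarrow> [x t = y t] (mod M)) \<Longrightarrow> R x = R y"
    and ne: "{c \<in> residue_box M. R c} \<noteq> {}"
  shows "((\<lambda>r. real (card {x \<in> lattice_points. P x \<and> int_norm x < r}) / real (card {x \<in> lattice_points. R x \<and> int_norm x < r}))
     \<longlongrightarrow> real (card {c \<in> residue_box M. P c}) / real (card {c \<in> residue_box M. R c})) at_top"
proof -
  have fin: "finite {c \<in> residue_box M. Q c}" for Q
    by (intro finite_subset[OF _ finite_PiE[of "{..<k}" "\<lambda>_. {0..<M}"]]) auto
  define w where "w = (\<lambda>r c. real (card (residue_ball M c r)) / real (card (residue_ball M (\<lambda>_. 0) r)))"
  have lim: "((\<lambda>r. \<Sum>c\<in>{c \<in> residue_box M. Q c}. w r c) \<longlongrightarrow> real (card {c \<in> residue_box M. Q c})) at_top" for Q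
  proof -
    have "((\<lambda>r. \<Sum>c\<in>{c \<in> residue_box M. Q c}. w r c) \<longlongrightarrow> (\<Sum>c\<in>{c \<in> residue_box M. Q c}. 1)) at_top"
      unfolding w_def by (intro tendsto_sum residue_balls_equidistributed assms(1))
    thus ?thesis by simp
  qed
  have "((\<lambda>r. (\<Sum>c\<in>{c \<in> residue_box M. P c}. w r c) / (\<Sum>c\<in>{c \<in> residue_box M. R c}. w r c))
     \<longlongrightarrow> real (card {c \<in> residue_box M. P c}) / real (card {c \<in> residue_box M. R c})) at_top"
    using ne fin by (intro tendsto_divide lim) (auto simp: card_eq_0_iff)
  moreover have "\<forall>\<^sub>F r in at_top. (\<Sum>c\<in>{c \<in> residue_box M. P c}. w r c) / (\<Sum>c\<in>{c \<in> residue_box M. R c}. w r c)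
     = real (card {x \<in> lattice_points. P x \<and> int_norm x < r}) / real (card {x \<in> lattice_points. R x \<and> int_norm x < r})"
  proof -
    have "\<forall>\<^sub>F r in at_top. real (inner_side M r) > 0"
      using inner_side_at_top[OF assms(1)] unfolding filterlim_at_top_dense by blast
    thus ?thesis
    proof eventually_elim
      case (elim r)
      have "inner_side M r ^ k > 0" using elim by simp
      hence b: "card (residue_ball M (\<lambda>_. 0) r) > 0" using card_residue_ball_zero_ge[OF assms(1), of r] by linarith
      show ?case
        using less_imp_neq[OF b] by (simp del: card_eq_0_iff add: card_periodic_ball[OF assms(1) P] card_periodic_ball[OF assms(1) R] w_def
            flip: sum_divide_distrib)
    qed
  qed
  ultimately show ?thesis by (rule Lim_transform_eventually)
qed

end

definition real_combination :: "(nat \<Rightarrow> 'a \<Rightarrow> complex) \<Rightarrow> nat \<Rightarrow> (nat \<Rightarrow> real) \<Rightarrow> 'a \<Rightarrow> complex" where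
  "real_combination b k x = (\<lambda>a. \<Sum>t<k. complex_of_real (x t) * b t a)"

abbreviation int_combination :: "(nat \<Rightarrow> 'a \<Rightarrow> complex) \<Rightarrow> nat \<Rightarrow> (nat \<Rightarrow> int) \<Rightarrow> 'a \<Rightarrow> complex" where
  "int_combination b k x \<equiv> real_combination b k (\<lambda>t. of_int (x t))"

lemma real_combination_add: "real_combination b k (\<lambda>t. x t + y t) = real_combination b k x + real_combination b k y"
  by (auto simp: real_combination_def fun_eq_iff sum.distrib algebra_simps)

lemma real_combination_scale: "real_combination b k (\<lambda>t. c * x t) = (\<lambda>a. complex_of_real c * real_combination b k x a)"
  by (auto simp: real_combination_def fun_eq_iff sum_distrib_left algebra_simps)

lemma real_combination_local: "(\<And>t. t < k \<Longrightarrow> x t = y t) \<Longrightarrow> real_combination b k x = real_combination b k y"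
  by (auto simp: real_combination_def fun_eq_iff)

definition real_independent :: "(nat \<Rightarrow> 'a \<Rightarrow> complex) \<Rightarrow> nat \<Rightarrow> bool" where
  "real_independent b k \<longleftrightarrow> (\<forall>x. real_combination b k x = 0 \<longrightarrow> (\<forall>t<k. x t = 0))"

lemma real_combination_inj:
  assumes indep: "real_independent b k"
    and "real_combination b k x = real_combination b k y" "t < k"
  shows "x t = y t"
proof -
  have "real_combination b k (\<lambda>t. x t - y t) = 0"
  proof
    fix a
    have "real_combination b k (\<lambda>t. x t - y t) a = real_combination b k x a - real_combination b k y a"
      by (simp add: real_combination_def sum_subtractf algebra_simps)
    thus "real_combination b k (\<lambda>t. x t - y t) a = 0 a" using assms(2) by simp
  qed
  thus ?thesis using indep assms(3) unfolding real_independent_def by fastforce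
qed

text \<open>
  The multiples by \<open>M\<close> of the basis vectors span the same real space, so a periodic subset that
  contains them has the same norms as the whole lattice. In particular the orthogonal weights need no basis of their
  own.
\<close>

lemma real_span_full_rank_subset:
  assumes indep: "real_independent b k"
    and "M > 0" and B: "\<And>v. v \<in> B \<Longrightarrow> \<exists>x. v = int_combination b k x"
    and MB: "\<And>t. t < k \<Longrightarrow> int_combination b k (\<lambda>s. if s = t then M else 0) \<in> B"
  shows "real_span B = range (real_combination b k)"
proof (intro equalityI subsetI)
  fix v assume "v \<in> real_span B"
  then obtain S c where S: "finite S" "S \<subseteq> B" "v = (\<lambda>a. \<Sum>u\<in>S. complex_of_real (c u) * u a)"
    unfolding real_span_def by auto
  obtain f where f: "\<And>u. u \<in> S \<Longrightarrow> u = int_combination b k (f u)" using B S(2) by (metis subsetD)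
  have "v = real_combination b k (\<lambda>t. \<Sum>u\<in>S. c u * of_int (f u t))"
  proof
    fix a
    have "v a = (\<Sum>u\<in>S. complex_of_real (c u) * int_combination b k (f u) a)"
      unfolding S(3) using f by (intro sum.cong refl) metis
    also have "\<dots> = (\<Sum>u\<in>S. \<Sum>t<k. complex_of_real (c u) * (of_int (f u t) * b t a))"
      by (simp add: real_combination_def sum_distrib_left)
    also have "\<dots> = (\<Sum>t<k. \<Sum>u\<in>S. complex_of_real (c u) * (of_int (f u t) * b t a))" by (rule sum.swap)
    also have "\<dots> = real_combination b k (\<lambda>t. \<Sum>u\<in>S. c u * of_int (f u t)) a"
      by (simp add: real_combination_def sum_distrib_right mult.assoc)
    finally show "v a = real_combination b k (\<lambda>t. \<Sum>u\<in>S. c u * of_int (f u t)) a" .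
  qed
  thus "v \<in> range (real_combination b k)" by blast
next
  fix v assume "v \<in> range (real_combination b k)"
  then obtain x where x: "v = real_combination b k x" by auto
  define \<phi> where "\<phi> = (\<lambda>t. int_combination b k (\<lambda>s. if s = t then M else 0))"
  have inj: "inj_on \<phi> {..<k}"
  proof (rule inj_onI)
    fix s t assume st: "s \<in> {..<k}" "t \<in> {..<k}" "\<phi> s = \<phi> t"
    have "real_of_int (if s = s then M else 0) = of_int (if s = t then M else 0)"
      by (rule real_combination_inj[OF indep st(3)[unfolded \<phi>_def]]) (use st in auto)
    thus "s = t" using assms(2) by (auto split: if_splits)
  qed
  define c where "c = (\<lambda>u. x (inv_into {..<k} \<phi> u) / of_int M)"
  have "v a = (\<Sum>u\<in>\<phi> ` {..<k}. complex_of_real (c u) * u a)" for a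
  proof -
    have "(\<Sum>u\<in>\<phi> ` {..<k}. complex_of_real (c u) * u a) = (\<Sum>t<k. complex_of_real (c (\<phi> t)) * \<phi> t a)"
      by (simp add: sum.reindex[OF inj])
    also have "\<dots> = (\<Sum>t<k. complex_of_real (x t) * b t a)"
    proof (intro sum.cong refl)
      fix t assume t: "t \<in> {..<k}"
      have "\<phi> t a = (\<Sum>s<k. if s = t then of_int M * b t a else 0)"
        unfolding \<phi>_def real_combination_def by (intro sum.cong) auto
      hence "\<phi> t a = of_int M * b t a" using t by simp
      thus "complex_of_real (c (\<phi> t)) * \<phi> t a = complex_of_real (x t) * b t a"
        unfolding c_def using inv_into_f_f[OF inj t] assms(2) by simp
    qed
    finally show ?thesis unfolding x real_combination_def by simp
  qed
  thus "v \<in> real_span B" unfolding real_span_def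
    using MB by (intro CollectI exI[of _ "\<phi> ` {..<k}"] exI[of _ c]) (auto simp: \<phi>_def)
qed

text \<open>
  The density is defined by unique choice among numbers that are limits for all norms; without a norm
  every number would qualify.
\<close>

lemma exists_norm_on_span:
  assumes indep: "real_independent b k"
  shows "\<exists>N. is_norm_on (range (real_combination b k)) N"
proof -
  define X where "X = (\<lambda>v. SOME x. v = real_combination b k x)"
  define N where "N = (\<lambda>v. \<Sum>t<k. \<bar>X v t\<bar>)"
  have X: "X (real_combination b k x) t = x t" if "t < k" for x t
  proof -
    have "real_combination b k x = real_combination b k (X (real_combination b k x))"
      unfolding X_def by (rule someI[of _ x]) simp
    from real_combination_inj[OF indep this that] show ?thesis by simp
  qed
  have N: "N (real_combination b k x) = (\<Sum>t<k. \<bar>x t\<bar>)" for x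
    unfolding N_def using X by simp
  have z: "real_combination b k x = 0 \<longleftrightarrow> (\<forall>t<k. x t = 0)" for x
    using indep unfolding real_independent_def by (auto simp: real_combination_def fun_eq_iff)
  have "is_norm_on (range (real_combination b k)) N"
    unfolding is_norm_on_def
    by (auto simp: N z real_combination_add[symmetric] real_combination_scale[symmetric] sum_nonneg sum_nonneg_eq_0_iff
        abs_mult sum_distrib_left sum.distrib[symmetric] intro!: sum_mono)
  thus ?thesis by blast
qed

text \<open>
  The number of residue classes does not involve the norm. So the limits for all norms agree, and
  their common value is the density.
\<close>

theorem density_periodic:
  fixes P R :: "(nat \<Rightarrow> int) \<Rightarrow> bool"
  assumes "k > 0" and indep: "real_independent b k"
    and M: "M > 0"
    and P: "\<And>x y. (\<And>t. t < k \<Longrightarrow> [x t = y t] (mod M)) \<Longrightarrow> P x = P y"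
    and R: "\<And>x y. (\<And>t. t < k \<Longrightarrow> [x t = y t] (mod M)) \<Longrightarrow> R x = R y"
    and R0: "R (\<lambda>_. 0)"
  shows "density {int_combination b k x | x. P x} {int_combination b k x | x. R x}
    = real (card {c \<in> PiE {..<k} (\<lambda>_. {0..<M}). P c}) / real (card {c \<in> PiE {..<k} (\<lambda>_. {0..<M}). R c})"
    (is "density ?A ?B = ?d")
proof -
  have span: "real_span ?B = range (real_combination b k)"
  proof (rule real_span_full_rank_subset[OF indep M])
    fix t assume "t < k"
    have "R (\<lambda>s. if s = t then M else 0)" using R0 R[of "\<lambda>s. if s = t then M else 0" "\<lambda>_. 0"] by (auto simp: cong_def)
    thus "int_combination b k (\<lambda>s. if s = t then M else 0) \<in> ?B" by auto
  qed auto
  have count: "card {v \<in> {int_combination b k x | x. Q x}. N v < r}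
      = card {x \<in> PiE {..<k} (\<lambda>_. UNIV). Q x \<and> N (int_combination b k x) < r}"
    if Q: "\<And>x y. (\<And>t. t < k \<Longrightarrow> [x t = y t] (mod M)) \<Longrightarrow> Q x = Q y" for Q N and r :: real
  proof -
    have "{v \<in> {int_combination b k x | x. Q x}. N v < r}
      = (\<lambda>x. int_combination b k x) ` {x \<in> PiE {..<k} (\<lambda>_. UNIV). Q x \<and> N (int_combination b k x) < r}"
    proof (intro equalityI subsetI)
      fix v assume "v \<in> {v \<in> {int_combination b k x | x. Q x}. N v < r}"
      then obtain x where x: "v = int_combination b k x" "Q x" "N v < r" by auto
      define y where "y = restrict x {..<k}"
      have v: "v = int_combination b k y" unfolding x(1) y_def by (rule real_combination_local) simp
      moreover have "Q y" using Q[of x y] x(2) unfolding y_def by simp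
      moreover have "y \<in> PiE {..<k} (\<lambda>_. UNIV)" unfolding y_def by simp
      ultimately show "v \<in> (\<lambda>x. int_combination b k x) ` {x \<in> PiE {..<k} (\<lambda>_. UNIV). Q x \<and> N (int_combination b k x) < r}"
        using x(3) by blast
    qed auto
    moreover have "inj_on (\<lambda>x. int_combination b k x) (PiE {..<k} (\<lambda>_. UNIV))"
    proof (rule inj_onI)
      fix x y :: "nat \<Rightarrow> int" assume xy: "x \<in> PiE {..<k} (\<lambda>_. UNIV)" "y \<in> PiE {..<k} (\<lambda>_. UNIV)"
        "int_combination b k x = int_combination b k y"
      show "x = y"
      proof (rule PiE_ext[OF xy(1,2)])
        fix t assume "t \<in> {..<k}"
        thus "x t = y t" using real_combination_inj[OF indep xy(3), of t] by simp
      qed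
    qed
    ultimately show ?thesis by (simp add: card_image inj_on_subset[of _ "PiE {..<k} (\<lambda>_. UNIV)"] subset_iff)
  qed
  have lim: "((\<lambda>r. real (card {a\<in>?A. N a < r}) / real (card {v\<in>?B. N v < r})) \<longlongrightarrow> ?d) at_top"
    if N: "is_norm_on (real_span ?B) N" for N
  proof -
    have mem: "real_combination b k x \<in> real_span ?B" for x unfolding span by simp
    interpret coordinate_norm k "\<lambda>x. N (real_combination b k x)"
    proof
      fix x y :: "nat \<Rightarrow> real" and c :: real and t
      show "0 \<le> N (real_combination b k x)" using N mem unfolding is_norm_on_def by blast
      show "N (real_combination b k (\<lambda>t. x t + y t)) \<le> N (real_combination b k x) + N (real_combination b k y)"
        unfolding real_combination_add using N mem unfolding is_norm_on_def by blast
      show "N (real_combination b k (\<lambda>t. c * x t)) = \<bar>c\<bar> * N (real_combination b k x)"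
        unfolding real_combination_scale using N mem unfolding is_norm_on_def by blast
      show "N (real_combination b k x) = N (real_combination b k y)" if "\<And>t. t < k \<Longrightarrow> x t = y t"
        using real_combination_local[of k x y b] that by simp
      show "x t = 0" if "N (real_combination b k x) = 0" "t < k"
        using that N mem[of x] indep unfolding is_norm_on_def real_independent_def by blast
    qed (rule assms(1))
    have ne: "{c \<in> residue_box M. R c} \<noteq> {}"
    proof -
      have "R (restrict (\<lambda>_. 0) {..<k})" using R0 R[of "restrict (\<lambda>_. 0) {..<k}" "\<lambda>_. 0"] by auto
      moreover have "restrict (\<lambda>_. 0) {..<k} \<in> residue_box M" using M by auto
      ultimately show ?thesis by blast
    qed
    have "((\<lambda>r. real (card {x \<in> lattice_points. P x \<and> N (int_combination b k x) < r})
          / real (card {x \<in> lattice_points. R x \<and> N (int_combination b k x) < r})) \<longlongrightarrow> ?d) at_top"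
      by (rule periodic_ratio_tendsto[OF M P R ne])
    moreover have "card {v \<in> ?A. N v < r} = card {x \<in> lattice_points. P x \<and> N (int_combination b k x) < r}" for r
      by (rule count) (rule P)
    moreover have "card {v \<in> ?B. N v < r} = card {x \<in> lattice_points. R x \<and> N (int_combination b k x) < r}" for r
      by (rule count) (rule R)
    ultimately show ?thesis by simp
  qed
  obtain N0 where N0: "is_norm_on (real_span ?B) N0" using exists_norm_on_span[OF indep] unfolding span by blast
  show ?thesis
    unfolding density_def
  proof (rule the_equality)
    show "\<forall>N. is_norm_on (real_span ?B) N \<longrightarrow>
     ((\<lambda>r. real (card {a\<in>?A. N a < r}) / real (card {v\<in>?B. N v < r})) \<longlongrightarrow> ?d) at_top" using lim by blast
    fix d assume "\<forall>N. is_norm_on (real_span ?B) N \<longrightarrow>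
     ((\<lambda>r. real (card {a\<in>?A. N a < r}) / real (card {v\<in>?B. N v < r})) \<longlongrightarrow> d) at_top"
    hence "((\<lambda>r. real (card {a\<in>?A. N0 a < r}) / real (card {v\<in>?B. N0 v < r})) \<longlongrightarrow> d) at_top"
      using N0 by (elim allE[of _ N0] impE)
    from tendsto_unique[OF trivial_limit_at_top_linorder this lim[OF N0]] show "d = ?d" .
  qed
qed

section \<open>Roots, coroots and functionals of the special linear Lie algebra\<close>

locale special_linear =
  fixes n :: nat
  assumes n_ge_2: "n \<ge> 2"
begin

abbreviation cartan :: "complex mat set" where "cartan \<equiv> sl_cartan n"

definition diag :: "(nat \<Rightarrow> complex) \<Rightarrow> complex mat" where
  "diag v = Matrix.mat n n (\<lambda>(i, j). if i = j then v i else 0)"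

text \<open>
  Every functional on the Cartan subalgebra has this form, and \<open>\<xi>\<close> is unique up to an additive
  constant because traces vanish. Outside the Cartan subalgebra the value is 0, the convention for
  functionals.
\<close>

definition functional_of :: "(nat \<Rightarrow> complex) \<Rightarrow> functional" where
  "functional_of \<xi> = (\<lambda>H. if H \<in> cartan then \<Sum>i<n. \<xi> i * H $$ (i, i) else 0)"

text \<open>
  The vector \<open>e\<^sub>i - e\<^sub>j\<close>: read as coefficients it is a root, read as diagonal entries it is the
  corresponding coroot.
\<close>

definition delta :: "nat \<Rightarrow> nat \<Rightarrow> nat \<Rightarrow> complex" where
  "delta i j s = of_bool (s = i) - of_bool (s = j)"

abbreviation coroot_mat :: "nat \<Rightarrow> nat \<Rightarrow> complex mat" where
  "coroot_mat i j \<equiv> diag (delta i j)"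

abbreviation sl_root :: "nat \<Rightarrow> nat \<Rightarrow> functional" where
  "sl_root i j \<equiv> functional_of (delta i j)"

lemma diag_index [simp]: "i < n \<Longrightarrow> j < n \<Longrightarrow> diag v $$ (i, j) = (if i = j then v i else 0)"
  by (simp add: diag_def)

lemma diag_dim [simp]: "dim_row (diag v) = n" "dim_col (diag v) = n"
  by (simp_all add: diag_def)

lemma diag_in_cartan: "diag v \<in> cartan \<longleftrightarrow> (\<Sum>i<n. v i) = 0"
  unfolding sl_cartan_def sl_def diagonal_mat_def carrier_mat_def by simp

lemma cartan_eq_diag:
  assumes "H \<in> cartan"
  shows "H = diag (\<lambda>i. H $$ (i, i))" "(\<Sum>i<n. H $$ (i, i)) = 0" "dim_row H = n" "dim_col H = n"
  using assms unfolding sl_cartan_def sl_def diagonal_mat_def by (auto intro!: eq_matI)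

lemma sum_delta_mult: "i < n \<Longrightarrow> j < n \<Longrightarrow> (\<Sum>s<n. delta i j s * v s) = v i - v j"
proof -
  assume ij: "i < n" "j < n"
  have "(\<Sum>s<n. delta i j s * v s) = (\<Sum>s<n. (if s = i then v s else 0) - (if s = j then v s else 0))"
    by (intro sum.cong) (auto simp: delta_def)
  also have "\<dots> = v i - v j" using ij by (simp add: sum_subtractf)
  finally show ?thesis .
qed

lemma coroot_mat_in_cartan [simp]: "i < n \<Longrightarrow> j < n \<Longrightarrow> coroot_mat i j \<in> cartan"
  unfolding diag_in_cartan using sum_delta_mult[of i j "\<lambda>_. 1"] by simp

lemma functional_of_coroot_mat: "i < n \<Longrightarrow> j < n \<Longrightarrow> functional_of \<xi> (coroot_mat i j) = \<xi> i - \<xi> j"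
  using sum_delta_mult[of i j \<xi>] by (simp add: functional_of_def mult.commute)

lemma root_apply: "H \<in> cartan \<Longrightarrow> i < n \<Longrightarrow> j < n \<Longrightarrow> sl_root i j H = H $$ (i, i) - H $$ (j, j)"
  using sum_delta_mult[of i j "\<lambda>s. H $$ (s, s)"] by (simp add: functional_of_def)

lemma cartan_add: "A \<in> cartan \<Longrightarrow> B \<in> cartan \<Longrightarrow> A + B \<in> cartan"
  unfolding sl_cartan_def sl_def diagonal_mat_def by (auto simp: sum.distrib)

lemma cartan_smult: "A \<in> cartan \<Longrightarrow> c \<cdot>\<^sub>m A \<in> cartan"
  unfolding sl_cartan_def sl_def diagonal_mat_def by (auto simp: sum_distrib_left[symmetric])

lemma functional_of_in_dual: "functional_of \<xi> \<in> dual_space cartan"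
  unfolding dual_space_def
proof (intro CollectI conjI ballI allI impI)
  fix A B c
  assume A: "A \<in> cartan"
  note dA = cartan_eq_diag(3,4)[OF A]
  show "functional_of \<xi> (c \<cdot>\<^sub>m A) = c * functional_of \<xi> A"
    using A cartan_smult[OF A] dA by (simp add: functional_of_def sum_distrib_left mult.left_commute)
  assume B: "B \<in> cartan"
  show "functional_of \<xi> (A + B) = functional_of \<xi> A + functional_of \<xi> B"
    using A B cartan_add[OF A B] dA cartan_eq_diag(3,4)[OF B]
    by (simp add: functional_of_def sum.distrib algebra_simps)
qed (simp add: functional_of_def)

text \<open>
  A traceless diagonal matrix with entries \<open>v\<close> is \<open>\<Sum>i<n. v i * (E\<^sub>i\<^sub>i - E\<^sub>l\<^sub>l)\<close> with \<open>l = n - 1\<close>. Matrices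
  of unspecified size form no additive monoid, so the sum is built up by induction.
\<close>

lemma dual_eq_functional_of:
  assumes f: "f \<in> dual_space cartan"
  shows "f = functional_of (\<lambda>i. f (coroot_mat i (n - 1)))"
proof
  fix H
  have n1: "n - 1 < n" using n_ge_2 by simp
  have add: "f (A + B) = f A + f B" if "A \<in> cartan" "B \<in> cartan" for A B
    using f that unfolding dual_space_def by blast
  have smult: "f (c \<cdot>\<^sub>m A) = c * f A" if "A \<in> cartan" for A c
    using f that unfolding dual_space_def by blast
  show "f H = functional_of (\<lambda>i. f (coroot_mat i (n - 1))) H"
  proof (cases "H \<in> cartan")
    case False
    thus ?thesis using f unfolding dual_space_def functional_of_def by simp
  next
    case True
    define v where "v = (\<lambda>i. H $$ (i, i))"
    \<comment> \<open>The diagonal of the \<open>m\<close>-th partial sum.\<close>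
    define u where "u = (\<lambda>m s. \<Sum>i<m. v i * delta i (n - 1) s)"
    have "diag (u m) \<in> cartan \<and> f (diag (u m)) = (\<Sum>i<m. v i * f (coroot_mat i (n - 1)))" if "m \<le> n" for m
      using that
    proof (induction m)
      case 0
      have "diag (u 0) = 0 \<cdot>\<^sub>m coroot_mat 0 (n - 1)" by (rule eq_matI) (auto simp: u_def)
      thus ?case using smult[of "coroot_mat 0 (n - 1)" 0] cartan_smult[of "coroot_mat 0 (n - 1)" 0] n_ge_2 by simp
    next
      case (Suc m)
      have e: "diag (u (Suc m)) = diag (u m) + v m \<cdot>\<^sub>m coroot_mat m (n - 1)" by (rule eq_matI) (auto simp: u_def)
      have c: "coroot_mat m (n - 1) \<in> cartan" using Suc.prems n1 by simp
      have IH: "diag (u m) \<in> cartan" "f (diag (u m)) = (\<Sum>i<m. v i * f (coroot_mat i (n - 1)))" using Suc by auto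
      show ?case unfolding e using add[OF IH(1) cartan_smult[OF c]] cartan_add[OF IH(1) cartan_smult[OF c]] smult[OF c] IH(2) by simp
    qed
    from this[of n] have *: "f (diag (u n)) = (\<Sum>i<n. v i * f (coroot_mat i (n - 1)))" by simp
    have "diag (u n) = H"
    proof -
      have "u n s = v s" if "s < n" for s
      proof -
        have "u n s = (\<Sum>i<n. (if i = s then v i else 0) - v i * of_bool (s = n - 1))"
          unfolding u_def by (intro sum.cong) (auto simp: delta_def algebra_simps)
        also have "\<dots> = v s - (\<Sum>i<n. v i) * of_bool (s = n - 1)" using that by (simp add: sum_subtractf sum_distrib_right)
        finally show ?thesis using cartan_eq_diag(2)[OF True] unfolding v_def by simp
      qed
      hence "diag (u n) = diag v" by (intro eq_matI) auto
      thus ?thesis using cartan_eq_diag(1)[OF True] unfolding v_def by simp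
    qed
    thus ?thesis using * True unfolding functional_of_def v_def by (simp add: mult.commute)
  qed
qed

lemma dual_eqI:
  assumes "f \<in> dual_space cartan" "g \<in> dual_space cartan"
    and "\<And>i. i < n \<Longrightarrow> f (coroot_mat i (n - 1)) = g (coroot_mat i (n - 1))"
  shows "f = g"
proof -
  have "functional_of (\<lambda>i. f (coroot_mat i (n - 1))) = functional_of (\<lambda>i. g (coroot_mat i (n - 1)))"
    using assms(3) by (auto simp: functional_of_def fun_eq_iff)
  thus ?thesis using dual_eq_functional_of[OF assms(1)] dual_eq_functional_of[OF assms(2)] by simp
qed

lemma functional_of_eqI:
  assumes "\<And>i. i < n \<Longrightarrow> \<xi> i - \<xi> (n - 1) = \<eta> i - \<eta> (n - 1)"
  shows "functional_of \<xi> = functional_of \<eta>"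
  by (rule dual_eqI) (use assms n_ge_2 in \<open>auto simp: functional_of_in_dual functional_of_coroot_mat\<close>)

lemma uminus_functional_of: "- functional_of \<xi> = functional_of (\<lambda>i. - \<xi> i)"
  by (auto simp: functional_of_def fun_eq_iff sum_negf)

lemma uminus_root: "- sl_root i j = sl_root j i"
  unfolding uminus_functional_of by (rule arg_cong[of _ _ functional_of]) (auto simp: delta_def)

lemma delta_eq_2:
  assumes "delta i j a - delta i j b = 2"
  shows "i = a \<and> j = b"
  using assms unfolding delta_def by (auto simp: of_bool_def split: if_splits)

text \<open>
  A root takes the value 2 on a coroot \<open>E\<^sub>a\<^sub>a - E\<^sub>b\<^sub>b\<close> only if it belongs to it.
\<close>

lemma root_inj:
  assumes "a < n" "b < n" "i < n" "j < n" "a \<noteq> b" "sl_root i j = sl_root a b"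
  shows "i = a \<and> j = b"
proof -
  have "delta i j a - delta i j b = sl_root i j (coroot_mat a b)" using functional_of_coroot_mat[OF assms(1,2)] by simp
  also have "\<dots> = 2" unfolding assms(6) using assms by (simp add: functional_of_coroot_mat delta_def)
  finally show ?thesis by (rule delta_eq_2)
qed

lemma sl_dim: "X \<in> sl n \<Longrightarrow> dim_row X = n \<and> dim_col X = n"
  unfolding sl_def by auto

lemma bracket_cartan_index:
  assumes "H \<in> cartan" "X \<in> sl n" "i < n" "j < n"
  shows "lie_bracket H X $$ (i, j) = (H $$ (i, i) - H $$ (j, j)) * X $$ (i, j)"
proof -
  note d = cartan_eq_diag(3,4)[OF assms(1)] sl_dim[OF assms(2)]
  have off: "H $$ (a, b) = 0" if "a \<noteq> b" "a < n" "b < n" for a b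
    using cartan_eq_diag(1)[OF assms(1)] that by (metis diag_index)
  have "(H * X) $$ (i, j) = (\<Sum>l\<in>{0..<n}. H $$ (i, l) * X $$ (l, j))"
    using d assms by (simp add: scalar_prod_def)
  also have "\<dots> = (\<Sum>l\<in>{0..<n}. if l = i then H $$ (i, i) * X $$ (i, j) else 0)"
    by (intro sum.cong) (use off assms in auto)
  finally have 1: "(H * X) $$ (i, j) = H $$ (i, i) * X $$ (i, j)" using assms by simp
  have "(X * H) $$ (i, j) = (\<Sum>l\<in>{0..<n}. X $$ (i, l) * H $$ (l, j))"
    using d assms by (simp add: scalar_prod_def)
  also have "\<dots> = (\<Sum>l\<in>{0..<n}. if l = j then X $$ (i, j) * H $$ (j, j) else 0)"
    by (intro sum.cong) (use off assms in auto)
  finally have 2: "(X * H) $$ (i, j) = X $$ (i, j) * H $$ (j, j)" using assms by simp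
  show ?thesis unfolding lie_bracket_def using 1 2 d assms by (simp add: algebra_simps)
qed

text \<open>
  Bracketing with a diagonal matrix \<open>H\<close> multiplies the entry \<open>(i, j)\<close> by \<open>H\<^sub>i\<^sub>i - H\<^sub>j\<^sub>j\<close>.
\<close>

lemma root_space_iff:
  "X \<in> root_space (sl n) cartan \<alpha> \<longleftrightarrow> X \<in> sl n \<and>
     (\<forall>H\<in>cartan. \<forall>i<n. \<forall>j<n. X $$ (i, j) \<noteq> 0 \<longrightarrow> \<alpha> H = H $$ (i, i) - H $$ (j, j))"
proof -
  have "lie_bracket H X = \<alpha> H \<cdot>\<^sub>m X \<longleftrightarrow>
      (\<forall>i<n. \<forall>j<n. X $$ (i, j) \<noteq> 0 \<longrightarrow> \<alpha> H = H $$ (i, i) - H $$ (j, j))"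
    if H: "H \<in> cartan" and X: "X \<in> sl n" for H
  proof -
    note d = cartan_eq_diag(3,4)[OF H] sl_dim[OF X]
    have "lie_bracket H X = \<alpha> H \<cdot>\<^sub>m X \<longleftrightarrow> (\<forall>i<n. \<forall>j<n. lie_bracket H X $$ (i, j) = (\<alpha> H \<cdot>\<^sub>m X) $$ (i, j))"
    proof
      assume "\<forall>i<n. \<forall>j<n. lie_bracket H X $$ (i, j) = (\<alpha> H \<cdot>\<^sub>m X) $$ (i, j)"
      thus "lie_bracket H X = \<alpha> H \<cdot>\<^sub>m X" using d by (intro eq_matI) (auto simp: lie_bracket_def)
    qed simp
    also have "\<dots> \<longleftrightarrow> (\<forall>i<n. \<forall>j<n. (H $$ (i, i) - H $$ (j, j)) * X $$ (i, j) = \<alpha> H * X $$ (i, j))"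
      using bracket_cartan_index[OF H X] d by simp
    also have "\<dots> \<longleftrightarrow> (\<forall>i<n. \<forall>j<n. X $$ (i, j) \<noteq> 0 \<longrightarrow> \<alpha> H = H $$ (i, i) - H $$ (j, j))"
      by (metis mult_right_cancel mult_zero_right)
    finally show ?thesis .
  qed
  thus ?thesis unfolding root_space_def by blast
qed

definition unit_mat :: "nat \<Rightarrow> nat \<Rightarrow> complex \<Rightarrow> complex mat" where
  "unit_mat a b c = Matrix.mat n n (\<lambda>(i, j). if i = a \<and> j = b then c else 0)"

lemma unit_mat_in_sl: "a \<noteq> b \<Longrightarrow> unit_mat a b c \<in> sl n"
  unfolding sl_def unit_mat_def by (auto intro!: sum.neutral)

lemma root_space_root:
  assumes ab: "a < n" "b < n" "a \<noteq> b"
  shows "root_space (sl n) cartan (sl_root a b) = range (unit_mat a b)"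
proof (intro equalityI subsetI)
  fix X assume X: "X \<in> root_space (sl n) cartan (sl_root a b)"
  have "X $$ (i, j) = 0" if ij: "i < n" "j < n" "(i, j) \<noteq> (a, b)" for i j
  proof (rule ccontr)
    assume "X $$ (i, j) \<noteq> 0"
    hence "sl_root a b (coroot_mat a b) = coroot_mat a b $$ (i, i) - coroot_mat a b $$ (j, j)"
      using X ij ab coroot_mat_in_cartan[OF ab(1,2)] unfolding root_space_iff by blast
    hence "delta a b i - delta a b j = delta a b a - delta a b b"
      using ij functional_of_coroot_mat[OF ab(1,2), of "delta a b"] by simp
    also have "\<dots> = 2" using ab(3) by (simp add: delta_def)
    finally show False using delta_eq_2 ij(3) by blast
  qed
  hence "X = unit_mat a b (X $$ (a, b))"
    using X unfolding root_space_iff unit_mat_def by (intro eq_matI) (auto dest: sl_dim)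
  thus "X \<in> range (unit_mat a b)" by blast
next
  fix X assume "X \<in> range (unit_mat a b)"
  then obtain c where X: "X = unit_mat a b c" by auto
  show "X \<in> root_space (sl n) cartan (sl_root a b)"
    unfolding root_space_iff X using unit_mat_in_sl[OF ab(3)] ab root_apply by (auto simp: unit_mat_def)
qed

lemma roots_eq: "roots (sl n) cartan = {sl_root i j | i j. i < n \<and> j < n \<and> i \<noteq> j}"
proof (intro equalityI subsetI)
  fix \<alpha> assume a: "\<alpha> \<in> roots (sl n) cartan"
  then obtain X where X: "\<alpha> \<in> dual_space cartan" "\<alpha> \<noteq> 0" "X \<in> root_space (sl n) cartan \<alpha>" "X \<noteq> 0\<^sub>m (dim_row X) (dim_col X)"
    unfolding roots_def by auto
  have d: "dim_row X = n" "dim_col X = n" using X(3) sl_dim unfolding root_space_iff by auto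
  obtain i j where ij: "i < n" "j < n" "X $$ (i, j) \<noteq> 0"
  proof (rule ccontr)
    assume "\<not> thesis"
    hence "X = 0\<^sub>m n n" using that d by (intro eq_matI) auto
    thus False using X(4) d by simp
  qed
  have "\<alpha> H = sl_root i j H" for H
  proof (cases "H \<in> cartan")
    case True
    thus ?thesis using X(3) ij unfolding root_space_iff by (auto simp: root_apply)
  next
    case False
    thus ?thesis using X(1) unfolding dual_space_def functional_of_def by simp
  qed
  hence eq: "\<alpha> = sl_root i j" by auto
  moreover have "i \<noteq> j"
  proof
    assume "i = j"
    hence "\<alpha> = 0" unfolding eq by (auto simp: functional_of_def delta_def)
    thus False using X(2) by simp
  qed
  ultimately show "\<alpha> \<in> {sl_root i j | i j. i < n \<and> j < n \<and> i \<noteq> j}" using ij by blast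
next
  fix \<alpha> assume "\<alpha> \<in> {sl_root i j | i j. i < n \<and> j < n \<and> i \<noteq> j}"
  then obtain i j where ij: "\<alpha> = sl_root i j" "i < n" "j < n" "i \<noteq> j" by auto
  have "unit_mat i j 1 \<in> root_space (sl n) cartan \<alpha>" using root_space_root[OF ij(2-4)] ij(1) by auto
  moreover have "unit_mat i j 1 \<noteq> 0\<^sub>m (dim_row (unit_mat i j 1)) (dim_col (unit_mat i j 1))"
  proof
    assume "unit_mat i j 1 = 0\<^sub>m (dim_row (unit_mat i j 1)) (dim_col (unit_mat i j 1))"
    hence "unit_mat i j 1 $$ (i, j) = 0\<^sub>m n n $$ (i, j)" by (simp add: unit_mat_def)
    thus False using ij by (simp add: unit_mat_def)
  qed
  moreover have "\<alpha> \<noteq> 0"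
  proof
    assume "\<alpha> = 0"
    moreover have "sl_root i j (coroot_mat i j) = 2" using ij by (simp add: functional_of_coroot_mat delta_def)
    ultimately show False using ij(1) by simp
  qed
  ultimately show "\<alpha> \<in> roots (sl n) cartan" unfolding roots_def ij(1) using functional_of_in_dual by blast
qed

lemma unit_mat_bracket:
  assumes "a < n" "b < n" "a \<noteq> b"
  shows "lie_bracket (unit_mat a b x) (unit_mat b a y) = (x * y) \<cdot>\<^sub>m coroot_mat a b"
proof (rule eq_matI)
  have prod: "(unit_mat p q u * unit_mat q p v) $$ (i, j) = (if i = p \<and> j = p then u * v else 0)"
    if "p < n" "q < n" "i < n" "j < n" for p q u v i j
  proof -
    have "(unit_mat p q u * unit_mat q p v) $$ (i, j) = (\<Sum>l\<in>{0..<n}. unit_mat p q u $$ (i, l) * unit_mat q p v $$ (l, j))"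
      using that by (simp add: scalar_prod_def unit_mat_def)
    also have "\<dots> = (\<Sum>l\<in>{0..<n}. if l = q then (if i = p \<and> j = p then u * v else 0) else 0)"
      by (intro sum.cong) (use that in \<open>auto simp: unit_mat_def\<close>)
    finally show ?thesis using that by simp
  qed
  fix i j assume "i < dim_row ((x * y) \<cdot>\<^sub>m coroot_mat a b)" "j < dim_col ((x * y) \<cdot>\<^sub>m coroot_mat a b)"
  hence ij: "i < n" "j < n" by simp_all
  have "lie_bracket (unit_mat a b x) (unit_mat b a y) $$ (i, j)
      = (unit_mat a b x * unit_mat b a y) $$ (i, j) - (unit_mat b a y * unit_mat a b x) $$ (i, j)"
    unfolding lie_bracket_def using ij by (intro index_minus_mat) (auto simp: unit_mat_def)
  also have "\<dots> = (if i = a \<and> j = a then x * y else 0) - (if i = b \<and> j = b then y * x else 0)"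
    using prod[OF assms(1,2) ij] prod[OF assms(2,1) ij] by simp
  also have "\<dots> = ((x * y) \<cdot>\<^sub>m coroot_mat a b) $$ (i, j)" using ij assms by (auto simp: delta_def)
  finally show "lie_bracket (unit_mat a b x) (unit_mat b a y) $$ (i, j) = ((x * y) \<cdot>\<^sub>m coroot_mat a b) $$ (i, j)" .
qed (auto simp: lie_bracket_def unit_mat_def)

text \<open>
  Brackets of the two root lines are the multiples of \<open>E\<^sub>a\<^sub>a - E\<^sub>b\<^sub>b\<close>, and the root takes the
  value 2 on exactly one of them.
\<close>

lemma coroot_root:
  assumes ab: "a < n" "b < n" "a \<noteq> b"
  shows "coroot (sl n) cartan (sl_root a b) = coroot_mat a b"
  unfolding coroot_def uminus_root root_space_root[OF ab] root_space_root[OF ab(2,1) ab(3)[symmetric]]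
proof (rule the_equality)
  have val: "sl_root a b (coroot_mat a b) = 2" using ab by (simp add: functional_of_coroot_mat delta_def)
  have "coroot_mat a b = lie_bracket (unit_mat a b 1) (unit_mat b a 1)"
    unfolding unit_mat_bracket[OF ab] by (intro eq_matI) auto
  thus "coroot_mat a b \<in> cartan \<and> sl_root a b (coroot_mat a b) = 2 \<and>
    (\<exists>X\<in>range (unit_mat a b). \<exists>Y\<in>range (unit_mat b a). coroot_mat a b = lie_bracket X Y)"
    using coroot_mat_in_cartan[OF ab(1,2)] val by blast
  fix H assume H: "H \<in> cartan \<and> sl_root a b H = 2 \<and> (\<exists>X\<in>range (unit_mat a b). \<exists>Y\<in>range (unit_mat b a). H = lie_bracket X Y)"
  then obtain x y where "H = (x * y) \<cdot>\<^sub>m coroot_mat a b" using unit_mat_bracket[OF ab] by auto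
  moreover have "sl_root a b ((x * y) \<cdot>\<^sub>m coroot_mat a b) = (x * y) * sl_root a b (coroot_mat a b)"
    using functional_of_in_dual[of "delta a b"] ab unfolding dual_space_def by simp
  ultimately have "x * y = 1" using H val by simp
  thus "H = coroot_mat a b" using \<open>H = (x * y) \<cdot>\<^sub>m coroot_mat a b\<close> by (auto intro!: eq_matI)
qed

lemma sl_positive_eq: "sl_positive n = (\<lambda>(i, j). sl_root i j) ` index_pairs n"
proof -
  have "(\<forall>X\<in>root_space (sl n) cartan (sl_root i j). upper_triangular X) \<longleftrightarrow> i < j"
    if ij: "i < n" "j < n" "i \<noteq> j" for i j
  proof
    assume "\<forall>X\<in>root_space (sl n) cartan (sl_root i j). upper_triangular X"
    hence "upper_triangular (unit_mat i j 1)" unfolding root_space_root[OF ij] by blast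
    hence "unit_mat i j 1 $$ (i, j) = 0" if "j < i" 
      using upper_triangularD[of "unit_mat i j 1" j i] that ij(1) by (simp add: unit_mat_def)
    thus "i < j" using ij by (cases "j < i") (auto simp: unit_mat_def)
  next
    assume "i < j"
    thus "\<forall>X\<in>root_space (sl n) cartan (sl_root i j). upper_triangular X"
      unfolding root_space_root[OF ij] by (auto simp: unit_mat_def intro!: upper_triangularI)
  qed
  note upper = this
  show ?thesis
  proof (intro equalityI subsetI)
    fix \<alpha> assume "\<alpha> \<in> sl_positive n"
    then obtain i j where ij: "\<alpha> = sl_root i j" "i < n" "j < n" "i \<noteq> j"
      "\<forall>X\<in>root_space (sl n) cartan \<alpha>. upper_triangular X"
      unfolding sl_positive_def roots_eq by auto
    hence "(i, j) \<in> index_pairs n" using upper[OF ij(2-4)] unfolding index_pairs_def by simp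
    thus "\<alpha> \<in> (\<lambda>(i, j). sl_root i j) ` index_pairs n" using ij(1) by (intro image_eqI[of _ _ "(i, j)"]) simp_all
  next
    fix \<alpha> assume "\<alpha> \<in> (\<lambda>(i, j). sl_root i j) ` index_pairs n"
    then obtain i j where ij: "\<alpha> = sl_root i j" "i < j" "j < n" unfolding index_pairs_def by auto
    hence "i < n" "i \<noteq> j" by simp_all
    thus "\<alpha> \<in> sl_positive n" using upper[of i j] ij unfolding sl_positive_def roots_eq by blast
  qed
qed

lemma inj_on_positive_root: "inj_on (\<lambda>(i, j). sl_root i j) (index_pairs n)"
proof (rule inj_onI)
  fix p q assume pq: "p \<in> index_pairs n" "q \<in> index_pairs n" "(\<lambda>(i, j). sl_root i j) p = (\<lambda>(i, j). sl_root i j) q"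
  obtain i j a b where e: "p = (i, j)" "q = (a, b)" by fastforce
  have "i = a \<and> j = b" by (rule root_inj) (use pq e in \<open>auto simp: index_pairs_def\<close>)
  thus "p = q" using e by simp
qed

text \<open>
  Decomposability is decided by the height \<open>j - i\<close>, which is additive since it is the
  evaluation at a fixed element \<open>H\<close> of the Cartan subalgebra.
\<close>

lemma simple_roots_eq: "simple_roots (sl_positive n) = {sl_root i (Suc i) | i. Suc i < n}"
proof -
  \<comment> \<open>Entries descending by 1, shifted to have trace 0.\<close>
  define H where "H = diag (\<lambda>i. of_nat (n - 1) / 2 - of_nat i)"
  have "(\<Sum>i<m. (of_nat (m - 1) / 2 - of_nat i :: complex)) = 0" if "m \<ge> 1" for m
    using that
  proof (induction m rule: dec_induct)
    case (step m)
    have "(\<Sum>i<Suc m. (of_nat (Suc m - 1) / 2 - of_nat i :: complex))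
        = (\<Sum>i<m. (of_nat (m - 1) / 2 - of_nat i) + 1 / 2) + (of_nat m / 2 - of_nat m)"
      using step(1) by (auto simp: of_nat_diff field_simps intro!: sum.cong)
    also have "\<dots> = 0" using step by (simp add: sum.distrib)
    finally show ?case .
  qed simp
  hence H: "H \<in> cartan" unfolding H_def diag_in_cartan using n_ge_2 by simp
  have ht: "sl_root i j H = of_nat (j - i)" if "i < j" "j < n" for i j
    using root_apply[OF H, of i j] that by (simp add: H_def of_nat_diff)
  show ?thesis
  proof (intro equalityI subsetI)
    fix \<alpha> assume "\<alpha> \<in> simple_roots (sl_positive n)"
    then obtain i j where ij: "\<alpha> = sl_root i j" "i < j" "j < n"
      and no: "\<not> (\<exists>\<beta>\<in>sl_positive n. \<exists>\<gamma>\<in>sl_positive n. \<alpha> = \<beta> + \<gamma>)"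
      unfolding simple_roots_def sl_positive_eq index_pairs_def by auto
    have "j = Suc i"
    proof (rule ccontr)
      assume "j \<noteq> Suc i"
      hence "sl_root i (Suc i) \<in> sl_positive n" "sl_root (Suc i) j \<in> sl_positive n"
        unfolding sl_positive_eq index_pairs_def using ij
        by (auto intro: image_eqI[of _ _ "(i, Suc i)"] image_eqI[of _ _ "(Suc i, j)"])
      moreover have "\<alpha> = sl_root i (Suc i) + sl_root (Suc i) j"
        unfolding ij(1) by (auto simp: functional_of_def fun_eq_iff delta_def sum.distrib[symmetric] algebra_simps intro!: sum.cong)
      ultimately show False using no by blast
    qed
    thus "\<alpha> \<in> {sl_root i (Suc i) | i. Suc i < n}" using ij by auto
  next
    fix \<alpha> assume "\<alpha> \<in> {sl_root i (Suc i) | i. Suc i < n}"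
    then obtain i where i: "\<alpha> = sl_root i (Suc i)" "Suc i < n" by auto
    have "\<alpha> \<noteq> \<beta> + \<gamma>" if bc: "\<beta> \<in> sl_positive n" "\<gamma> \<in> sl_positive n" for \<beta> \<gamma>
    proof
      assume eq: "\<alpha> = \<beta> + \<gamma>"
      obtain a b c d where abcd: "\<beta> = sl_root a b" "\<gamma> = sl_root c d" "a < b" "b < n" "c < d" "d < n"
        using bc unfolding sl_positive_eq index_pairs_def by auto
      have "of_nat 1 = (of_nat (b - a + (d - c)) :: complex)"
        using arg_cong[OF eq, of "\<lambda>f. f H"] ht[of i "Suc i"] ht[of a b] ht[of c d] i abcd
        by (simp only: plus_fun_def of_nat_add Suc_diff_le[OF order_refl]) simp
      hence "1 = b - a + (d - c)" by (simp only: of_nat_eq_iff)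
      thus False using abcd by linarith
    qed
    thus "\<alpha> \<in> simple_roots (sl_positive n)"
      unfolding simple_roots_def using i by (auto simp: sl_positive_eq index_pairs_def image_iff)
  qed
qed

section \<open>The Weyl group and its longest element\<close>

abbreviation perms :: "(nat \<Rightarrow> nat) set" where
  "perms \<equiv> {\<sigma>. \<sigma> permutes {..<n}}"

abbreviation perm_inv :: "(nat \<Rightarrow> nat) \<Rightarrow> nat \<Rightarrow> nat" where
  "perm_inv \<sigma> \<equiv> inv_into UNIV \<sigma>"

text \<open>
  The action of a permutation on functionals, \<open>\<xi> \<mapsto> \<xi> \<circ> \<sigma>\<inverse>\<close> in coordinates. Like
  the reflections, it is the identity on functions that are not functionals.
\<close>

definition act :: "(nat \<Rightarrow> nat) \<Rightarrow> functional \<Rightarrow> functional" where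
  "act \<sigma> f = (if f \<in> dual_space cartan then functional_of (\<lambda>i. f (coroot_mat (perm_inv \<sigma> i) (n - 1))) else f)"

lemma perm_less: "\<sigma> permutes {..<n} \<Longrightarrow> \<sigma> i < n \<longleftrightarrow> i < n"
  using permutes_in_image[of \<sigma> "{..<n}" i] by simp

lemma inv_perm_less: "\<sigma> permutes {..<n} \<Longrightarrow> perm_inv \<sigma> i < n \<longleftrightarrow> i < n"
  using perm_less[OF permutes_inv] .

lemma act_functional_of:
  assumes "\<sigma> permutes {..<n}"
  shows "act \<sigma> (functional_of \<xi>) = functional_of (\<lambda>i. \<xi> (perm_inv \<sigma> i))"
proof -
  have "act \<sigma> (functional_of \<xi>) = functional_of (\<lambda>i. functional_of \<xi> (coroot_mat (perm_inv \<sigma> i) (n - 1)))"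
    unfolding act_def using functional_of_in_dual by simp
  also have "\<dots> = functional_of (\<lambda>i. \<xi> (perm_inv \<sigma> i))"
    by (rule functional_of_eqI) (use n_ge_2 assms in \<open>simp add: functional_of_coroot_mat inv_perm_less\<close>)
  finally show ?thesis .
qed

lemma dual_obtain:
  assumes "f \<in> dual_space cartan"
  obtains \<xi> where "f = functional_of \<xi>"
  using dual_eq_functional_of[OF assms] by blast

lemma act_comp:
  assumes "\<sigma> permutes {..<n}" "\<tau> permutes {..<n}"
  shows "act \<tau> \<circ> act \<sigma> = act (\<tau> \<circ> \<sigma>)"
proof
  fix f
  show "(act \<tau> \<circ> act \<sigma>) f = act (\<tau> \<circ> \<sigma>) f"
  proof (cases "f \<in> dual_space cartan")
    case True
    then obtain \<xi> where f: "f = functional_of \<xi>" by (rule dual_obtain)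
    have "perm_inv (\<tau> \<circ> \<sigma>) = perm_inv \<sigma> \<circ> perm_inv \<tau>"
      using assms by (intro o_inv_distrib permutes_bij) auto
    thus ?thesis unfolding f using assms permutes_compose[OF assms] by (simp add: act_functional_of)
  qed (simp add: act_def)
qed

lemma act_id: "act id = id"
proof
  fix f
  show "act id f = id f"
  proof (cases "f \<in> dual_space cartan")
    case True
    then obtain \<xi> where f: "f = functional_of \<xi>" by (rule dual_obtain)
    show ?thesis unfolding f using act_functional_of[OF permutes_id, of \<xi>] by simp
  qed (simp add: act_def)
qed

lemma act_root:
  assumes "\<sigma> permutes {..<n}"
  shows "act \<sigma> (sl_root i j) = sl_root (\<sigma> i) (\<sigma> j)"
  unfolding act_functional_of[OF assms]
  by (rule arg_cong[of _ _ functional_of]) (auto simp: delta_def fun_eq_iff permutes_inv_eq[OF assms])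

text \<open>
  The images of the roots determine the permutation. For \<open>n \<ge> 2\<close> every index occurs in a root.
\<close>

lemma act_inj:
  assumes "\<sigma> permutes {..<n}" "\<tau> permutes {..<n}" "act \<sigma> = act \<tau>"
  shows "\<sigma> = \<tau>"
proof
  fix i
  show "\<sigma> i = \<tau> i"
  proof (cases "i < n")
    case True
    define j where "j = (if i = 0 then 1 else 0 :: nat)"
    have j: "j < n" "i \<noteq> j" unfolding j_def using n_ge_2 by auto
    have "sl_root (\<sigma> i) (\<sigma> j) = sl_root (\<tau> i) (\<tau> j)"
      using arg_cong[OF assms(3), of "\<lambda>w. w (sl_root i j)"] assms(1,2) by (simp add: act_root)
    moreover have "\<tau> i \<noteq> \<tau> j" using j permutes_inj[OF assms(2)] by (simp add: inj_eq)
    ultimately show ?thesis using root_inj[of "\<tau> i" "\<tau> j" "\<sigma> i" "\<sigma> j"] assms(1,2) True j by (simp add: perm_less)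
  next
    case False
    thus ?thesis using assms(1,2) by (simp add: permutes_not_in)
  qed
qed

lemma transpose_permutes: "i < n \<Longrightarrow> j < n \<Longrightarrow> Transposition.transpose i j permutes {..<n}"
  by (simp add: permutes_swap_id)

lemma reflection_root:
  assumes ij: "i < n" "j < n" "i \<noteq> j"
  shows "reflection (sl n) cartan (sl_root i j) = act (Transposition.transpose i j)"
proof
  fix f
  show "reflection (sl n) cartan (sl_root i j) f = act (Transposition.transpose i j) f"
  proof (cases "f \<in> dual_space cartan")
    case True
    then obtain \<xi> where f: "f = functional_of \<xi>" by (rule dual_obtain)
    have "reflection (sl n) cartan (sl_root i j) f = functional_of (\<lambda>s. \<xi> s - (\<xi> i - \<xi> j) * delta i j s)"
    proof
      fix H
      have "reflection (sl n) cartan (sl_root i j) f H = functional_of \<xi> H - (\<xi> i - \<xi> j) * sl_root i j H"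
        using True unfolding reflection_def coroot_root[OF ij] f by (simp add: functional_of_coroot_mat ij)
      also have "\<dots> = functional_of (\<lambda>s. \<xi> s - (\<xi> i - \<xi> j) * delta i j s) H"
        unfolding functional_of_def by (simp add: sum_distrib_left left_diff_distrib mult.assoc flip: sum_subtractf)
      finally show "reflection (sl n) cartan (sl_root i j) f H = functional_of (\<lambda>s. \<xi> s - (\<xi> i - \<xi> j) * delta i j s) H" .
    qed
    also have "(\<lambda>s. \<xi> s - (\<xi> i - \<xi> j) * delta i j s) = (\<lambda>s. \<xi> (perm_inv (Transposition.transpose i j) s))"
      using ij(3) by (auto simp: delta_def fun_eq_iff Transposition.transpose_def)
    also have "functional_of \<dots> = act (Transposition.transpose i j) f"
      unfolding f by (rule act_functional_of[OF transpose_permutes[OF ij(1,2)], symmetric])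
    finally show ?thesis .
  qed (simp add: act_def reflection_def)
qed

lemma reflection_word_Nil: "reflection_word g h [] = id"
  unfolding reflection_word_def by simp

lemma reflection_word_Cons:
  "reflection_word g h (\<alpha> # \<alpha>s) = reflection g h \<alpha> \<circ> reflection_word g h \<alpha>s"
  unfolding reflection_word_def by simp

text \<open>
  The reflections in roots act as transpositions, and \<open>act\<close> is multiplicative.
\<close>

lemma reflection_word_perm:
  assumes "set \<alpha>s \<subseteq> roots (sl n) cartan"
  shows "\<exists>\<sigma>. \<sigma> permutes {..<n} \<and> reflection_word (sl n) cartan \<alpha>s = act \<sigma>"
  using assms
proof (induction \<alpha>s)
  case Nil
  show ?case unfolding reflection_word_Nil using permutes_id act_id by metis
next
  case (Cons \<alpha> \<alpha>s)
  then obtain \<sigma> where \<sigma>: "\<sigma> permutes {..<n}" "reflection_word (sl n) cartan \<alpha>s = act \<sigma>" by auto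
  obtain i j where ij: "\<alpha> = sl_root i j" "i < n" "j < n" "i \<noteq> j" using Cons.prems unfolding roots_eq by auto
  show ?case unfolding reflection_word_Cons \<sigma>(2) ij(1) reflection_root[OF ij(2-4)] act_comp[OF \<sigma>(1) transpose_permutes[OF ij(2,3)]]
    using permutes_compose[OF \<sigma>(1) transpose_permutes[OF ij(2,3)]] by blast
qed

definition inversions :: "(nat \<Rightarrow> nat) \<Rightarrow> (nat \<times> nat) set" where
  "inversions \<sigma> = {(a, b) \<in> index_pairs n. \<sigma> a > \<sigma> b}"

lemma finite_inversions [simp]: "finite (inversions \<sigma>)"
  unfolding inversions_def by (rule finite_subset[OF _ finite_index_pairs[of n]]) auto

text \<open>
  Exchanging the neighbouring values \<open>i\<close> and \<open>i + 1\<close> alters the relative order only of the two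
  positions that carry them. So at most one inversion is gained, and one is lost if these values occurred
  in the wrong order.
\<close>

lemma inversions_swap_subset:
  assumes "\<sigma> permutes {..<n}" "Suc i < n"
  defines "a \<equiv> perm_inv \<sigma> i" and "b \<equiv> perm_inv \<sigma> (Suc i)"
  shows "inversions (Transposition.transpose i (Suc i) \<circ> \<sigma>) - {(a, b)} \<subseteq> inversions \<sigma>"
    and "a > b \<Longrightarrow> inversions (Transposition.transpose i (Suc i) \<circ> \<sigma>) \<subseteq> inversions \<sigma> - {(b, a)}"
proof -
  have ab: "\<sigma> a = i" "\<sigma> b = Suc i" unfolding a_def b_def using permutes_inverses(1)[OF assms(1)] by auto
  have char: "(\<sigma> c = i \<longleftrightarrow> c = a) \<and> (\<sigma> c = Suc i \<longleftrightarrow> c = b)" for c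
    using ab permutes_inj[OF assms(1)] by (metis injD)
  have key: "Transposition.transpose i (Suc i) (\<sigma> c) > Transposition.transpose i (Suc i) (\<sigma> d) \<longleftrightarrow> \<sigma> c > \<sigma> d"
    if "c < d" "(c, d) \<noteq> (a, b)" "(c, d) \<noteq> (b, a)" for c d
  proof -
    have "\<sigma> c \<noteq> \<sigma> d" using that(1) permutes_inj[OF assms(1)] by (simp add: inj_eq)
    moreover have "\<not> (\<sigma> c = i \<and> \<sigma> d = Suc i)" "\<not> (\<sigma> c = Suc i \<and> \<sigma> d = i)" using that char by auto
    ultimately show ?thesis by (auto simp: Transposition.transpose_def)
  qed
  show "inversions (Transposition.transpose i (Suc i) \<circ> \<sigma>) - {(a, b)} \<subseteq> inversions \<sigma>"
  proof
    fix p assume p: "p \<in> inversions (Transposition.transpose i (Suc i) \<circ> \<sigma>) - {(a, b)}"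
    obtain c d where cd: "p = (c, d)" by fastforce
    show "p \<in> inversions \<sigma>"
    proof (cases "(c, d) = (b, a)")
      case True
      thus ?thesis using p cd ab unfolding inversions_def index_pairs_def by auto
    next
      case False
      thus ?thesis using p cd key[of c d] unfolding inversions_def index_pairs_def by auto
    qed
  qed
  assume "a > b"
  show "inversions (Transposition.transpose i (Suc i) \<circ> \<sigma>) \<subseteq> inversions \<sigma> - {(b, a)}"
  proof
    fix p assume p: "p \<in> inversions (Transposition.transpose i (Suc i) \<circ> \<sigma>)"
    obtain c d where cd: "p = (c, d)" by fastforce
    have "(c, d) \<noteq> (b, a)" using p cd ab unfolding inversions_def by auto
    moreover have "(c, d) \<noteq> (a, b)" using p cd \<open>a > b\<close> unfolding inversions_def index_pairs_def by auto
    ultimately show "p \<in> inversions \<sigma> - {(b, a)}"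
      using p cd key[of c d] unfolding inversions_def index_pairs_def by auto
  qed
qed

lemma increasing_perm_id:
  assumes "\<sigma> permutes {..<n}" "\<And>a b. a < b \<Longrightarrow> b < n \<Longrightarrow> \<sigma> a < \<sigma> b"
  shows "\<sigma> = id"
proof -
  have "sorted (map \<sigma> [0..<n])" unfolding sorted_map
    by (rule sorted_wrt_mono_rel[of _ "(<)"]) (use assms(2) in \<open>auto intro: less_imp_le sorted_wrt_upt\<close>)
  moreover have "distinct (map \<sigma> [0..<n])"
    unfolding distinct_map using inj_on_subset[OF permutes_inj[OF assms(1)] subset_UNIV] by simp
  moreover have "set (map \<sigma> [0..<n]) = set [0..<n]"
    unfolding set_map set_upt lessThan_atLeast0[symmetric] by (rule permutes_image[OF assms(1)])
  ultimately have "map \<sigma> [0..<n] = [0..<n]" using sorted_distinct_set_unique[of "map \<sigma> [0..<n]" "[0..<n]"] by simp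
  hence eq: "map \<sigma> [0..<n] ! i = [0..<n] ! i" for i by simp
  show ?thesis
  proof
    fix i
    show "\<sigma> i = id i"
      using eq[of i] permutes_not_in[OF assms(1), of i] by (cases "i < n") simp_all
  qed
qed

lemma no_inversions_id:
  assumes "\<sigma> permutes {..<n}" "inversions \<sigma> = {}"
  shows "\<sigma> = id"
proof (rule increasing_perm_id[OF assms(1)])
  fix a b assume ab: "a < b" "b < n"
  hence "\<not> \<sigma> a > \<sigma> b" using assms(2) unfolding inversions_def index_pairs_def by auto
  moreover have "\<sigma> a \<noteq> \<sigma> b" using ab permutes_inj[OF assms(1)] by (simp add: inj_eq)
  ultimately show "\<sigma> a < \<sigma> b" by simp
qed

lemma exists_descent:
  assumes "\<sigma> permutes {..<n}" "inversions \<sigma> \<noteq> {}"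
  shows "\<exists>i. Suc i < n \<and> perm_inv \<sigma> i > perm_inv \<sigma> (Suc i)"
proof (rule ccontr)
  assume no: "\<not> ?thesis"
  have step: "perm_inv \<sigma> i < perm_inv \<sigma> (Suc i)" if "Suc i < n" for i
  proof -
    have "perm_inv \<sigma> i \<noteq> perm_inv \<sigma> (Suc i)" using permutes_inj[OF permutes_inv[OF assms(1)]] by (simp add: inj_eq)
    thus ?thesis using no that by (meson linorder_neqE_nat)
  qed
  have mono: "a < b \<Longrightarrow> b < n \<Longrightarrow> perm_inv \<sigma> a < perm_inv \<sigma> b" for a b
  proof (induction b)
    case (Suc b)
    show ?case using step[of b] Suc by (cases "a = b") auto
  qed simp
  have "perm_inv \<sigma> = id" by (rule increasing_perm_id[OF permutes_inv[OF assms(1)] mono])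
  hence "\<sigma> = id" using assms(1) by (metis inv_id permutes_inv_inv)
  thus False using assms(2) unfolding inversions_def index_pairs_def by auto
qed

abbreviation simple_set :: "functional set" where
  "simple_set \<equiv> simple_roots (sl_positive n)"

lemma simple_subset_roots: "simple_set \<subseteq> roots (sl n) cartan"
  unfolding simple_roots_eq roots_eq by fastforce

text \<open>
  Each letter creates at most one inversion.
\<close>

lemma simple_word_inversions:
  assumes "set \<alpha>s \<subseteq> simple_set" "\<sigma> permutes {..<n}" "reflection_word (sl n) cartan \<alpha>s = act \<sigma>"
  shows "card (inversions \<sigma>) \<le> length \<alpha>s"
  using assms
proof (induction \<alpha>s arbitrary: \<sigma>)
  case Nil
  hence "act \<sigma> = act id" unfolding reflection_word_Nil act_id by metis
  hence "\<sigma> = id" using act_inj[OF Nil(2) permutes_id] by simp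
  moreover have "inversions id = {}" by (auto simp: inversions_def index_pairs_def)
  ultimately show ?case by (simp only: card.empty le0)
next
  case (Cons \<alpha> \<alpha>s)
  obtain i where i: "\<alpha> = sl_root i (Suc i)" "Suc i < n" using Cons.prems(1) unfolding simple_roots_eq by auto
  obtain \<tau> where \<tau>: "\<tau> permutes {..<n}" "reflection_word (sl n) cartan \<alpha>s = act \<tau>"
    using reflection_word_perm[of \<alpha>s] Cons.prems(1) simple_subset_roots by auto
  have sw: "Transposition.transpose i (Suc i) permutes {..<n}" using i(2) by (intro transpose_permutes) auto
  have "act (Transposition.transpose i (Suc i) \<circ> \<tau>) = act \<sigma>"
    using Cons.prems(3) unfolding reflection_word_Cons \<tau>(2) i(1)
    using reflection_root[of i "Suc i"] i(2) act_comp[OF \<tau>(1) sw] by simp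
  hence \<sigma>: "\<sigma> = Transposition.transpose i (Suc i) \<circ> \<tau>"
    using act_inj[OF Cons.prems(2) permutes_compose[OF \<tau>(1) sw]] by simp
  have "inversions \<sigma> \<subseteq> insert (perm_inv \<tau> i, perm_inv \<tau> (Suc i)) (inversions \<tau>)"
    using inversions_swap_subset(1)[OF \<tau>(1) i(2)] unfolding \<sigma> by blast
  hence "card (inversions \<sigma>) \<le> card (insert (perm_inv \<tau> i, perm_inv \<tau> (Suc i)) (inversions \<tau>))" by (intro card_mono) auto
  also have "\<dots> \<le> Suc (card (inversions \<tau>))" by (simp add: card_insert_if)
  also have "card (inversions \<tau>) \<le> length \<alpha>s" using Cons.IH[OF _ \<tau>] Cons.prems(1) by simp
  finally show ?case by simp
qed

text \<open>
  Sorting by exchanges of neighbouring values: each exchange at a descent removes an inversion.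
\<close>

lemma exists_simple_word:
  assumes "\<sigma> permutes {..<n}"
  shows "\<exists>\<alpha>s. length \<alpha>s \<le> card (inversions \<sigma>) \<and> set \<alpha>s \<subseteq> simple_set \<and> act \<sigma> = reflection_word (sl n) cartan \<alpha>s"
  using assms
proof (induction "card (inversions \<sigma>)" arbitrary: \<sigma> rule: less_induct)
  case less
  show ?case
  proof (cases "inversions \<sigma> = {}")
    case True
    hence "\<sigma> = id" using no_inversions_id less.prems by blast
    thus ?thesis by (intro exI[of _ "[]"]) (simp add: reflection_word_Nil act_id[unfolded id_def] id_def)
  next
    case False
    then obtain i where i: "Suc i < n" "perm_inv \<sigma> i > perm_inv \<sigma> (Suc i)" using exists_descent less.prems by blast
    define s where "s = Transposition.transpose i (Suc i)"
    have s: "s permutes {..<n}" unfolding s_def using i(1) by (intro transpose_permutes) auto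
    define \<tau> where "\<tau> = s \<circ> \<sigma>"
    have \<tau>: "\<tau> permutes {..<n}" unfolding \<tau>_def using less.prems s by (rule permutes_compose)
    have "s \<circ> s = id" unfolding s_def by (simp add: fun_eq_iff)
    hence \<sigma>: "\<sigma> = s \<circ> \<tau>" unfolding \<tau>_def by (simp add: o_assoc[symmetric] fun_eq_iff)
    have sub: "inversions \<tau> \<subseteq> inversions \<sigma> - {(perm_inv \<sigma> (Suc i), perm_inv \<sigma> i)}"
      unfolding \<tau>_def s_def by (rule inversions_swap_subset(2)[OF less.prems i])
    moreover have "(perm_inv \<sigma> (Suc i), perm_inv \<sigma> i) \<in> inversions \<sigma>"
      using i less.prems permutes_inverses(1)[OF less.prems] unfolding inversions_def index_pairs_def
      by (simp add: inv_perm_less)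
    ultimately have "card (inversions \<tau>) < card (inversions \<sigma>)"
      by (intro psubset_card_mono) auto
    moreover obtain \<alpha>s where \<alpha>s: "length \<alpha>s \<le> card (inversions \<tau>)" "set \<alpha>s \<subseteq> simple_set" "act \<tau> = reflection_word (sl n) cartan \<alpha>s"
      using less.hyps[OF calculation \<tau>] by blast
    moreover have "act \<sigma> = reflection_word (sl n) cartan (sl_root i (Suc i) # \<alpha>s)"
      unfolding reflection_word_Cons \<alpha>s(3)[symmetric]
      using reflection_root[of i "Suc i"] i(1) act_comp[OF \<tau> s] \<sigma> unfolding s_def by simp
    ultimately show ?thesis using i(1)
      by (intro exI[of _ "sl_root i (Suc i) # \<alpha>s"]) (auto simp: simple_roots_eq)
  qed
qed

lemma weyl_group_eq: "weyl_group (sl n) cartan = act ` perms"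
proof (intro equalityI subsetI)
  fix w assume "w \<in> weyl_group (sl n) cartan"
  thus "w \<in> act ` perms" unfolding weyl_group_def using reflection_word_perm by auto
next
  fix w assume "w \<in> act ` perms"
  then obtain \<sigma> where "\<sigma> permutes {..<n}" "w = act \<sigma>" by auto
  thus "w \<in> weyl_group (sl n) cartan"
    unfolding weyl_group_def using exists_simple_word[of \<sigma>] simple_subset_roots by blast
qed

lemma weyl_length_act:
  assumes "\<sigma> permutes {..<n}"
  shows "weyl_length (sl n) cartan (sl_positive n) (act \<sigma>) = card (inversions \<sigma>)"
  unfolding weyl_length_def
proof (rule Least_equality)
  obtain \<alpha>s where \<alpha>s: "length \<alpha>s \<le> card (inversions \<sigma>)" "set \<alpha>s \<subseteq> simple_set" "act \<sigma> = reflection_word (sl n) cartan \<alpha>s"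
    using exists_simple_word[OF assms] by blast
  moreover have "card (inversions \<sigma>) \<le> length \<alpha>s" using simple_word_inversions \<alpha>s assms by simp
  ultimately show "\<exists>\<alpha>s. length \<alpha>s = card (inversions \<sigma>) \<and> set \<alpha>s \<subseteq> simple_set \<and> act \<sigma> = reflection_word (sl n) cartan \<alpha>s"
    by (intro exI[of _ \<alpha>s]) simp
  fix l assume "\<exists>\<alpha>s. length \<alpha>s = l \<and> set \<alpha>s \<subseteq> simple_set \<and> act \<sigma> = reflection_word (sl n) cartan \<alpha>s"
  thus "card (inversions \<sigma>) \<le> l" using simple_word_inversions assms by metis
qed

definition reversal :: "nat \<Rightarrow> nat" where
  "reversal i = (if i < n then n - 1 - i else i)"

lemma reversal_reversal: "reversal (reversal i) = i"
  by (simp add: reversal_def)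

lemma reversal_perm: "reversal permutes {..<n}"
  by (rule bij_imp_permutes[OF bij_betwI[of _ _ _ reversal]]) (auto simp: reversal_def)

lemma inv_reversal: "perm_inv reversal = reversal"
  by (rule inv_unique_comp) (simp_all add: fun_eq_iff reversal_reversal)

lemma inversions_reversal: "inversions reversal = index_pairs n"
  unfolding inversions_def index_pairs_def reversal_def by auto

lemma full_inversions_reversal:
  assumes "\<sigma> permutes {..<n}" "inversions \<sigma> = index_pairs n"
  shows "\<sigma> = reversal"
proof -
  have "reversal \<circ> \<sigma> = id"
  proof (rule increasing_perm_id)
    show "reversal \<circ> \<sigma> permutes {..<n}" by (rule permutes_compose[OF assms(1) reversal_perm])
    fix a b assume ab: "a < b" "b < n"
    hence "(a, b) \<in> inversions \<sigma>" unfolding assms(2) index_pairs_def by simp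
    hence "\<sigma> b < \<sigma> a" unfolding inversions_def by simp
    moreover have "\<sigma> a < n" using perm_less[OF assms(1)] ab by simp
    ultimately show "(reversal \<circ> \<sigma>) a < (reversal \<circ> \<sigma>) b" unfolding reversal_def by simp
  qed
  hence "reversal (\<sigma> i) = i" for i by (metis comp_apply id_apply)
  thus ?thesis by (metis ext reversal_reversal)
qed

text \<open>
  The reversal inverts all pairs, and it is the only permutation that does.
\<close>

lemma longest_element_eq: "longest_element (sl n) cartan (sl_positive n) = act reversal"
  unfolding longest_element_def
proof (rule the_equality)
  have le: "card (inversions \<sigma>) \<le> card (index_pairs n)" for \<sigma>
    by (rule card_mono) (auto simp: inversions_def)
  show "act reversal \<in> weyl_group (sl n) cartan \<and>
    (\<forall>v\<in>weyl_group (sl n) cartan. weyl_length (sl n) cartan (sl_positive n) v \<le> weyl_length (sl n) cartan (sl_positive n) (act reversal))"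
    unfolding weyl_group_eq using reversal_perm le by (auto simp: weyl_length_act inversions_reversal)
  fix w
  assume w: "w \<in> weyl_group (sl n) cartan \<and>
    (\<forall>v\<in>weyl_group (sl n) cartan. weyl_length (sl n) cartan (sl_positive n) v \<le> weyl_length (sl n) cartan (sl_positive n) w)"
  then obtain \<sigma> where \<sigma>: "\<sigma> permutes {..<n}" "w = act \<sigma>" unfolding weyl_group_eq by auto
  have "card (index_pairs n) \<le> card (inversions \<sigma>)"
    using w reversal_perm \<sigma> unfolding weyl_group_eq by (auto simp: weyl_length_act inversions_reversal dest: bspec[of _ _ "act reversal"])
  hence "inversions \<sigma> = index_pairs n" by (intro card_seteq) (auto simp: inversions_def)
  thus "w = act reversal" using full_inversions_reversal \<sigma> by blast
qed

section \<open>Self-dual and orthogonal weights in coordinates\<close>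

text \<open>
  Twice the half sum of the positive roots, in coordinates.
\<close>

lemma sum_positive_diff:
  fixes v :: "nat \<Rightarrow> complex"
  shows "(\<Sum>(a, b)\<in>index_pairs l. v a - v b) = (\<Sum>a<l. (of_nat l - 1 - 2 * of_nat a) * v a)"
proof (induction l)
  case 0
  show ?case by (simp add: index_pairs_def)
next
  case (Suc l)
  have "index_pairs (Suc l) = index_pairs l \<union> (\<lambda>a. (a, l)) ` {..<l}"
    unfolding index_pairs_def by (auto simp: less_Suc_eq)
  moreover have "index_pairs l \<inter> (\<lambda>a. (a, l)) ` {..<l} = {}" unfolding index_pairs_def by auto
  ultimately have "(\<Sum>(a, b)\<in>index_pairs (Suc l). v a - v b)
      = (\<Sum>(a, b)\<in>index_pairs l. v a - v b) + (\<Sum>(a, b)\<in>(\<lambda>a. (a, l)) ` {..<l}. v a - v b)"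
    by (simp add: sum.union_disjoint)
  also have "(\<Sum>(a, b)\<in>(\<lambda>a. (a, l)) ` {..<l}. v a - v b) = (\<Sum>a<l. v a) - of_nat l * v l"
    by (subst sum.reindex) (auto simp: inj_on_def sum_subtractf)
  finally have "(\<Sum>(a, b)\<in>index_pairs (Suc l). v a - v b)
      = (\<Sum>a<l. (of_nat l - 1 - 2 * of_nat a) * v a + v a) - of_nat l * v l" using Suc by (simp add: sum.distrib)
  also have "(\<Sum>a<l. (of_nat l - 1 - 2 * of_nat a) * v a + v a) = (\<Sum>a<l. (of_nat (Suc l) - 1 - 2 * of_nat a) * v a)"
    by (intro sum.cong) (auto simp: algebra_simps)
  finally show ?case by (simp add: algebra_simps)
qed

lemma half_sum_roots_coroot:
  assumes "i < n" "j < n" "i \<le> j"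
  shows "half_sum_roots (sl_positive n) (coroot_mat i j) = of_nat (j - i)"
proof -
  have "(\<Sum>\<alpha>\<in>sl_positive n. \<alpha> (coroot_mat i j)) = (\<Sum>(a, b)\<in>index_pairs n. sl_root a b (coroot_mat i j))"
    unfolding sl_positive_eq using sum.reindex[OF inj_on_positive_root] by (simp add: case_prod_unfold)
  also have "\<dots> = (\<Sum>(a, b)\<in>index_pairs n. delta i j a - delta i j b)"
    by (intro sum.cong) (use assms in \<open>auto simp: index_pairs_def root_apply\<close>)
  also have "\<dots> = (\<Sum>a<n. delta i j a * (of_nat n - 1 - 2 * of_nat a))"
    unfolding sum_positive_diff by (simp add: mult.commute)
  also have "\<dots> = 2 * of_nat (j - i)" using assms by (simp add: sum_delta_mult of_nat_diff)
  finally show ?thesis unfolding half_sum_roots_def by simp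
qed

abbreviation sd_rank :: nat where "sd_rank \<equiv> n div 2"

text \<open>
  The self-dual weight whose labels are 1 on the \<open>t\<close>-th mirror orbit of nodes and 0 elsewhere.
\<close>

definition sd_basis :: "nat \<Rightarrow> functional" where
  "sd_basis t = functional_of (\<lambda>i. of_nat (card {s \<in> {i..<n - 1}. mirror_label n s = t}))"

text \<open>
  The coordinates, normalised to vanish at \<open>n - 1\<close>, of the functional with mirror symmetric labels
  \<open>x\<close>.
\<close>

definition label_sum :: "(nat \<Rightarrow> real) \<Rightarrow> nat \<Rightarrow> complex" where
  "label_sum x i = of_real (\<Sum>s\<in>{i..<n - 1}. x (mirror_label n s))"

lemma real_combination_sd_basis: "real_combination sd_basis sd_rank x = functional_of (label_sum x)"
proof
  fix H
  have lab: "(\<Sum>t<sd_rank. complex_of_real (x t) * of_nat (card {s \<in> {i..<n - 1}. mirror_label n s = t})) = label_sum x i" for i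
  proof -
    have "(\<Sum>t<sd_rank. complex_of_real (x t) * of_nat (card {s \<in> {i..<n - 1}. mirror_label n s = t}))
        = (\<Sum>t<sd_rank. \<Sum>s\<in>{s \<in> {i..<n - 1}. mirror_label n s = t}. complex_of_real (x (mirror_label n s)))"
      by (intro sum.cong) (auto simp: mult.commute)
    also have "\<dots> = (\<Sum>s\<in>{i..<n - 1}. complex_of_real (x (mirror_label n s)))"
      by (rule sum.group) (use n_ge_2 in \<open>auto intro!: mirror_label_bound\<close>)
    finally show ?thesis unfolding label_sum_def by simp
  qed
  show "real_combination sd_basis sd_rank x H = functional_of (label_sum x) H"
  proof (cases "H \<in> cartan")
    case True
    have "real_combination sd_basis sd_rank x H = (\<Sum>t<sd_rank. \<Sum>i<n. complex_of_real (x t) *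
        (of_nat (card {s \<in> {i..<n - 1}. mirror_label n s = t}) * H $$ (i, i)))"
      using True by (simp add: real_combination_def sd_basis_def functional_of_def sum_distrib_left)
    also have "\<dots> = (\<Sum>i<n. \<Sum>t<sd_rank. complex_of_real (x t) *
        (of_nat (card {s \<in> {i..<n - 1}. mirror_label n s = t}) * H $$ (i, i)))" by (rule sum.swap)
    also have "\<dots> = (\<Sum>i<n. label_sum x i * H $$ (i, i))"
      unfolding lab[symmetric] by (simp add: sum_distrib_right mult.assoc)
    finally show ?thesis using True by (simp add: functional_of_def)
  qed (simp add: real_combination_def sd_basis_def functional_of_def)
qed

lemma label_sum_diff:
  assumes "i \<le> j" "j < n"
  shows "label_sum x i - label_sum x j = of_real (\<Sum>s\<in>{i..<j}. x (mirror_label n s))"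
proof -
  have "{i..<n - 1} = {i..<j} \<union> {j..<n - 1}" using assms by auto
  hence "(\<Sum>s\<in>{i..<n - 1}. x (mirror_label n s)) = (\<Sum>s\<in>{i..<j}. x (mirror_label n s)) + (\<Sum>s\<in>{j..<n - 1}. x (mirror_label n s))"
    by (simp add: sum.union_disjoint ivl_disj_int)
  thus ?thesis unfolding label_sum_def by simp
qed

lemma mirror_label_outer: "t < sd_rank \<Longrightarrow> mirror_label n (n - sd_rank - 1 + t) = t"
  unfolding mirror_label_def by simp

lemma mirror_label_mirror: "s + 1 < n \<Longrightarrow> mirror_label n (n - 2 - s) = mirror_label n s"
proof -
  assume s: "s + 1 < n"
  define k where "k = sd_rank"
  define a where "a = n - 2 - s"
  define b where "b = n - k - 1"
  have k: "n = 2 * k \<or> n = 2 * k + 1" unfolding k_def by presburger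
  have ab: "a + s + 2 = n" "b + k + 1 = n" "k \<ge> 1" using s n_ge_2 k unfolding a_def b_def by auto
  have "(if b \<le> a then a - b else k - 1 - a) = (if b \<le> s then s - b else k - 1 - s)"
    using k ab by (cases "b \<le> a"; cases "b \<le> s") auto
  thus ?thesis unfolding mirror_label_def k_def a_def b_def .
qed

lemma real_independent_sd_basis: "real_independent sd_basis sd_rank"
  unfolding real_independent_def
proof (intro allI impI)
  fix x t assume x: "real_combination sd_basis sd_rank x = 0" and t: "t < sd_rank"
  define s where "s = n - sd_rank - 1 + t"
  have s: "Suc s < n" "mirror_label n s = t" unfolding s_def using t mirror_label_outer[OF t] by auto
  have "0 = functional_of (label_sum x) (coroot_mat s (Suc s))" using x unfolding real_combination_sd_basis by simp
  also have "\<dots> = complex_of_real (x t)"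
    using s label_sum_diff[of s "Suc s" x] by (simp add: functional_of_coroot_mat)
  finally show "x t = 0" by simp
qed

lemma weight_lattice_iff:
  "functional_of \<xi> \<in> weight_lattice (sl n) cartan \<longleftrightarrow> (\<forall>i<n. \<forall>j<n. \<xi> i - \<xi> j \<in> \<int>)"
proof -
  have "functional_of \<xi> \<in> weight_lattice (sl n) cartan \<longleftrightarrow>
      (\<forall>i<n. \<forall>j<n. i \<noteq> j \<longrightarrow> functional_of \<xi> (coroot (sl n) cartan (sl_root i j)) \<in> \<int>)"
    unfolding weight_lattice_def roots_eq using functional_of_in_dual by blast
  also have "\<dots> \<longleftrightarrow> (\<forall>i<n. \<forall>j<n. i \<noteq> j \<longrightarrow> \<xi> i - \<xi> j \<in> \<int>)"
    by (simp add: coroot_root functional_of_coroot_mat)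
  also have "\<dots> \<longleftrightarrow> (\<forall>i<n. \<forall>j<n. \<xi> i - \<xi> j \<in> \<int>)"
    by (metis Ints_0 diff_self)
  finally show ?thesis .
qed

text \<open>
  The condition \<open>w\<^sub>0 \<lambda> = - \<lambda>\<close> says that \<open>\<xi>\<close> and its reversal add up to a constant, that is, that
  the successive differences of \<open>\<xi>\<close> (the Dynkin labels) are mirror symmetric.
\<close>

lemma weights_sd_iff:
  "functional_of \<xi> \<in> weights_sd (sl n) cartan (sl_positive n) \<longleftrightarrow>
     (\<forall>i<n. \<forall>j<n. \<xi> i - \<xi> j \<in> \<int>) \<and> (\<forall>s. Suc s < n \<longrightarrow> \<xi> (n - 2 - s) - \<xi> (Suc (n - 2 - s)) = \<xi> s - \<xi> (Suc s))"
proof -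
  have "act reversal (functional_of \<xi>) = - functional_of \<xi> \<longleftrightarrow>
      functional_of (\<lambda>i. \<xi> (reversal i)) = functional_of (\<lambda>i. - \<xi> i)"
    unfolding act_functional_of[OF reversal_perm] inv_reversal uminus_functional_of ..
  also have "\<dots> \<longleftrightarrow> (\<forall>s. Suc s < n \<longrightarrow> \<xi> (n - 2 - s) - \<xi> (Suc (n - 2 - s)) = \<xi> s - \<xi> (Suc s))"
  proof
    assume eq: "functional_of (\<lambda>i. \<xi> (reversal i)) = functional_of (\<lambda>i. - \<xi> i)"
    show "\<forall>s. Suc s < n \<longrightarrow> \<xi> (n - 2 - s) - \<xi> (Suc (n - 2 - s)) = \<xi> s - \<xi> (Suc s)"
    proof (intro allI impI)
      fix s assume s: "Suc s < n"
      have "functional_of (\<lambda>i. \<xi> (reversal i)) (coroot_mat s (Suc s)) = functional_of (\<lambda>i. - \<xi> i) (coroot_mat s (Suc s))"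
        unfolding eq ..
      hence "\<xi> (reversal s) - \<xi> (reversal (Suc s)) = - \<xi> s + \<xi> (Suc s)" using s by (simp add: functional_of_coroot_mat)
      moreover have rev: "reversal s = Suc (n - 2 - s)" "reversal (Suc s) = n - 2 - s" using s unfolding reversal_def by auto
      ultimately have "\<xi> (Suc (n - 2 - s)) - \<xi> (n - 2 - s) = - \<xi> s + \<xi> (Suc s)" by (simp only: rev)
      hence "- (\<xi> (Suc (n - 2 - s)) - \<xi> (n - 2 - s)) = - (- \<xi> s + \<xi> (Suc s))" by (rule arg_cong)
      thus "\<xi> (n - 2 - s) - \<xi> (Suc (n - 2 - s)) = \<xi> s - \<xi> (Suc s)"
        by (simp only: minus_diff_eq minus_add_distrib minus_minus diff_conv_add_uminus[of "\<xi> s"])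
    qed
  next
    assume sym: "\<forall>s. Suc s < n \<longrightarrow> \<xi> (n - 2 - s) - \<xi> (Suc (n - 2 - s)) = \<xi> s - \<xi> (Suc s)"
    have sum: "\<xi> (n - 1 - i) + \<xi> i = \<xi> (n - 1) + \<xi> 0" if "i < n" for i
      using that
    proof (induction i)
      case (Suc i)
      define a where "a = n - 2 - i"
      have e: "n - 1 - i = Suc a" "n - 1 - Suc i = a" using Suc.prems unfolding a_def by auto
      have step: "\<xi> a - \<xi> (Suc a) = \<xi> i - \<xi> (Suc i)" using sym Suc.prems unfolding a_def by blast
      have IH: "\<xi> (Suc a) + \<xi> i = \<xi> (n - 1) + \<xi> 0" using Suc unfolding e(1) by simp
      have "\<xi> a + \<xi> (Suc i) = (\<xi> a - \<xi> (Suc a)) + \<xi> (Suc a) + \<xi> (Suc i)" by simp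
      also have "\<dots> = \<xi> (Suc a) + \<xi> i" unfolding step by simp
      finally show ?case unfolding e(2) IH .
    qed simp
    show "functional_of (\<lambda>i. \<xi> (reversal i)) = functional_of (\<lambda>i. - \<xi> i)"
    proof (rule functional_of_eqI)
      fix i assume i: "i < n"
      have "reversal i = n - 1 - i" "reversal (n - 1) = 0" using i n_ge_2 unfolding reversal_def by auto
      thus "\<xi> (reversal i) - \<xi> (reversal (n - 1)) = - \<xi> i - - \<xi> (n - 1)"
      proof -
        assume r: "reversal i = n - 1 - i" "reversal (n - 1) = 0"
        have "\<xi> (n - 1 - i) - \<xi> 0 = (\<xi> (n - 1 - i) + \<xi> i) - \<xi> i - \<xi> 0" by simp
        also have "\<dots> = - \<xi> i - - \<xi> (n - 1)" unfolding sum[OF i] by simp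
        finally show ?thesis unfolding r .
      qed
    qed
  qed
  finally show ?thesis unfolding weights_sd_def longest_element_eq using weight_lattice_iff by auto
qed

lemma weights_sd_eq:
  "weights_sd (sl n) cartan (sl_positive n) = {int_combination sd_basis sd_rank x | x. True}"
proof (intro equalityI subsetI)
  fix f assume f: "f \<in> weights_sd (sl n) cartan (sl_positive n)"
  hence "f \<in> dual_space cartan" unfolding weights_sd_def weight_lattice_def by simp
  then obtain \<xi> where \<xi>: "f = functional_of \<xi>" by (rule dual_obtain)
  note sd = f[unfolded \<xi> weights_sd_iff]
  have "\<forall>t. \<exists>z. t < sd_rank \<longrightarrow> \<xi> (n - sd_rank - 1 + t) - \<xi> (Suc (n - sd_rank - 1 + t)) = of_int z"
  proof
    fix t
    show "\<exists>z. t < sd_rank \<longrightarrow> \<xi> (n - sd_rank - 1 + t) - \<xi> (Suc (n - sd_rank - 1 + t)) = of_int z"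
    proof (cases "t < sd_rank")
      case True
      hence "n - sd_rank - 1 + t < n" "Suc (n - sd_rank - 1 + t) < n" by auto
      hence "\<xi> (n - sd_rank - 1 + t) - \<xi> (Suc (n - sd_rank - 1 + t)) \<in> \<int>" using sd by blast
      then obtain z where "\<xi> (n - sd_rank - 1 + t) - \<xi> (Suc (n - sd_rank - 1 + t)) = of_int z" by (rule Ints_cases)
      thus ?thesis by blast
    qed blast
  qed
  then obtain x :: "nat \<Rightarrow> int" where x: "\<And>t. t < sd_rank \<Longrightarrow> \<xi> (n - sd_rank - 1 + t) - \<xi> (Suc (n - sd_rank - 1 + t)) = of_int (x t)"
    by metis
  have lab: "\<xi> s - \<xi> (Suc s) = of_int (x (mirror_label n s))" if s: "Suc s < n" for s
  proof (cases "n - sd_rank - 1 \<le> s")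
    case True
    have "mirror_label n s = s - (n - sd_rank - 1)" "s - (n - sd_rank - 1) < sd_rank" using True s unfolding mirror_label_def by auto
    thus ?thesis using x[of "s - (n - sd_rank - 1)"] True by simp
  next
    case False
    define k where "k = sd_rank"
    have k: "n = 2 * k \<or> n = 2 * k + 1" unfolding k_def by presburger
    have e: "mirror_label n s = k - 1 - s" "n - 2 - s = n - k - 1 + (k - 1 - s)" "k - 1 - s < k"
      using False s k unfolding mirror_label_def k_def[symmetric] by auto
    have "\<xi> s - \<xi> (Suc s) = \<xi> (n - 2 - s) - \<xi> (Suc (n - 2 - s))" using sd s by simp
    also have "\<dots> = of_int (x (k - 1 - s))" unfolding e(2) using x[folded k_def, OF e(3)] .
    finally show ?thesis unfolding e(1) .
  qed
  have "functional_of \<xi> = functional_of (label_sum (\<lambda>t. of_int (x t)))"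
  proof (rule functional_of_eqI)
    fix i assume i: "i < n"
    have "label_sum (\<lambda>t. of_int (x t)) i = (\<Sum>s\<in>{i..<n - 1}. \<xi> s - \<xi> (Suc s))"
    proof -
      have "label_sum (\<lambda>t. of_int (x t)) i = (\<Sum>s\<in>{i..<n - 1}. of_int (x (mirror_label n s)))"
        unfolding label_sum_def by simp
      also have "\<dots> = (\<Sum>s\<in>{i..<n - 1}. \<xi> s - \<xi> (Suc s))"
        by (intro sum.cong refl lab[symmetric]) auto
      finally show ?thesis .
    qed
    also have "\<dots> = \<xi> i - \<xi> (n - 1)" using sum_Suc_diff'[of i "n - 1" "\<lambda>s. - \<xi> s"] i by simp
    finally show "\<xi> i - \<xi> (n - 1) = label_sum (\<lambda>t. of_int (x t)) i - label_sum (\<lambda>t. of_int (x t)) (n - 1)"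
      by (simp add: label_sum_def)
  qed
  thus "f \<in> {int_combination sd_basis sd_rank x | x. True}" unfolding \<xi> real_combination_sd_basis by blast
next
  fix f assume "f \<in> {int_combination sd_basis sd_rank x | x. True}"
  then obtain x where f: "f = functional_of (label_sum (\<lambda>t. of_int (x t)))"
    unfolding real_combination_sd_basis by blast
  have int: "label_sum (\<lambda>t. of_int (x t)) i \<in> \<int>" for i unfolding label_sum_def of_real_sum by (rule Ints_sum) simp
  have lab: "label_sum (\<lambda>t. of_int (x t)) s - label_sum (\<lambda>t. of_int (x t)) (Suc s) = of_int (x (mirror_label n s))"
    if "Suc s < n" for s
    using label_sum_diff[of s "Suc s" "\<lambda>t. of_int (x t)"] that by simp
  show "f \<in> weights_sd (sl n) cartan (sl_positive n)"
    unfolding f weights_sd_iff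
  proof (intro conjI allI impI)
    fix s assume s: "Suc s < n"
    hence s': "Suc (n - 2 - s) < n" using n_ge_2 by simp
    show "label_sum (\<lambda>t. of_int (x t)) (n - 2 - s) - label_sum (\<lambda>t. of_int (x t)) (Suc (n - 2 - s))
        = label_sum (\<lambda>t. of_int (x t)) s - label_sum (\<lambda>t. of_int (x t)) (Suc s)"
      unfolding lab[OF s] lab[OF s'] using mirror_label_mirror[of s] s by simp
  qed (intro Ints_diff int)
qed

text \<open>
  Numerator and denominator of each factor are differences of staircase values and of positions.
\<close>

lemma weyl_dim_sd:
  "weyl_dim (sl n) cartan (sl_positive n) (int_combination sd_basis sd_rank x)
     = of_int (vandermonde (staircase n x) n) / of_int (vandermonde int n)"
proof -
  define f where "f = functional_of (label_sum (\<lambda>t. of_int (x t)))"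
  have pair: "(f + half_sum_roots (sl_positive n)) (coroot (sl n) cartan (sl_root i j)) / half_sum_roots (sl_positive n) (coroot (sl n) cartan (sl_root i j))
     = of_int (staircase n x j - staircase n x i) / of_int (int j - int i)" if "i < j" "j < n" for i j
  proof -
    have ij: "i < n" "j < n" "i \<noteq> j" "i \<le> j" using that by auto
    have "staircase n x j - staircase n x i = (\<Sum>s\<in>{i..<j}. x (mirror_label n s)) + int (j - i)"
      unfolding staircase_diff[OF ij(4)] by (simp add: sum.distrib)
    hence "complex_of_int (staircase n x j - staircase n x i) = f (coroot_mat i j) + of_nat (j - i)"
      unfolding f_def functional_of_coroot_mat[OF ij(1,2)] label_sum_diff[OF ij(4,2)] by simp
    moreover have "complex_of_int (int j - int i) = of_nat (j - i)" using ij by (simp add: of_nat_diff)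
    ultimately show ?thesis unfolding coroot_root[OF ij(1-3)] by (simp add: half_sum_roots_coroot[OF ij(1,2,4)])
  qed
  have "weyl_dim (sl n) cartan (sl_positive n) f
      = (\<Prod>(i, j)\<in>index_pairs n. (f + half_sum_roots (sl_positive n)) (coroot (sl n) cartan (sl_root i j)) / half_sum_roots (sl_positive n) (coroot (sl n) cartan (sl_root i j)))"
    unfolding weyl_dim_def by (subst (1) sl_positive_eq, subst prod.reindex[OF inj_on_positive_root]) (simp add: case_prod_unfold)
  also have "\<dots> = (\<Prod>(i, j)\<in>index_pairs n. of_int (staircase n x j - staircase n x i) / of_int (int j - int i))"
  proof (rule prod.cong[OF refl])
    fix p assume "p \<in> index_pairs n"
    then obtain i j where p: "p = (i, j)" "i < j" "j < n" unfolding index_pairs_def by auto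
    show "(case p of (i, j) \<Rightarrow> (f + half_sum_roots (sl_positive n)) (coroot (sl n) cartan (sl_root i j)) / half_sum_roots (sl_positive n) (coroot (sl n) cartan (sl_root i j)))
        = (case p of (i, j) \<Rightarrow> of_int (staircase n x j - staircase n x i) / of_int (int j - int i))"
      unfolding p(1) prod.case by (rule pair[OF p(2,3)])
  qed
  also have "\<dots> = of_int (vandermonde (staircase n x) n) / of_int (vandermonde int n)"
    unfolding vandermonde_def by (simp add: case_prod_unfold prod_dividef)
  finally show ?thesis unfolding f_def real_combination_sd_basis .
qed

lemma weights_not_div_iff:
  "int_combination sd_basis sd_rank x \<in> weights_not_div m (sl n) cartan (sl_positive n) \<longleftrightarrow> non_multiple n m x"
proof -
  have "int_combination sd_basis sd_rank x \<in> weights_sd (sl n) cartan (sl_positive n)" unfolding weights_sd_eq by blast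
  hence "int_combination sd_basis sd_rank x \<in> weight_lattice (sl n) cartan" unfolding weights_sd_def by simp
  moreover have "(weyl_dim (sl n) cartan (sl_positive n) (int_combination sd_basis sd_rank x) = of_nat m * of_int c)
      \<longleftrightarrow> vandermonde (staircase n x) n = int m * vandermonde int n * c" for c
  proof -
    have "(weyl_dim (sl n) cartan (sl_positive n) (int_combination sd_basis sd_rank x) = of_nat m * of_int c)
      \<longleftrightarrow> complex_of_int (vandermonde (staircase n x) n) = complex_of_int (int m * vandermonde int n * c)"
      unfolding weyl_dim_sd using vandermonde_int_pos[of n] by (simp add: divide_eq_eq mult_ac)
    thus ?thesis by (simp only: of_int_eq_iff)
  qed
  ultimately show ?thesis unfolding weights_not_div_def non_multiple_def dvd_def by simp
qed

text \<open>
  The pairing with \<open>2 \<rho>\<^sup>\<or>\<close>, a sum of coroots, is an integral linear form in the labels.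
\<close>

lemma weights_orth_iff:
  "\<exists>c :: nat \<Rightarrow> int. \<forall>x. int_combination sd_basis sd_rank x \<in> weights_orth n (sl n) cartan (sl_positive n)
      \<longleftrightarrow> even (\<Sum>t<sd_rank. c t * x t)"
proof -
  define H where "H = 2 \<cdot>\<^sub>m half_sum_coroots n (sl n) cartan (sl_positive n)"
  have "H $$ (i, i) \<in> \<int>" if i: "i < n" for i
  proof -
    have "H $$ (i, i) = (\<Sum>\<alpha>\<in>sl_positive n. coroot (sl n) cartan \<alpha> $$ (i, i))"
      using i by (simp add: H_def half_sum_coroots_def)
    also have "\<dots> \<in> \<int>"
    proof (rule Ints_sum)
      fix \<alpha> assume "\<alpha> \<in> sl_positive n"
      then obtain a b where "\<alpha> = sl_root a b" "a < b" "b < n" unfolding sl_positive_eq index_pairs_def by auto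
      thus "coroot (sl n) cartan \<alpha> $$ (i, i) \<in> \<int>" using i by (simp add: coroot_root delta_def of_bool_def)
    qed
    finally show ?thesis .
  qed
  hence "sd_basis t H \<in> \<int>" for t unfolding sd_basis_def functional_of_def by (auto intro!: Ints_sum Ints_mult)
  hence "\<forall>t. \<exists>c. sd_basis t H = of_int c" by (auto elim: Ints_cases)
  then obtain c where c: "\<And>t. sd_basis t H = of_int (c t)" by metis
  have val: "int_combination sd_basis sd_rank x H = of_int (\<Sum>t<sd_rank. c t * x t)" for x
    unfolding real_combination_def c by (simp add: mult.commute)
  have sd: "int_combination sd_basis sd_rank x \<in> weights_sd (sl n) cartan (sl_positive n)" for x
    unfolding weights_sd_eq by blast
  have "int_combination sd_basis sd_rank x \<in> weights_orth n (sl n) cartan (sl_positive n) \<longleftrightarrow> even (\<Sum>t<sd_rank. c t * x t)" for x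
  proof -
    have "int_combination sd_basis sd_rank x \<in> weights_orth n (sl n) cartan (sl_positive n)
        \<longleftrightarrow> (\<exists>z::int. complex_of_int (\<Sum>t<sd_rank. c t * x t) = complex_of_int (2 * z))"
      unfolding weights_orth_def H_def[symmetric] using sd val[of x] by simp
    thus ?thesis unfolding of_int_eq_iff dvd_def .
  qed
  thus ?thesis by blast
qed

lemma density_bounds:
  assumes m: "m > 0"
  shows "sl_density_sd m n \<le> real (omega m) * exp (- (real n / (36 * real m)))"
    and "sl_density_orth m n \<le> 2 * real (omega m) * exp (- (real n / (36 * real m)))"
proof -
  obtain M :: int where M: "M > 0" "even M" "int m * vandermonde int n dvd M"
    and bound: "real (card {x \<in> PiE {..<sd_rank} (\<lambda>_. {0..<M}). non_multiple n m x})
       \<le> real (card (prime_factors m)) * exp (- (real n / (36 * real m))) * real_of_int M ^ sd_rank"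
    by (rule card_non_multiple[OF n_ge_2 m])
  define E where "E = real (omega m) * exp (- (real n / (36 * real m)))"
  have bound: "real (card {x \<in> PiE {..<sd_rank} (\<lambda>_. {0..<M}). non_multiple n m x}) \<le> E * real_of_int M ^ sd_rank"
    using bound unfolding E_def omega_def .
  have r: "sd_rank > 0" using n_ge_2 by simp
  have per: "non_multiple n m x = non_multiple n m y" if "\<And>t. t < sd_rank \<Longrightarrow> [x t = y t] (mod M)" for x y
    using non_multiple_periodic[OF n_ge_2 M(3)] that by blast
  have Mp: "real_of_int M ^ sd_rank > 0" using M(1) by simp
  have "weights_not_div m (sl n) cartan (sl_positive n) \<inter> weights_sd (sl n) cartan (sl_positive n)
      = {int_combination sd_basis sd_rank x | x. non_multiple n m x}"
    unfolding weights_sd_eq using weights_not_div_iff by auto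
  hence "sl_density_sd m n = density {int_combination sd_basis sd_rank x | x. non_multiple n m x} {int_combination sd_basis sd_rank x | x. True}"
    unfolding sl_density_sd_def density_sd_def weights_sd_eq by simp
  also have "\<dots> = real (card {c \<in> PiE {..<sd_rank} (\<lambda>_. {0..<M}). non_multiple n m c}) / real (card {c \<in> PiE {..<sd_rank} (\<lambda>_. {0..<M}). True})"
    by (rule density_periodic[OF r real_independent_sd_basis M(1)]) (use per in blast)+
  also have "real (card {c \<in> PiE {..<sd_rank} (\<lambda>_. {0..<M}). True}) = real_of_int M ^ sd_rank"
    using M(1) by (simp add: card_PiE)
  also have "real (card {c \<in> PiE {..<sd_rank} (\<lambda>_. {0..<M}). non_multiple n m c}) / real_of_int M ^ sd_rank \<le> E"
    using bound Mp by (simp add: divide_le_eq)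
  finally show "sl_density_sd m n \<le> real (omega m) * exp (- (real n / (36 * real m)))" unfolding E_def .
  obtain c :: "nat \<Rightarrow> int" where c: "\<And>x. int_combination sd_basis sd_rank x \<in> weights_orth n (sl n) cartan (sl_positive n)
      \<longleftrightarrow> even (\<Sum>t<sd_rank. c t * x t)"
    using weights_orth_iff by auto
  define R where "R = (\<lambda>x. even (\<Sum>t<sd_rank. c t * x t))"
  define P where "P = (\<lambda>x. non_multiple n m x \<and> R x)"
  have sub: "weights_orth n (sl n) cartan (sl_positive n) \<subseteq> weights_sd (sl n) cartan (sl_positive n)"
    unfolding weights_orth_def by auto
  have orth: "weights_orth n (sl n) cartan (sl_positive n) = {int_combination sd_basis sd_rank x | x. R x}"
    using sub c unfolding weights_sd_eq R_def by blast
  have "weights_not_div m (sl n) cartan (sl_positive n) \<inter> weights_orth n (sl n) cartan (sl_positive n)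
      = {int_combination sd_basis sd_rank x | x. P x}"
  proof (intro equalityI subsetI)
    fix v assume v: "v \<in> weights_not_div m (sl n) cartan (sl_positive n) \<inter> weights_orth n (sl n) cartan (sl_positive n)"
    then obtain x where x: "v = int_combination sd_basis sd_rank x" "R x" unfolding orth by auto
    have "non_multiple n m x" using v weights_not_div_iff[of x m] unfolding x(1) by simp
    thus "v \<in> {int_combination sd_basis sd_rank x | x. P x}" unfolding P_def using x by blast
  next
    fix v assume "v \<in> {int_combination sd_basis sd_rank x | x. P x}"
    thus "v \<in> weights_not_div m (sl n) cartan (sl_positive n) \<inter> weights_orth n (sl n) cartan (sl_positive n)"
      unfolding orth P_def using weights_not_div_iff by auto
  qed
  hence "sl_density_orth m n = density {int_combination sd_basis sd_rank x | x. P x} {int_combination sd_basis sd_rank x | x. R x}"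
    unfolding sl_density_orth_def density_orth_def orth by simp
  also have "\<dots> = real (card {c \<in> PiE {..<sd_rank} (\<lambda>_. {0..<M}). P c}) / real (card {c \<in> PiE {..<sd_rank} (\<lambda>_. {0..<M}). R c})"
  proof (rule density_periodic[OF r real_independent_sd_basis M(1)])
    show perR: "R x = R y" if "\<And>t. t < sd_rank \<Longrightarrow> [x t = y t] (mod M)" for x y
    proof -
      have "[(\<Sum>t<sd_rank. c t * x t) = (\<Sum>t<sd_rank. c t * y t)] (mod M)"
        by (intro cong_sum cong_mult cong_refl) (use that in auto)
      hence "[(\<Sum>t<sd_rank. c t * x t) = (\<Sum>t<sd_rank. c t * y t)] (mod 2)" using M(2) by (rule cong_dvd_modulus)
      thus ?thesis unfolding R_def using cong_dvd_iff by blast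
    qed
    show "P x = P y" if "\<And>t. t < sd_rank \<Longrightarrow> [x t = y t] (mod M)" for x y
      unfolding P_def using perR[of x y] per[of x y] that by blast
    show "R (\<lambda>_. 0)" unfolding R_def by simp
  qed
  also have "\<dots> \<le> (E * real_of_int M ^ sd_rank) / (real_of_int M ^ sd_rank / 2)"
  proof (rule frac_le)
    have "card {c \<in> PiE {..<sd_rank} (\<lambda>_. {0..<M}). P c} \<le> card {c \<in> PiE {..<sd_rank} (\<lambda>_. {0..<M}). non_multiple n m c}"
      unfolding P_def by (intro card_mono finite_subset[OF _ finite_PiE[of "{..<sd_rank}" "\<lambda>_. {0..<M}"]]) auto
    thus "real (card {c \<in> PiE {..<sd_rank} (\<lambda>_. {0..<M}). P c}) \<le> E * real_of_int M ^ sd_rank" using bound by linarith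
    show "real_of_int M ^ sd_rank / 2 \<le> real (card {c \<in> PiE {..<sd_rank} (\<lambda>_. {0..<M}). R c})"
      using card_even_combinations[OF M(2,1), of sd_rank c] unfolding R_def by simp
  qed (use Mp in \<open>auto simp: E_def\<close>)
  also have "\<dots> = 2 * E"
  proof -
    have "E * q / (q / 2) = 2 * E" if "q > 0" for q :: real using that by simp
    from this[OF Mp] show ?thesis .
  qed
  finally show "sl_density_orth m n \<le> 2 * real (omega m) * exp (- (real n / (36 * real m)))" unfolding E_def by simp
qed

end

theorem theorem6p1:
  fixes n m :: nat
  assumes "n \<ge> 2" and "m > 0"
  shows "sl_density_sd m n \<le> real (omega m) * exp (- (real n / (36 * real m))) \<and>
         sl_density_orth m n \<le> 2 * real (omega m) * exp (- (real n / (36 * real m)))"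
proof -
  interpret special_linear n by unfold_locales (rule assms(1))
  show ?thesis using density_bounds[OF assms(2)] by blast
qed

end
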